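(* Let $(\Lambda,w,\mathscr{H},\varepsilon)$ be an input datum over $k$, with associated Lie algebra $\mathfrak{h}$, lift $\widetilde w\in\operatorname{Aut}(\mathfrak{h})$ of $w$, and $\mathfrak{g}=\mathfrak{h}^{\widetilde w}$. Let $k/k_0$ be a finite Galois extension with group $\Gamma=\operatorname{Gal}(k/k_0)$, and let $\theta:\langle\zeta\rangle\to\operatorname{Aut}(\Lambda)$ be the homomorphism with $\theta(\zeta)=w$. Suppose given homomorphisms $\Gamma\to\operatorname{Aut}(\Lambda)$ and $\Gamma\to\operatorname{Aut}(\mathscr{H})$ such that: (A1) $\sigma\theta(\zeta^i)\sigma^{-1}=\theta(\sigma(\zeta^i))$ in $\operatorname{Aut}(\Lambda)$ for all $\sigma\in\Gamma$ and all $i$; (A2) the action of $\Gamma$ on $\mathscr{H}$ restricts to the natural Galois action on $\langle\zeta\rangle$; (A3) the naturally induced homomorphisms $\Gamma\to\operatorname{Aut}(\Lambda)\to\operatorname{Aut}(\Lambda_w)$ and $\Gamma\to\operatorname{Aut}(\mathscr{H})\to\operatorname{Aut}(\Lambda_w)$ are the same. Suppose moreover that the following two conditions hold for all $\sigma\in\Gamma$: (1) $\sigma(\langle\alpha,\beta\rangle)=\langle\sigma(\alpha),\sigma(\beta)\rangle$ for all $\alpha,\beta\in\Lambda$; (2) $\sigma(\varepsilon(\alpha,\beta))=\varepsilon(\sigma(\alpha),\sigma(\beta))$ for all $\alpha,\beta\in\Lambda$. Then there is a natural semilinear action of $\Gamma$ on $\mathfrak{h}$ preserving $\mathfrak{g}$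 such that $\mathfrak{h}^\Gamma$ and $\mathfrak{g}^\Gamma$ are $k_0$-forms of the Lie algebras $\mathfrak{h}$ and $\mathfrak{g}$, respectively.
   Context: A lattice is a finitely generated free $\mathbb{Z}$-module $\Lambda$ with a symmetric positive-definite bilinear form $(\cdot,\cdot):\Lambda\times\Lambda\to\mathbb{Z}$; $\operatorname{Aut}(\Lambda)$ is the group of $\mathbb{Z}$-linear bijections preserving the form. $\Lambda$ is a simply laced root lattice if it is generated by its set of roots $\Phi=\{\alpha\in\Lambda : (\alpha,\alpha)=2\}$. For $\gamma\in\Lambda$, $\gamma^\vee\in\operatorname{Hom}(\Lambda,\mathbb{Z})$ is $\gamma^\vee(\alpha)=(\gamma,\alpha)$. An automorphism $w\in\operatorname{Aut}(\Lambda)$ is elliptic if the group of coinvariants $\Lambda_w=\Lambda/(1-w)\Lambda$ is finite. Setting: $\Lambda$ is a simply laced root lattice, $w$ an elliptic automorphism of $\Lambda$ of order $d$, $k$ a field of characteristic zero containing a primitive $d$th root of unity $\zeta$, and $1\to\langle\zeta\rangle\to\mathscr{H}\to\Lambda_w\to1$ a central extension with commutator pairing $\langle\cdot,\cdot\rangle:\Lambda_w\times\Lambda_w\to\langle\zeta\rangle$. Let $\widetilde\Lambda=\Lambda\times_{\Lambda_w}\mathscr{H}$, a central extension of $\Lambda$ by $\langle\zeta\rangle$; its commutator pairing on $\Lambda$ (the pullback of that on $\Lambda_w$) is also written $\langle\cdot,\cdot\rangle$. Let $\widetilde\Phi$ be the preimage of $\Phi$ in $\widetilde\Lambda$; for $\tilde\alpha\in\widetilde\Phi$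 write $\alpha$ for its image in $\Phi$. The quadruple $(\Lambda,w,\mathscr{H},\varepsilon)$ is an input datum if $\varepsilon:\Lambda\times\Lambda\to k^\times$ is bilinear (multiplicative in each variable) and: (i) $\varepsilon(\alpha,\beta)/\varepsilon(\beta,\alpha)=-\langle\beta,\alpha\rangle$ whenever $(\alpha,\beta)=-1$; (ii) $\varepsilon(w\alpha,w\beta)=\varepsilon(\alpha,\beta)$ for all $\alpha,\beta\in\Lambda$. Construction of $\mathfrak{h}$: $\mathfrak{t}=\operatorname{Hom}(\Lambda,k)$, spanned by $\{\alpha^\vee:\alpha\in\Phi\}$; $\mathfrak{l}$ is the $k$-vector space generated by symbols $X_{\tilde\alpha}$, $\tilde\alpha\in\widetilde\Phi$, modulo the relations $X_{\zeta\tilde\alpha}=\zeta X_{\tilde\alpha}$; $\mathfrak{h}=\mathfrak{t}\oplus\mathfrak{l}$. It is a Lie algebra under the $k$-bilinear bracket with $[\mathfrak{t},\mathfrak{t}]=0$, $[\alpha^\vee,X_{\tilde\beta}]=-[X_{\tilde\beta},\alpha^\vee]=(\alpha,\beta)X_{\tilde\beta}$, and $[X_{\tilde\alpha},X_{\tilde\beta}]=\varepsilon(\alpha,\beta)\,\tilde\alpha\tilde\beta\,\alpha^\vee$ if $\alpha+\beta=0$ (with $\tilde\alpha\tilde\beta\in\langle\zeta\rangle\subset k^\times$ a scalar), $\varepsilon(\alpha,\beta)X_{\tilde\alpha\tilde\beta}$ if $\alpha+\beta\in\Phi$, and $0$ otherwise. Lift of $w$: extend $w$ to $\widetilde\Lambda$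 by $w(\lambda,h)=(w\lambda,h)$; then $\widetilde w\in\operatorname{Aut}(\mathfrak{h})$ is the order-$d$ Lie algebra automorphism with $\widetilde w(\alpha^\vee)=w(\alpha)^\vee$ for $\alpha\in\Phi$ and $\widetilde w(X_{\tilde\alpha})=X_{w(\tilde\alpha)}$ for $\tilde\alpha\in\widetilde\Phi$. A semilinear action of $\Gamma$ on $\mathfrak{h}$ is an action in which each $\sigma\in\Gamma$ acts by a $\sigma$-linear map. A $k_0$-form of a $k$-Lie algebra $\mathfrak{a}$ is a $k_0$-Lie subalgebra $\mathfrak{a}_0\subset\mathfrak{a}$ with $\mathfrak{a}_0\otimes_{k_0}k\to\mathfrak{a}$ an isomorphism. *)

theory Defs
  imports
    "HOL-Algebra.Algebraic_Closure_Type"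
    "HOL-Algebra.Free_Abelian_Groups"
    "HOL-Algebra.Group_Action"
    "HOL-Algebra.Module"
begin

section \<open>Lattices\<close>

abbreviation fld :: "'k::field ring"
  where "fld \<equiv> ring_of_type_algebra"

definition add_grp :: "'a::ab_group_add monoid"
  where "add_grp = \<lparr>carrier = UNIV, monoid.mult = (+), one = 0\<rparr>"

definition int_lattice :: "('l::ab_group_add \<Rightarrow> 'l \<Rightarrow> int) \<Rightarrow> bool"
  where "int_lattice ip \<longleftrightarrow>
    (\<exists>S::nat set. finite S \<and> (add_grp :: 'l monoid) \<cong> free_Abelian_group S) \<and>
    (\<forall>x y. ip x y = ip y x) \<and>
    (\<forall>x y z. ip (x + y) z = ip x z + ip y z) \<and>
    (\<forall>x. x \<noteq> 0 \<longrightarrow> ip x x > 0)"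

definition roots :: "('l::ab_group_add \<Rightarrow> 'l \<Rightarrow> int) \<Rightarrow> 'l set"
  where "roots ip = {\<alpha>. ip \<alpha> \<alpha> = 2}"

definition simply_laced_root_lattice :: "('l::ab_group_add \<Rightarrow> 'l \<Rightarrow> int) \<Rightarrow> bool"
  where "simply_laced_root_lattice ip \<longleftrightarrow> int_lattice ip \<and> generate add_grp (roots ip) = UNIV"

definition lattice_aut :: "('l::ab_group_add \<Rightarrow> 'l \<Rightarrow> int) \<Rightarrow> ('l \<Rightarrow> 'l) monoid"
  where "lattice_aut ip =
    \<lparr>carrier = {f \<in> iso add_grp add_grp. \<forall>x y. ip (f x) (f y) = ip x y},
     monoid.mult = (\<circ>), one = id\<rparr>"

definition coinvariants :: "('l::ab_group_add \<Rightarrow> 'l) \<Rightarrow> 'l set monoid"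
  where "coinvariants w = add_grp Mod range (\<lambda>x. x - w x)"

definition coinv_class :: "('l::ab_group_add \<Rightarrow> 'l) \<Rightarrow> 'l \<Rightarrow> 'l set"
  where "coinv_class w x = range (\<lambda>y. y - w y) #>\<^bsub>add_grp\<^esub> x"

definition elliptic :: "('l::ab_group_add \<Rightarrow> 'l) \<Rightarrow> bool"
  where "elliptic w \<longleftrightarrow> finite (carrier (coinvariants w))"

text \<open>The functional \<open>\<gamma>\<^sup>\<or>\<close>, viewed as an element of \<open>Hom(\<Lambda>, k)\<close>.\<close>

definition coroot :: "('l \<Rightarrow> 'l \<Rightarrow> int) \<Rightarrow> 'l \<Rightarrow> 'l \<Rightarrow> 'k::ring_1"
  where "coroot ip \<gamma> = (\<lambda>x. of_int (ip \<gamma> x))"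


section \<open>Central extensions\<close>

definition central_extension ::
    "('a, 'm) monoid_scheme \<Rightarrow> ('e, 'n) monoid_scheme \<Rightarrow> ('q, 'r) monoid_scheme \<Rightarrow>
     ('a \<Rightarrow> 'e) \<Rightarrow> ('e \<Rightarrow> 'q) \<Rightarrow> bool"
  where "central_extension A E Q \<iota> \<pi> \<longleftrightarrow>
    group A \<and> group E \<and> group Q \<and>
    \<iota> \<in> mon A E \<and> \<pi> \<in> epi E Q \<and> kernel E Q \<pi> = \<iota> ` carrier A \<and>
    (\<forall>z\<in>carrier A. \<forall>x\<in>carrier E. \<iota> z \<otimes>\<^bsub>E\<^esub> x = x \<otimes>\<^bsub>E\<^esub> \<iota> z)"

text \<open>The convention is \<open>[x, y] = x y x\<^sup>-\<^sup>1 y\<^sup>-\<^sup>1\<close>; centrality makes it independent of the lifts.\<close>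

definition commutator_pairing ::
    "('a, 'm) monoid_scheme \<Rightarrow> ('e, 'n) monoid_scheme \<Rightarrow> ('a \<Rightarrow> 'e) \<Rightarrow> ('e \<Rightarrow> 'q) \<Rightarrow> 'q \<Rightarrow> 'q \<Rightarrow> 'a"
  where "commutator_pairing A E \<iota> \<pi> a b =
    (THE z. z \<in> carrier A \<and>
      (\<exists>x\<in>carrier E. \<exists>y\<in>carrier E. \<pi> x = a \<and> \<pi> y = b \<and>
         \<iota> z = x \<otimes>\<^bsub>E\<^esub> y \<otimes>\<^bsub>E\<^esub> inv\<^bsub>E\<^esub> x \<otimes>\<^bsub>E\<^esub> inv\<^bsub>E\<^esub> y))"

definition root_of_unity_grp :: "'k::field \<Rightarrow> 'k monoid"
  where "root_of_unity_grp \<zeta> = subgroup_generated (mult_of fld) {\<zeta>}"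


section \<open>Free, quotient and tensor constructions for modules\<close>

text \<open>As usual for the record type of modules, the ring fields \<open>mult\<close> and \<open>one\<close> carry no meaning.\<close>

definition free_module :: "'s set \<Rightarrow> ('k::field, 's \<Rightarrow>\<^sub>0 'k) module"
  where "free_module S =
    \<lparr>carrier = {p. Poly_Mapping.keys p \<subseteq> S}, monoid.mult = undefined, one = undefined,
     ring.zero = 0, add = (+), module.smult = (\<lambda>c. Poly_Mapping.map ((*) c))\<rparr>"

definition submodule_generated ::
    "('a, 'r) ring_scheme \<Rightarrow> ('a, 'b, 'm) module_scheme \<Rightarrow> 'b set \<Rightarrow> 'b set"
  where "submodule_generated R M A = \<Inter>{N. submodule N R M \<and> A \<subseteq> N}"

definition quotient_module :: "('a, 'b, 'm) module_scheme \<Rightarrow> 'b set \<Rightarrow> ('a, 'b set) module"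
  where "quotient_module M N =
    \<lparr>carrier = a_rcosets\<^bsub>M\<^esub> N, monoid.mult = undefined, one = undefined,
     ring.zero = N, add = (<+>\<^bsub>M\<^esub>), module.smult = (\<lambda>c C. \<Union>x\<in>C. N +>\<^bsub>M\<^esub> (c \<odot>\<^bsub>M\<^esub> x))\<rparr>"

definition tensor_free ::
    "('a, 'b, 'm) module_scheme \<Rightarrow> ('a, 'c, 'n) module_scheme \<Rightarrow> ('b \<times> 'c \<Rightarrow>\<^sub>0 int) monoid"
  where "tensor_free M N = free_Abelian_group (carrier M \<times> carrier N)"

definition tensor_relations ::
    "('a, 'r) ring_scheme \<Rightarrow> ('a, 'b, 'm) module_scheme \<Rightarrow> ('a, 'c, 'n) module_scheme \<Rightarrow>
     ('b \<times> 'c \<Rightarrow>\<^sub>0 int) set"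
  where "tensor_relations R M N =
    {frag_of (x \<oplus>\<^bsub>M\<^esub> x', y) - frag_of (x, y) - frag_of (x', y) | x x' y.
        x \<in> carrier M \<and> x' \<in> carrier M \<and> y \<in> carrier N} \<union>
    {frag_of (x, y \<oplus>\<^bsub>N\<^esub> y') - frag_of (x, y) - frag_of (x, y') | x y y'.
        x \<in> carrier M \<and> y \<in> carrier N \<and> y' \<in> carrier N} \<union>
    {frag_of (a \<odot>\<^bsub>M\<^esub> x, y) - frag_of (x, a \<odot>\<^bsub>N\<^esub> y) | a x y.
        a \<in> carrier R \<and> x \<in> carrier M \<and> y \<in> carrier N}"

definition tensor_product ::
    "('a, 'r) ring_scheme \<Rightarrow> ('a, 'b, 'm) module_scheme \<Rightarrow> ('a, 'c, 'n) module_scheme \<Rightarrow>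
     ('b \<times> 'c \<Rightarrow>\<^sub>0 int) set monoid"
  where "tensor_product R M N =
    tensor_free M N Mod generate (tensor_free M N) (tensor_relations R M N)"

definition pure_tensor ::
    "('a, 'r) ring_scheme \<Rightarrow> ('a, 'b, 'm) module_scheme \<Rightarrow> ('a, 'c, 'n) module_scheme \<Rightarrow>
     'b \<Rightarrow> 'c \<Rightarrow> ('b \<times> 'c \<Rightarrow>\<^sub>0 int) set"
  where "pure_tensor R M N x y =
    generate (tensor_free M N) (tensor_relations R M N) #>\<^bsub>tensor_free M N\<^esub> frag_of (x, y)"

definition fld_module :: "('k::field, 'k) module"
  where "fld_module =
    \<lparr>carrier = UNIV, monoid.mult = (*), one = 1, ring.zero = 0, add = (+), module.smult = (*)\<rparr>"


section \<open>Galois actions and forms\<close>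

definition galois_group :: "'k::field set \<Rightarrow> ('k \<Rightarrow> 'k) monoid"
  where "galois_group k\<^sub>0 =
    \<lparr>carrier = {\<sigma> \<in> ring_iso fld fld. \<forall>x\<in>k\<^sub>0. \<sigma> x = x}, monoid.mult = (\<circ>), one = id\<rparr>"

text \<open>\<open>k\<close> is the whole type; \<open>k / k\<^sub>0\<close> is Galois if the fixed field of \<open>Aut(k / k\<^sub>0)\<close> is \<open>k\<^sub>0\<close>.\<close>

definition finite_galois_extension :: "'k::field set \<Rightarrow> bool"
  where "finite_galois_extension k\<^sub>0 \<longleftrightarrow>
    subfield k\<^sub>0 fld \<and> ring.finite_dimension fld k\<^sub>0 UNIV \<and>
    {x. \<forall>\<sigma>\<in>carrier (galois_group k\<^sub>0). \<sigma> x = x} = k\<^sub>0"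

record ('a, 'b) lie_algebra = "('a, 'b) module" +
  lie_bracket :: "'b \<Rightarrow> 'b \<Rightarrow> 'b"

definition semilinear_action ::
    "('k::field \<Rightarrow> 'k) monoid \<Rightarrow> ('k, 'v, 'm) module_scheme \<Rightarrow> (('k \<Rightarrow> 'k) \<Rightarrow> 'v \<Rightarrow> 'v) \<Rightarrow> bool"
  where "semilinear_action \<Gamma> M act \<longleftrightarrow>
    group_action \<Gamma> (carrier M) act \<and>
    (\<forall>\<sigma>\<in>carrier \<Gamma>. \<forall>x\<in>carrier M. \<forall>y\<in>carrier M.
       act \<sigma> (x \<oplus>\<^bsub>M\<^esub> y) = act \<sigma> x \<oplus>\<^bsub>M\<^esub> act \<sigma> y) \<and>
    (\<forall>\<sigma>\<in>carrier \<Gamma>. \<forall>c. \<forall>x\<in>carrier M. act \<sigma> (c \<odot>\<^bsub>M\<^esub> x) = \<sigma> c \<odot>\<^bsub>M\<^esub> act \<sigma> x)"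

definition fixed_points ::
    "('g, 'n) monoid_scheme \<Rightarrow> ('v, 'm) partial_object_scheme \<Rightarrow> ('g \<Rightarrow> 'v \<Rightarrow> 'v) \<Rightarrow> 'v set"
  where "fixed_points \<Gamma> M act = {x \<in> carrier M. \<forall>\<sigma>\<in>carrier \<Gamma>. act \<sigma> x = x}"

text \<open>The map induced by \<open>f\<close> on the quotient \<open>p ` A\<close> of \<open>A\<close>.\<close>

definition induced_map :: "'a set \<Rightarrow> ('a \<Rightarrow> 'q) \<Rightarrow> ('a \<Rightarrow> 'a) \<Rightarrow> 'q \<Rightarrow> 'q"
  where "induced_map A p f c = the_elem {p (f x) | x. x \<in> A \<and> p x = c}"

text \<open>
  The last conjunct says that the natural map \<open>L0 \<otimes> k \<rightarrow> L\<close>, \<open>x \<otimes> c \<mapsto> c x\<close>, is an isomorphism.  Since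
  pure tensors generate, \<open>\<phi>\<close> is this map, and it is automatically \<open>k\<close>-linear and compatible with
  the brackets.
\<close>

definition is_form ::
    "'k::field set \<Rightarrow> ('k, 'v, 'm) lie_algebra_scheme \<Rightarrow> 'v set \<Rightarrow> bool"
  where "is_form k\<^sub>0 L L0 \<longleftrightarrow>
    submodule L0 (fld\<lparr>carrier := k\<^sub>0\<rparr>) L \<and>
    (\<forall>x\<in>L0. \<forall>y\<in>L0. lie_bracket L x y \<in> L0) \<and>
    (\<exists>\<phi>\<in>iso (tensor_product (fld\<lparr>carrier := k\<^sub>0\<rparr>) (L\<lparr>carrier := L0\<rparr>) fld_module) (add_monoid L).
       \<forall>x\<in>L0. \<forall>c. \<phi> (pure_tensor (fld\<lparr>carrier := k\<^sub>0\<rparr>) (L\<lparr>carrier := L0\<rparr>) fld_module x c)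
                     = c \<odot>\<^bsub>L\<^esub> x)"


section \<open>The Lie algebra attached to an input datum\<close>

context
  fixes ip :: "'l::ab_group_add \<Rightarrow> 'l \<Rightarrow> int"
    and w :: "'l \<Rightarrow> 'l"
    and \<zeta> :: "'k::field_char_0"
    and H :: "('h, 'm) monoid_scheme"
    and \<iota> :: "'k \<Rightarrow> 'h"
    and \<pi> :: "'h \<Rightarrow> 'l set"
    and \<epsilon> :: "'l \<Rightarrow> 'l \<Rightarrow> 'k"
begin

definition lattice_pairing :: "'l \<Rightarrow> 'l \<Rightarrow> 'k"
  where "lattice_pairing \<alpha> \<beta> =
    commutator_pairing (root_of_unity_grp \<zeta>) H \<iota> \<pi> (coinv_class w \<alpha>) (coinv_class w \<beta>)"

text \<open>The fibre product of \<open>\<Lambda>\<close> and \<open>H\<close> over the coinvariants.\<close>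

definition ext_lattice :: "('l \<times> 'h) monoid"
  where "ext_lattice =
    (add_grp \<times>\<times> H)\<lparr>carrier := {(x, h). h \<in> carrier H \<and> \<pi> h = coinv_class w x}\<rparr>"

definition ext_incl :: "'k \<Rightarrow> 'l \<times> 'h"
  where "ext_incl z = (0, \<iota> z)"

text \<open>The scalar in \<open>\<langle>\<zeta>\<rangle>\<close> given by an element of the fibre of the extended lattice over \<open>0\<close>.\<close>

definition ext_scalar :: "'l \<times> 'h \<Rightarrow> 'k"
  where "ext_scalar = inv_into (carrier (root_of_unity_grp \<zeta>)) ext_incl"

definition ext_roots :: "('l \<times> 'h) set"
  where "ext_roots = {a \<in> carrier ext_lattice. fst a \<in> roots ip}"

definition symbol_relations :: "('l \<times> 'h \<Rightarrow>\<^sub>0 'k) set"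
  where "symbol_relations =
    submodule_generated fld (free_module ext_roots)
      {Poly_Mapping.single (ext_incl \<zeta> \<otimes>\<^bsub>ext_lattice\<^esub> a) 1 - Poly_Mapping.single a \<zeta> | a. a \<in> ext_roots}"

definition l_space :: "('k, ('l \<times> 'h \<Rightarrow>\<^sub>0 'k) set) module"
  where "l_space = quotient_module (free_module ext_roots) symbol_relations"

definition l_class :: "('l \<times> 'h \<Rightarrow>\<^sub>0 'k) \<Rightarrow> ('l \<times> 'h \<Rightarrow>\<^sub>0 'k) set"
  where "l_class p = symbol_relations +>\<^bsub>free_module ext_roots\<^esub> p"

definition t_space :: "('k, 'l \<Rightarrow> 'k) module"
  where "t_space =
    \<lparr>carrier = {f. \<forall>x y. f (x + y) = f x + f y}, monoid.mult = undefined, one = undefined,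
     ring.zero = (\<lambda>_. 0), add = (\<lambda>f g x. f x + g x), module.smult = (\<lambda>c f x. c * f x)\<rparr>"

text \<open>
  The bracket on free representatives.  The action of \<open>t\<close> on \<open>l\<close> is the \<open>k\<close>-linear extension
  \<open>[f, X\<^sub>b] = f(\<beta>) X\<^sub>b\<close> of \<open>[\<alpha>\<^sup>\<or>, X\<^sub>b] = (\<alpha>, \<beta>) X\<^sub>b\<close>, as \<open>(\<alpha>, \<beta>) = \<alpha>\<^sup>\<or>(\<beta>)\<close>; the other two
  functions are the \<open>t\<close>- and \<open>l\<close>-components of the bracket of two elements of \<open>l\<close>.  All of them
  descend to the quotient, where the values on generators are those of
  \<open>h_bracket_coroot_coroot\<close> to \<open>h_bracket_X_X_zero\<close> below.
\<close>

definition free_t_action :: "('l \<Rightarrow> 'k) \<Rightarrow> ('l \<times> 'h \<Rightarrow>\<^sub>0 'k) \<Rightarrow> ('l \<times> 'h \<Rightarrow>\<^sub>0 'k)"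
  where "free_t_action f p = (\<Sum>b\<in>Poly_Mapping.keys p.
    Poly_Mapping.single b (f (fst b) * Poly_Mapping.lookup p b))"

definition free_bracket_t :: "('l \<times> 'h \<Rightarrow>\<^sub>0 'k) \<Rightarrow> ('l \<times> 'h \<Rightarrow>\<^sub>0 'k) \<Rightarrow> ('l \<Rightarrow> 'k)"
  where "free_bracket_t p q = (\<lambda>x. \<Sum>a\<in>Poly_Mapping.keys p. \<Sum>b\<in>Poly_Mapping.keys q.
    if fst a + fst b = 0
    then Poly_Mapping.lookup p a * Poly_Mapping.lookup q b *
         (\<epsilon> (fst a) (fst b) * ext_scalar (a \<otimes>\<^bsub>ext_lattice\<^esub> b) * coroot ip (fst a) x)
    else 0)"

definition free_bracket_l :: "('l \<times> 'h \<Rightarrow>\<^sub>0 'k) \<Rightarrow> ('l \<times> 'h \<Rightarrow>\<^sub>0 'k) \<Rightarrow> ('l \<times> 'h \<Rightarrow>\<^sub>0 'k)"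
  where "free_bracket_l p q = (\<Sum>a\<in>Poly_Mapping.keys p. \<Sum>b\<in>Poly_Mapping.keys q.
    if fst a + fst b \<in> roots ip
    then Poly_Mapping.single (a \<otimes>\<^bsub>ext_lattice\<^esub> b)
           (Poly_Mapping.lookup p a * Poly_Mapping.lookup q b * \<epsilon> (fst a) (fst b))
    else 0)"

definition h_bracket ::
    "('l \<Rightarrow> 'k) \<times> ('l \<times> 'h \<Rightarrow>\<^sub>0 'k) set \<Rightarrow> ('l \<Rightarrow> 'k) \<times> ('l \<times> 'h \<Rightarrow>\<^sub>0 'k) set \<Rightarrow>
     ('l \<Rightarrow> 'k) \<times> ('l \<times> 'h \<Rightarrow>\<^sub>0 'k) set"
  where "h_bracket = (\<lambda>(f, C) (g, D).
    (the_elem (\<Union>p\<in>C. \<Union>q\<in>D. {free_bracket_t p q}),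
     \<Union>p\<in>C. \<Union>q\<in>D. l_class (free_t_action f q - free_t_action g p + free_bracket_l p q)))"

definition h_alg :: "('k, ('l \<Rightarrow> 'k) \<times> ('l \<times> 'h \<Rightarrow>\<^sub>0 'k) set) lie_algebra"
  where "h_alg =
    \<lparr>carrier = carrier t_space \<times> carrier l_space, monoid.mult = undefined, one = undefined,
     ring.zero = (\<zero>\<^bsub>t_space\<^esub>, \<zero>\<^bsub>l_space\<^esub>),
     add = (\<lambda>(f, C) (g, D). (f \<oplus>\<^bsub>t_space\<^esub> g, C \<oplus>\<^bsub>l_space\<^esub> D)),
     module.smult = (\<lambda>c (f, C). (c \<odot>\<^bsub>t_space\<^esub> f, c \<odot>\<^bsub>l_space\<^esub> C)),
     lie_bracket = h_bracket\<rparr>"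

definition h_coroot :: "'l \<Rightarrow> ('l \<Rightarrow> 'k) \<times> ('l \<times> 'h \<Rightarrow>\<^sub>0 'k) set"
  where "h_coroot \<alpha> = (coroot ip \<alpha>, \<zero>\<^bsub>l_space\<^esub>)"

definition h_X :: "'l \<times> 'h \<Rightarrow> ('l \<Rightarrow> 'k) \<times> ('l \<times> 'h \<Rightarrow>\<^sub>0 'k) set"
  where "h_X a = (\<zero>\<^bsub>t_space\<^esub>, l_class (Poly_Mapping.single a 1))"

text \<open>
  On \<open>t\<close> the lift of \<open>w\<close> is \<open>f \<mapsto> f \<circ> w\<^sup>-\<^sup>1\<close>, which sends \<open>\<alpha>\<^sup>\<or>\<close> to \<open>(w \<alpha>)\<^sup>\<or>\<close> because \<open>w\<close> preserves the
  form; on \<open>l\<close> it permutes the symbols through \<open>(\<lambda>, h) \<mapsto> (w \<lambda>, h)\<close>.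
\<close>

definition w_lift ::
    "('l \<Rightarrow> 'k) \<times> ('l \<times> 'h \<Rightarrow>\<^sub>0 'k) set \<Rightarrow> ('l \<Rightarrow> 'k) \<times> ('l \<times> 'h \<Rightarrow>\<^sub>0 'k) set"
  where "w_lift = (\<lambda>(f, C).
    (f \<circ> inv_into UNIV w,
     \<Union>p\<in>C. l_class (\<Sum>a\<in>Poly_Mapping.keys p.
       Poly_Mapping.single (w (fst a), snd a) (Poly_Mapping.lookup p a))))"

definition g_alg :: "('k, ('l \<Rightarrow> 'k) \<times> ('l \<times> 'h \<Rightarrow>\<^sub>0 'k) set) lie_algebra"
  where "g_alg = h_alg\<lparr>carrier := {x \<in> carrier h_alg. w_lift x = x}\<rparr>"

definition input_datum :: "nat \<Rightarrow> bool"
  where "input_datum d \<longleftrightarrow>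
    simply_laced_root_lattice ip \<and>
    w \<in> carrier (lattice_aut ip) \<and> elliptic w \<and>
    d > 0 \<and> group.ord (lattice_aut ip) w = d \<and>
    \<zeta> \<noteq> 0 \<and> group.ord (mult_of fld) \<zeta> = d \<and>
    central_extension (root_of_unity_grp \<zeta>) H (coinvariants w) \<iota> \<pi> \<and>
    (\<forall>\<alpha> \<beta>. \<epsilon> \<alpha> \<beta> \<noteq> 0) \<and>
    (\<forall>\<alpha> \<beta> \<gamma>. \<epsilon> (\<alpha> + \<beta>) \<gamma> = \<epsilon> \<alpha> \<gamma> * \<epsilon> \<beta> \<gamma>) \<and>
    (\<forall>\<alpha> \<beta> \<gamma>. \<epsilon> \<alpha> (\<beta> + \<gamma>) = \<epsilon> \<alpha> \<beta> * \<epsilon> \<alpha> \<gamma>) \<and>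
    (\<forall>\<alpha> \<beta>. ip \<alpha> \<beta> = -1 \<longrightarrow> \<epsilon> \<alpha> \<beta> / \<epsilon> \<beta> \<alpha> = - lattice_pairing \<beta> \<alpha>) \<and>
    (\<forall>\<alpha> \<beta>. \<epsilon> (w \<alpha>) (w \<beta>) = \<epsilon> \<alpha> \<beta>)"

end


section \<open>Values on generators\<close>

text \<open>
  The bracket and the lift of \<open>w\<close> are compatible with the relations
  \<open>X\<^bsub>\<zeta>a\<^esub> = \<zeta> X\<^sub>a\<close>; the bracket is bilinear and both take the expected values on generators:
  see \<open>h_bracket_bilinear\<close>, \<open>h_X_scale\<close>, \<open>h_bracket_coroot_coroot\<close>, \<open>h_bracket_coroot_X\<close>,
  \<open>h_bracket_X_X_opposite\<close>, \<open>h_bracket_X_X_root\<close>, \<open>h_bracket_X_X_zero\<close>, \<open>w_lift_coroot\<close>,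
  \<open>w_lift_X\<close>.
\<close>

lemma sum_keys_superset:
  assumes "finite S" "Poly_Mapping.keys p \<subseteq> S" "\<And>a. G a 0 = (0::'c::comm_monoid_add)"
  shows "(\<Sum>a\<in>Poly_Mapping.keys p. G a (Poly_Mapping.lookup p a)) = (\<Sum>a\<in>S. G a (Poly_Mapping.lookup p a))"
  using assms by (intro sum.mono_neutral_left) (auto simp: in_keys_iff)

lemma sum_keys_add:
  assumes "\<And>a. G a 0 = (0::'c::comm_monoid_add)" "\<And>a x y. G a (x + y) = G a x + G a y"
  shows "(\<Sum>a\<in>Poly_Mapping.keys (p + q). G a (Poly_Mapping.lookup (p + q) a)) =
    (\<Sum>a\<in>Poly_Mapping.keys p. G a (Poly_Mapping.lookup p a)) +
    (\<Sum>a\<in>Poly_Mapping.keys q. G a (Poly_Mapping.lookup q a))"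
proof -
  let ?S = "Poly_Mapping.keys p \<union> Poly_Mapping.keys q"
  have s: "finite ?S" "Poly_Mapping.keys (p + q) \<subseteq> ?S" "Poly_Mapping.keys p \<subseteq> ?S" "Poly_Mapping.keys q \<subseteq> ?S"
    using Poly_Mapping.keys_add[of p q] by auto
  have e: "Poly_Mapping.keys r \<subseteq> ?S \<Longrightarrow> (\<Sum>a\<in>Poly_Mapping.keys r. G a (Poly_Mapping.lookup r a)) = (\<Sum>a\<in>?S. G a (Poly_Mapping.lookup r a))" for r
    by (rule sum_keys_superset) (use s assms in auto)
  show ?thesis
    using e[OF s(2)] e[OF s(3)] e[OF s(4)]
    by (simp add: lookup_add assms(2) sum.distrib)
qed

lemma lookup_map_mult [simp]:
  "Poly_Mapping.lookup (Poly_Mapping.map ((*) c) p) a = (c::'k::field) * Poly_Mapping.lookup p a"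
  by transfer (auto simp: when_def)

lemma keys_map_mult: "Poly_Mapping.keys (Poly_Mapping.map ((*) (c::'k::field)) p) \<subseteq> Poly_Mapping.keys p"
  by (auto simp: in_keys_iff)

lemma map_mult_single [simp]:
  "Poly_Mapping.map ((*) (c::'k::field)) (Poly_Mapping.single a x) = Poly_Mapping.single a (c * x)"
  by (rule poly_mapping_eqI) (auto simp: lookup_single when_def)

lemma map_mult_add [simp]:
  "Poly_Mapping.map ((*) (c::'k::field)) (p + q) = Poly_Mapping.map ((*) c) p + Poly_Mapping.map ((*) c) q"
  by (rule poly_mapping_eqI) (auto simp: lookup_add algebra_simps)

lemma map_mult_diff [simp]:
  "Poly_Mapping.map ((*) (c::'k::field)) (p - q) = Poly_Mapping.map ((*) c) p - Poly_Mapping.map ((*) c) q"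
  by (rule poly_mapping_eqI) (auto simp: lookup_minus algebra_simps)

lemma map_mult_zero [simp]: "Poly_Mapping.map ((*) (c::'k::field)) 0 = 0"
  by (rule poly_mapping_eqI) auto

lemma map_mult_sum:
  "Poly_Mapping.map ((*) (c::'k::field)) (sum P A) = (\<Sum>x\<in>A. Poly_Mapping.map ((*) c) (P x))"
  by (induction A rule: infinite_finite_induct) auto

lemma sum_keys_scale:
  fixes c :: "'k::field"
  assumes "\<And>a. G a 0 = (0::'c::comm_monoid_add)" "\<And>a x. G a (c * x) = s (G a x)"
    "s 0 = 0" "\<And>x y. s (x + y) = s x + s y"
  shows "(\<Sum>a\<in>Poly_Mapping.keys (Poly_Mapping.map ((*) c) p). G a (Poly_Mapping.lookup (Poly_Mapping.map ((*) c) p) a)) =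
    s (\<Sum>a\<in>Poly_Mapping.keys p. G a (Poly_Mapping.lookup p a))"
proof -
  have ss: "s (sum P A) = (\<Sum>x\<in>A. s (P x))" for P :: "'a \<Rightarrow> 'c" and A
    by (induction A rule: infinite_finite_induct) (auto simp: assms)
  have "(\<Sum>a\<in>Poly_Mapping.keys (Poly_Mapping.map ((*) c) p). G a (Poly_Mapping.lookup (Poly_Mapping.map ((*) c) p) a)) =
     (\<Sum>a\<in>Poly_Mapping.keys p. G a (Poly_Mapping.lookup (Poly_Mapping.map ((*) c) p) a))"
    by (rule sum_keys_superset, rule finite_keys, rule keys_map_mult, rule assms(1))
  then show ?thesis
    by (simp add: assms(2) ss)
qed

lemma sum_keys_single:
  assumes "G a 0 = (0::'c::comm_monoid_add)"
  shows "(\<Sum>a\<in>Poly_Mapping.keys (Poly_Mapping.single a x). G a (Poly_Mapping.lookup (Poly_Mapping.single a x) a)) = G a x"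
  using assms by (cases "x = 0") auto

lemma free_module_simps [simp]:
  "carrier (free_module S) = {p. Poly_Mapping.keys p \<subseteq> S}"
  "\<zero>\<^bsub>free_module S\<^esub> = 0"
  "p \<oplus>\<^bsub>free_module S\<^esub> q = p + q"
  "c \<odot>\<^bsub>free_module S\<^esub> p = Poly_Mapping.map ((*) c) p"
  by (simp_all add: free_module_def)

lemma fld_simps [simp]: "carrier (fld :: 'k::field ring) = UNIV" "\<zero>\<^bsub>fld\<^esub> = (0::'k)"
  by (simp_all add: ring_of_type_algebra_def)

lemma group_free_add: "group (add_monoid (free_module S :: ('k::field, _) module))"
proof (rule groupI, goal_cases)
  case (1 x y)
  then show ?case using Poly_Mapping.keys_add[of x y] by auto
next
  case (5 x)
  then show ?case by (auto intro!: exI[of _ "- x"])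
qed (auto simp: add.assoc)

lemma inv_free_add:
  assumes "Poly_Mapping.keys p \<subseteq> S"
  shows "inv\<^bsub>add_monoid (free_module S :: ('k::field, _) module)\<^esub> p = - p"
  by (rule group.inv_equality[OF group_free_add]) (use assms in auto)

lemma submodule_freeI:
  fixes N :: "('s \<Rightarrow>\<^sub>0 'k::field) set"
  assumes "N \<subseteq> {p. Poly_Mapping.keys p \<subseteq> S}" "0 \<in> N" "\<And>p q. p \<in> N \<Longrightarrow> q \<in> N \<Longrightarrow> p + q \<in> N"
    "\<And>c p. p \<in> N \<Longrightarrow> Poly_Mapping.map ((*) c) p \<in> N"
  shows "submodule N fld (free_module S)"
proof (intro submodule.intro subgroup.intro submodule_axioms.intro)
  fix p assume p: "p \<in> N"
  have "- p = Poly_Mapping.map ((*) (-1)) p" by (rule poly_mapping_eqI) simp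
  then show "inv\<^bsub>add_monoid (free_module S)\<^esub> p \<in> N"
    using assms(1) assms(4)[OF p, of "-1"] p by (subst inv_free_add) auto
qed (use assms in auto)

lemma submodule_freeD:
  fixes N :: "('s \<Rightarrow>\<^sub>0 'k::field) set"
  assumes "submodule N fld (free_module S)"
  shows "N \<subseteq> {p. Poly_Mapping.keys p \<subseteq> S}" "0 \<in> N" "\<And>p q. p \<in> N \<Longrightarrow> q \<in> N \<Longrightarrow> p + q \<in> N"
    "\<And>c p. p \<in> N \<Longrightarrow> Poly_Mapping.map ((*) c) p \<in> N"
proof -
  interpret submodule N fld "free_module S" by fact
  show "N \<subseteq> {p. Poly_Mapping.keys p \<subseteq> S}" using subset by auto
  show "0 \<in> N" using one_closed by simp
  show "\<And>p q. p \<in> N \<Longrightarrow> q \<in> N \<Longrightarrow> p + q \<in> N" using m_closed by simp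
  show "\<And>c p. p \<in> N \<Longrightarrow> Poly_Mapping.map ((*) c) p \<in> N" using smult_closed by simp
qed

context
  fixes ip :: "'l::ab_group_add \<Rightarrow> 'l \<Rightarrow> int"
    and w :: "'l \<Rightarrow> 'l"
    and \<zeta> :: "'k::field_char_0"
    and H :: "('h, 'm) monoid_scheme"
    and \<iota> :: "'k \<Rightarrow> 'h"
    and \<pi> :: "'h \<Rightarrow> 'l set"
    and \<epsilon> :: "'l \<Rightarrow> 'l \<Rightarrow> 'k"
    and d :: nat
  assumes D: "input_datum ip w \<zeta> H \<iota> \<pi> \<epsilon> d"
begin

private abbreviation (input) "Z \<equiv> root_of_unity_grp \<zeta>"
private abbreviation (input) "EL \<equiv> ext_lattice w H \<pi>"
private abbreviation (input) "ER \<equiv> ext_roots ip w H \<pi>"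
private abbreviation (input) "F \<equiv> (free_module ER :: ('k, 'l \<times> 'h \<Rightarrow>\<^sub>0 'k) module)"
private abbreviation (input) "N \<equiv> symbol_relations ip w \<zeta> H \<iota> \<pi>"
private abbreviation (input) "cls \<equiv> l_class ip w \<zeta> H \<iota> \<pi>"
private abbreviation (input) "sc \<equiv> ext_scalar \<zeta> \<iota> :: 'l \<times> 'h \<Rightarrow> 'k"
private abbreviation (input) "inc \<equiv> ext_incl \<iota> :: 'k \<Rightarrow> 'l \<times> 'h"

lemma CE: "central_extension Z H (coinvariants w) \<iota> \<pi>"
  using D by (simp add: input_datum_def)

lemma zeta_nz: "\<zeta> \<noteq> 0" using D by (simp add: input_datum_def)

lemma groups: "group H" "group Z" "group (coinvariants w)"
  using CE by (auto simp: central_extension_def)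

lemma root_simps [simp]: "\<one>\<^bsub>Z\<^esub> = 1" "x \<otimes>\<^bsub>Z\<^esub> y = x * y"
  by (simp_all add: root_of_unity_grp_def subgroup_generated_def ring_of_type_algebra_def)

lemma zeta_in [simp]: "\<zeta> \<in> carrier Z"
  by (auto simp: root_of_unity_grp_def carrier_subgroup_generated zeta_nz intro!: generate.incl)
 
lemma coinv_mult: "coinv_class w x \<otimes>\<^bsub>coinvariants w\<^esub> coinv_class w y = coinv_class w (x + y)"
proof -
  have wa: "w (x + y) = w x + w y" for x y
    using D by (auto simp: input_datum_def lattice_aut_def iso_def hom_def add_grp_def)
  have w0: "w 0 = 0" using wa[of 0 0] by simp
  show ?thesis
    unfolding coinv_class_def coinvariants_def FactGroup_def r_coset_def set_mult_def add_grp_def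
  proof (rule Set.set_eqI, rule iffI, goal_cases)
    case (1 z)
    then obtain a b where "z = a - w a + x + (b - w b + y)" by (auto simp: monoid.simps)
    then have "z = (a + b) - w (a + b) + (x + y)" by (simp add: wa algebra_simps)
    then show ?case by auto
  next
    case (2 z)
    then obtain a where "z = a - w a + (x + y)" by auto
    then have "z = (a - w a + x) + (0 - w 0 + y)" by (simp add: w0 algebra_simps)
    then show ?case by (auto simp: w0) (rule exI[of _ a], rule exI[of _ 0], simp add: w0)
  qed
qed

lemma pi_mult: "x \<in> carrier H \<Longrightarrow> y \<in> carrier H \<Longrightarrow> \<pi> (x \<otimes>\<^bsub>H\<^esub> y) = \<pi> x \<otimes>\<^bsub>coinvariants w\<^esub> \<pi> y"
  using CE by (auto simp: central_extension_def epi_def hom_def)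

lemma EL_simps [simp]: "a \<in> carrier EL \<longleftrightarrow> snd a \<in> carrier H \<and> \<pi> (snd a) = coinv_class w (fst a)"
  "a \<otimes>\<^bsub>EL\<^esub> b = (fst a + fst b, snd a \<otimes>\<^bsub>H\<^esub> snd b)"
  by (auto simp: ext_lattice_def DirProd_def add_grp_def split: prod.splits)

lemma coinv_class_0: "coinv_class w 0 = \<one>\<^bsub>coinvariants w\<^esub>"
  by (auto simp: coinv_class_def coinvariants_def FactGroup_def r_coset_def add_grp_def)

lemma inc_iff: "a \<in> carrier EL \<and> fst a = 0 \<longleftrightarrow> a \<in> inc ` carrier Z"
proof -
  have "kernel H (coinvariants w) \<pi> = \<iota> ` carrier Z" using CE by (simp add: central_extension_def)
  then show ?thesis
  proof -
    have "h \<in> \<iota> ` carrier Z \<longleftrightarrow> h \<in> carrier H \<and> \<pi> h = \<one>\<^bsub>coinvariants w\<^esub>" for h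
      unfolding \<open>kernel H (coinvariants w) \<pi> = \<iota> ` carrier Z\<close>[symmetric] kernel_def by simp
    then show ?thesis
      by (cases a) (force simp: ext_incl_def coinv_class_0 image_iff)
  qed
qed

lemma inj_inc: "inj_on inc (carrier Z)"
  using CE by (auto simp: central_extension_def mon_def ext_incl_def inj_on_def)

lemma sc_inc [simp]: "z \<in> carrier Z \<Longrightarrow> sc (inc z) = z"
  by (simp add: ext_scalar_def inv_into_f_f[OF inj_inc])

lemma inc_mult: "z \<in> carrier Z \<Longrightarrow> y \<in> carrier Z \<Longrightarrow> inc (z * y) = inc z \<otimes>\<^bsub>EL\<^esub> inc y"
  using CE by (auto simp: central_extension_def mon_def ext_incl_def hom_def)

lemma iota_in: "z \<in> carrier Z \<Longrightarrow> \<iota> z \<in> carrier H"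
  using CE by (auto simp: central_extension_def mon_def hom_def)

lemma central: "z \<in> carrier Z \<Longrightarrow> x \<in> carrier H \<Longrightarrow> \<iota> z \<otimes>\<^bsub>H\<^esub> x = x \<otimes>\<^bsub>H\<^esub> \<iota> z"
  using CE by (auto simp: central_extension_def)

lemma EL_closed: "a \<in> carrier EL \<Longrightarrow> b \<in> carrier EL \<Longrightarrow> a \<otimes>\<^bsub>EL\<^esub> b \<in> carrier EL"
  using groups by (auto simp: pi_mult coinv_mult group.is_monoid monoid.m_closed)

lemma EL_assoc: "a \<in> carrier EL \<Longrightarrow> b \<in> carrier EL \<Longrightarrow> c \<in> carrier EL \<Longrightarrow>
    a \<otimes>\<^bsub>EL\<^esub> b \<otimes>\<^bsub>EL\<^esub> c = a \<otimes>\<^bsub>EL\<^esub> (b \<otimes>\<^bsub>EL\<^esub> c)"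
  using groups by (simp add: group.is_monoid monoid.m_assoc add.assoc)

lemma inc_in: "z \<in> carrier Z \<Longrightarrow> inc z \<in> carrier EL"
  using inc_iff by blast

lemma EL_central: "a \<in> carrier EL \<Longrightarrow> z \<in> carrier Z \<Longrightarrow> inc z \<otimes>\<^bsub>EL\<^esub> a = a \<otimes>\<^bsub>EL\<^esub> inc z"
  by (simp add: ext_incl_def central)

lemma inc_zeta_root: "a \<in> ER \<Longrightarrow> inc \<zeta> \<otimes>\<^bsub>EL\<^esub> a \<in> ER"
  using EL_closed[OF inc_in[OF zeta_in], of a] by (auto simp: ext_roots_def ext_incl_def)

lemma ER_EL: "a \<in> ER \<Longrightarrow> a \<in> carrier EL" by (auto simp: ext_roots_def)

lemma fst_inc_mult [simp]: "fst (inc z \<otimes>\<^bsub>EL\<^esub> a) = fst a" by (simp add: ext_incl_def)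

lemma sc_zeta_left:
  assumes "a \<in> carrier EL" "b \<in> carrier EL" "fst a + fst b = 0"
  shows "sc (inc \<zeta> \<otimes>\<^bsub>EL\<^esub> a \<otimes>\<^bsub>EL\<^esub> b) = \<zeta> * sc (a \<otimes>\<^bsub>EL\<^esub> b)"
proof -
  have "a \<otimes>\<^bsub>EL\<^esub> b \<in> inc ` carrier Z" using assms EL_closed inc_iff[of "a \<otimes>\<^bsub>EL\<^esub> b"] by auto
  then obtain z where z: "z \<in> carrier Z" "a \<otimes>\<^bsub>EL\<^esub> b = inc z" by blast
  have m: "\<zeta> * z \<in> carrier Z" using group.is_monoid[OF groups(2)] z zeta_in
    by (metis monoid.m_closed root_simps(2))
  have "inc \<zeta> \<otimes>\<^bsub>EL\<^esub> a \<otimes>\<^bsub>EL\<^esub> b = inc (\<zeta> * z)"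
    using EL_assoc[OF inc_in[OF zeta_in] assms(1,2)] z by (simp only: inc_mult zeta_in)
  then show ?thesis using z m by (simp only: sc_inc)
qed

lemma zeta_right:
  assumes "a \<in> carrier EL" "b \<in> carrier EL"
  shows "a \<otimes>\<^bsub>EL\<^esub> (inc \<zeta> \<otimes>\<^bsub>EL\<^esub> b) = inc \<zeta> \<otimes>\<^bsub>EL\<^esub> a \<otimes>\<^bsub>EL\<^esub> b"
  using EL_assoc[OF assms(1) inc_in[OF zeta_in] assms(2)] EL_central[OF assms(1) zeta_in] by metis


lemma keys_rel: "a \<in> ER \<Longrightarrow> Poly_Mapping.keys (Poly_Mapping.single (inc \<zeta> \<otimes>\<^bsub>EL\<^esub> a) 1 - Poly_Mapping.single a \<zeta>) \<subseteq> ER"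
  using inc_zeta_root[of a] by (auto dest!: subsetD[OF keys_diff] split: if_splits)

lemma N_sub: "submodule N fld F"
proof (rule submodule_freeI)
  let ?R = "{Poly_Mapping.single (inc \<zeta> \<otimes>\<^bsub>EL\<^esub> a) (1::'k) - Poly_Mapping.single a \<zeta> | a. a \<in> ER}"
  have "submodule {p::_ \<Rightarrow>\<^sub>0 'k. Poly_Mapping.keys p \<subseteq> ER} fld F"
    by (rule submodule_freeI) (auto dest!: subsetD[OF Poly_Mapping.keys_add] subsetD[OF keys_map_mult])
  moreover have "?R \<subseteq> {p. Poly_Mapping.keys p \<subseteq> ER}" using keys_rel by blast
  ultimately show "N \<subseteq> {p. Poly_Mapping.keys p \<subseteq> ER}"
    unfolding symbol_relations_def submodule_generated_def by blast
qed (auto simp: symbol_relations_def submodule_generated_def dest: submodule_freeD)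

lemmas N_facts = submodule_freeD[OF N_sub]

lemma N_rel: "a \<in> ER \<Longrightarrow> Poly_Mapping.single (inc \<zeta> \<otimes>\<^bsub>EL\<^esub> a) (1::'k) - Poly_Mapping.single a \<zeta> \<in> N"
  unfolding symbol_relations_def submodule_generated_def by blast

lemma N_induct [consumes 1, case_names zero add scale rel]:
  assumes "p \<in> N" "P 0" "\<And>p q. Poly_Mapping.keys p \<subseteq> ER \<Longrightarrow> Poly_Mapping.keys q \<subseteq> ER \<Longrightarrow> P p \<Longrightarrow> P q \<Longrightarrow> P (p + q)"
    "\<And>c p. Poly_Mapping.keys p \<subseteq> ER \<Longrightarrow> P p \<Longrightarrow> P (Poly_Mapping.map ((*) c) p)"
    "\<And>a. a \<in> ER \<Longrightarrow> P (Poly_Mapping.single (inc \<zeta> \<otimes>\<^bsub>EL\<^esub> a) (1::'k) - Poly_Mapping.single a \<zeta>)"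
  shows "P p"
proof -
  let ?R = "{Poly_Mapping.single (inc \<zeta> \<otimes>\<^bsub>EL\<^esub> a) (1::'k) - Poly_Mapping.single a \<zeta> | a. a \<in> ER}"
  have "submodule {p. Poly_Mapping.keys p \<subseteq> ER \<and> P p} fld F"
    by (rule submodule_freeI) (use assms in \<open>auto dest!: subsetD[OF Poly_Mapping.keys_add] subsetD[OF keys_map_mult]\<close>)
  moreover have "?R \<subseteq> {p. Poly_Mapping.keys p \<subseteq> ER \<and> P p}" using keys_rel assms(5) by blast
  ultimately have "N \<subseteq> {p. Poly_Mapping.keys p \<subseteq> ER \<and> P p}"
    unfolding symbol_relations_def submodule_generated_def by blast
  then show ?thesis using assms(1) by blast
qed

lemma N_minus: "p \<in> N \<Longrightarrow> - p \<in> N"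
proof -
  assume "p \<in> N"
  moreover have "- p = Poly_Mapping.map ((*) (-1)) p" by (rule poly_mapping_eqI) simp
  ultimately show ?thesis using N_facts(4) by metis
qed

lemma N_diff: "p \<in> N \<Longrightarrow> q \<in> N \<Longrightarrow> p - q \<in> N"
  using N_facts(3)[OF _ N_minus] by fastforce

lemma cls_alt: "cls p = {q. q - p \<in> N}"
  by (auto simp: l_class_def a_r_coset_def r_coset_def intro!: bexI[of _ "_ - p"])

lemma mem_cls: "q \<in> cls p \<longleftrightarrow> q - p \<in> N" by (simp add: cls_alt)

lemma cls_refl: "p \<in> cls p" by (simp add: cls_alt N_facts)

lemma cls_eq: "p - q \<in> N \<Longrightarrow> cls p = cls q"
proof -
  assume a: "p - q \<in> N"
  have "x - p \<in> N \<longleftrightarrow> x - q \<in> N" for x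
    using N_facts(3)[OF _ a, of "x - p"] N_diff[OF _ a, of "x - q"] by auto
  then show ?thesis by (simp add: cls_alt)
qed

lemma UN_cls: assumes "\<And>q. q \<in> cls p \<Longrightarrow> K q = Y" shows "(\<Union>r\<in>cls p. K r) = Y"
  using assms cls_refl[of p] by blast

lemma l_zero: "\<zero>\<^bsub>l_space ip w \<zeta> H \<iota> \<pi>\<^esub> = cls 0"
  by (simp add: l_space_def quotient_module_def cls_alt)

lemma l_add: "cls p \<oplus>\<^bsub>l_space ip w \<zeta> H \<iota> \<pi>\<^esub> cls q = cls (p + q)"
proof -
  have "cls p \<oplus>\<^bsub>l_space ip w \<zeta> H \<iota> \<pi>\<^esub> cls q = (\<Union>x\<in>cls p. \<Union>y\<in>cls q. {x + y})"
    by (simp add: l_space_def quotient_module_def set_add_def set_mult_def)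
  also have "\<dots> = cls (p + q)"
  proof (rule Set.set_eqI, rule iffI, goal_cases)
    case (1 z)
    then obtain x y where xy: "x - p \<in> N" "y - q \<in> N" "z = x + y" by (auto simp: mem_cls)
    have "z - (p + q) = (x - p) + (y - q)" by (simp add: xy)
    then show ?case using N_facts(3)[OF xy(1,2)] by (simp only: mem_cls)
  next
    case (2 z)
    then have "z = (z - q) + q" "z - q \<in> cls p" "q \<in> cls q"
      by (auto simp: mem_cls N_facts algebra_simps)
    then show ?case by blast
  qed
  finally show ?thesis .
qed

lemma l_smult: "c \<odot>\<^bsub>l_space ip w \<zeta> H \<iota> \<pi>\<^esub> cls p = cls (Poly_Mapping.map ((*) c) p)"
proof -
  have "c \<odot>\<^bsub>l_space ip w \<zeta> H \<iota> \<pi>\<^esub> cls p = (\<Union>x\<in>cls p. cls (Poly_Mapping.map ((*) c) x))"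
    by (simp add: l_space_def quotient_module_def l_class_def)
  also have "\<dots> = cls (Poly_Mapping.map ((*) c) p)"
    by (rule UN_cls, rule cls_eq) (auto simp: mem_cls simp flip: map_mult_diff intro: N_facts)
  finally show ?thesis .
qed

lemma l_carrier: "C \<in> carrier (l_space ip w \<zeta> H \<iota> \<pi>) \<longleftrightarrow> (\<exists>p. Poly_Mapping.keys p \<subseteq> ER \<and> C = cls p)"
  by (auto simp: l_space_def quotient_module_def l_class_def A_RCOSETS_def RCOSETS_def a_r_coset_def)

private abbreviation (input) "tact \<equiv> free_t_action :: ('l \<Rightarrow> 'k) \<Rightarrow> ('l \<times> 'h \<Rightarrow>\<^sub>0 'k) \<Rightarrow> _"
private abbreviation (input) "brt \<equiv> free_bracket_t ip w \<zeta> H \<iota> \<pi> \<epsilon>"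
private abbreviation (input) "brl \<equiv> free_bracket_l ip w H \<pi> \<epsilon>"

lemma tact_add: "tact f (p + q) = tact f p + tact f q"
  unfolding free_t_action_def by (rule sum_keys_add) (auto simp: distrib_left single_add)

lemma tact_add2: "tact (\<lambda>x. f x + g x) p = tact f p + tact g p"
  unfolding free_t_action_def by (simp add: distrib_right single_add sum.distrib)

lemma tact_scale: "tact f (Poly_Mapping.map ((*) c) p) = Poly_Mapping.map ((*) c) (tact f p)"
  unfolding free_t_action_def by (rule sum_keys_scale) (auto simp: mult.left_commute)

lemma tact_single: "tact f (Poly_Mapping.single a x) = Poly_Mapping.single a (f (fst a) * x)"
  unfolding free_t_action_def by (cases "x = 0") auto

lemma neg_scale: "- p = Poly_Mapping.map ((*) (-1 :: 'k)) (p :: 'x \<Rightarrow>\<^sub>0 'k)"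
  by (rule poly_mapping_eqI) simp

lemma tact_diff: "tact f (p - q) = tact f p - tact f q"
  using tact_add[of f p "- q"] tact_scale[of f "-1" q] by (simp add: neg_scale[symmetric])

lemma tact_N: "p \<in> N \<Longrightarrow> tact f p \<in> N"
proof (induction p rule: N_induct)
  case zero then show ?case by (simp add: free_t_action_def N_facts)
next
  case (add p q) then show ?case by (simp add: tact_add N_facts)
next
  case (scale c p) then show ?case by (simp add: tact_scale N_facts)
next
  case (rel a)
  have "tact f (Poly_Mapping.single (inc \<zeta> \<otimes>\<^bsub>EL\<^esub> a) 1 - Poly_Mapping.single a \<zeta>) =
      Poly_Mapping.map ((*) (f (fst a))) (Poly_Mapping.single (inc \<zeta> \<otimes>\<^bsub>EL\<^esub> a) 1 - Poly_Mapping.single a \<zeta>)"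
    by (simp only: tact_diff tact_single fst_inc_mult map_mult_diff map_mult_single)
  then show ?case using N_facts(4)[OF N_rel[OF rel]] by metis
qed

definition gen_bracket_t :: "'l \<times> 'h \<Rightarrow> 'l \<times> 'h \<Rightarrow> 'l \<Rightarrow> 'k"
  where "gen_bracket_t a b x = (if fst a + fst b = 0 then \<epsilon> (fst a) (fst b) * sc (a \<otimes>\<^bsub>EL\<^esub> b) * coroot ip (fst a) x else 0)"

lemma brt_alt: "brt p q x = (\<Sum>a\<in>Poly_Mapping.keys p. Poly_Mapping.lookup p a * (\<Sum>b\<in>Poly_Mapping.keys q. Poly_Mapping.lookup q b * gen_bracket_t a b x))"
  unfolding free_bracket_t_def by (auto simp: gen_bracket_t_def sum_distrib_left intro!: sum.cong)

definition gen_bracket_l :: "'l \<times> 'h \<Rightarrow> 'l \<times> 'h \<Rightarrow> ('l \<times> 'h \<Rightarrow>\<^sub>0 'k)"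
  where "gen_bracket_l a b = (if fst a + fst b \<in> roots ip then Poly_Mapping.single (a \<otimes>\<^bsub>EL\<^esub> b) (\<epsilon> (fst a) (fst b)) else 0)"

lemma brl_alt: "brl p q = (\<Sum>a\<in>Poly_Mapping.keys p. Poly_Mapping.map ((*) (Poly_Mapping.lookup p a))
   (\<Sum>b\<in>Poly_Mapping.keys q. Poly_Mapping.map ((*) (Poly_Mapping.lookup q b)) (gen_bracket_l a b)))"
  unfolding free_bracket_l_def
  by (auto simp: gen_bracket_l_def map_mult_sum algebra_simps intro!: sum.cong)

lemma map_mult_add_scalar: "Poly_Mapping.map ((*) (c + c'::'k)) p = Poly_Mapping.map ((*) c) p + Poly_Mapping.map ((*) c') p"
  by (rule poly_mapping_eqI) (simp add: lookup_add algebra_simps)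
lemma map_mult_zero_scalar [simp]: "Poly_Mapping.map (\<lambda>_. 0::'k) (p::_ \<Rightarrow>\<^sub>0 'k) = 0"
  by (rule poly_mapping_eqI) (transfer, simp add: when_def)
lemma map_mult_zero_scalar' [simp]: "Poly_Mapping.map ((*) 0) (p::_ \<Rightarrow>\<^sub>0 'k) = 0"
  by (rule poly_mapping_eqI) simp
lemma map_mult_mult: "Poly_Mapping.map ((*) (c * c'::'k)) p = Poly_Mapping.map ((*) c) (Poly_Mapping.map ((*) c') p)"
  by (rule poly_mapping_eqI) simp

lemma brt_add1: "brt (p + p') q x = brt p q x + brt p' q x"
  unfolding brt_alt by (rule sum_keys_add) (auto simp: algebra_simps)
lemma brt_add2: "brt p (q + q') x = brt p q x + brt p q' x"
  unfolding brt_alt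
  by (subst sum_keys_add[where G = "\<lambda>b y. y * gen_bracket_t _ b x"]) (auto simp: algebra_simps sum.distrib)
lemma brt_scale1: "brt (Poly_Mapping.map ((*) c) p) q x = c * brt p q x"
  unfolding brt_alt by (rule sum_keys_scale) (auto simp: algebra_simps)
lemma brt_scale2: "brt p (Poly_Mapping.map ((*) c) q) x = c * brt p q x"
  unfolding brt_alt
  by (subst sum_keys_scale[where G = "\<lambda>b y. y * gen_bracket_t _ b x" and s = "\<lambda>y. c * y"])
     (auto simp: algebra_simps sum_distrib_left)
lemma brt_single: "brt (Poly_Mapping.single a y) (Poly_Mapping.single b z) x = y * z * gen_bracket_t a b x"
  unfolding brt_alt by (cases "y = 0"; cases "z = 0") auto

lemma brl_add1: "brl (p + p') q = brl p q + brl p' q"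
  unfolding brl_alt by (rule sum_keys_add) (auto simp: map_mult_add_scalar)
lemma brl_add2: "brl p (q + q') = brl p q + brl p q'"
  unfolding brl_alt
  by (subst sum_keys_add[where G = "\<lambda>b y. Poly_Mapping.map ((*) y) (gen_bracket_l _ b)"])
     (auto simp: map_mult_add_scalar sum.distrib)
lemma brl_scale1: "brl (Poly_Mapping.map ((*) c) p) q = Poly_Mapping.map ((*) c) (brl p q)"
  unfolding brl_alt by (rule sum_keys_scale) (auto simp: map_mult_mult)
lemma map_mult_commute: "Poly_Mapping.map ((*) (c::'k)) (Poly_Mapping.map ((*) c') p) = Poly_Mapping.map ((*) c') (Poly_Mapping.map ((*) c) p)"
  by (rule poly_mapping_eqI) simp
lemma brl_scale2: "brl p (Poly_Mapping.map ((*) c) q) = Poly_Mapping.map ((*) c) (brl p q)"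
  unfolding brl_alt
  by (subst sum_keys_scale[where G = "\<lambda>b y. Poly_Mapping.map ((*) y) (gen_bracket_l _ b)" and s = "Poly_Mapping.map ((*) c)"])
     (auto simp: map_mult_mult map_mult_sum map_mult_commute[of c])
lemma brl_single: "brl (Poly_Mapping.single a y) (Poly_Mapping.single b z) = Poly_Mapping.map ((*) (y * z)) (gen_bracket_l a b)"
  unfolding brl_alt by (cases "y = 0"; cases "z = 0") (auto simp: map_mult_mult)

lemma brt_diff1: "brt (p - p') q x = brt p q x - brt p' q x"
  using brt_add1[of p "- p'" q x] brt_scale1[of "-1" p' q x] by (simp add: neg_scale[symmetric])
lemma brt_diff2: "brt p (q - q') x = brt p q x - brt p q' x"
  using brt_add2[of p q "- q'" x] brt_scale2[of p "-1" q' x] by (simp add: neg_scale[symmetric])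
lemma brl_diff1: "brl (p - p') q = brl p q - brl p' q"
  using brl_add1[of p "- p'" q] brl_scale1[of "-1" p' q] by (simp add: neg_scale[symmetric])
lemma brl_diff2: "brl p (q - q') = brl p q - brl p q'"
  using brl_add2[of p q "- q'"] brl_scale2[of p "-1" q'] by (simp add: neg_scale[symmetric])

lemma free_induct [consumes 1, case_names zero add single]:
  fixes q :: "'l \<times> 'h \<Rightarrow>\<^sub>0 'k"
  assumes "Poly_Mapping.keys q \<subseteq> ER" "P 0" "\<And>p q. P p \<Longrightarrow> P q \<Longrightarrow> P (p + q)"
    "\<And>a x. a \<in> ER \<Longrightarrow> P (Poly_Mapping.single a x)"
  shows "P q"
proof -
  have "q = (\<Sum>a\<in>Poly_Mapping.keys q. Poly_Mapping.single a (Poly_Mapping.lookup q a))"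
    by (rule poly_mapping_eqI) (auto simp: lookup_sum lookup_single when_def in_keys_iff)
  moreover have "P (\<Sum>a\<in>A. Poly_Mapping.single a (Poly_Mapping.lookup q a))" if "A \<subseteq> ER" for A
    using that by (induction A rule: infinite_finite_induct) (auto intro: assms)
  ultimately show ?thesis using assms(1) by metis
qed

lemma gen_bracket_t_zeta1: "a \<in> ER \<Longrightarrow> b \<in> ER \<Longrightarrow> gen_bracket_t (inc \<zeta> \<otimes>\<^bsub>EL\<^esub> a) b x = \<zeta> * gen_bracket_t a b x"
  unfolding gen_bracket_t_def fst_inc_mult using sc_zeta_left[OF ER_EL ER_EL, of a b] by (simp del: EL_simps)
lemma gen_bracket_t_zeta2: "a \<in> ER \<Longrightarrow> b \<in> ER \<Longrightarrow> gen_bracket_t a (inc \<zeta> \<otimes>\<^bsub>EL\<^esub> b) x = \<zeta> * gen_bracket_t a b x"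
  unfolding gen_bracket_t_def fst_inc_mult zeta_right[OF ER_EL ER_EL] using sc_zeta_left[OF ER_EL ER_EL, of a b] by (simp del: EL_simps)

lemma brt_N1: "p \<in> N \<Longrightarrow> Poly_Mapping.keys q \<subseteq> ER \<Longrightarrow> brt p q x = 0"
proof (induction p rule: N_induct)
  case (rel a)
  from rel(2,1) show ?case
    by (induction q rule: free_induct)
       (simp_all del: EL_simps add: brt_add2 brt_diff1 brt_single gen_bracket_t_zeta1, simp add: brt_alt)
qed (auto simp: brt_add1 brt_scale1, simp add: brt_alt)

lemma brt_N2: "q \<in> N \<Longrightarrow> Poly_Mapping.keys p \<subseteq> ER \<Longrightarrow> brt p q x = 0"
proof (induction q rule: N_induct)
  case (rel a)
  from rel(2,1) show ?case
    by (induction p rule: free_induct)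
       (simp_all del: EL_simps add: brt_add1 brt_diff2 brt_single gen_bracket_t_zeta2, simp add: brt_alt)
qed (auto simp: brt_add2 brt_scale2, simp add: brt_alt)

lemma gen_bracket_l_zeta1: assumes "a \<in> ER" "b \<in> ER"
  shows "gen_bracket_l (inc \<zeta> \<otimes>\<^bsub>EL\<^esub> a) b - Poly_Mapping.map ((*) \<zeta>) (gen_bracket_l a b) \<in> N"
proof (cases "fst a + fst b \<in> roots ip")
  case True
  then have r: "a \<otimes>\<^bsub>EL\<^esub> b \<in> ER" using EL_closed[OF ER_EL ER_EL, OF assms] by (auto simp: ext_roots_def)
  have "gen_bracket_l (inc \<zeta> \<otimes>\<^bsub>EL\<^esub> a) b - Poly_Mapping.map ((*) \<zeta>) (gen_bracket_l a b) =
    Poly_Mapping.map ((*) (\<epsilon> (fst a) (fst b))) (Poly_Mapping.single (inc \<zeta> \<otimes>\<^bsub>EL\<^esub> (a \<otimes>\<^bsub>EL\<^esub> b)) 1 - Poly_Mapping.single (a \<otimes>\<^bsub>EL\<^esub> b) \<zeta>)"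
    unfolding gen_bracket_l_def fst_inc_mult EL_assoc[OF inc_in[OF zeta_in] ER_EL[OF assms(1)] ER_EL[OF assms(2)]]
    using True by (simp del: EL_simps add: mult.commute)
  then show ?thesis using N_facts(4)[OF N_rel[OF r]] by metis
next
  case False
  then show ?thesis unfolding gen_bracket_l_def fst_inc_mult by (simp add: N_facts)
qed

lemma gen_bracket_l_zeta2: assumes "a \<in> ER" "b \<in> ER"
  shows "gen_bracket_l a (inc \<zeta> \<otimes>\<^bsub>EL\<^esub> b) - Poly_Mapping.map ((*) \<zeta>) (gen_bracket_l a b) \<in> N"
proof -
  have "gen_bracket_l a (inc \<zeta> \<otimes>\<^bsub>EL\<^esub> b) = gen_bracket_l (inc \<zeta> \<otimes>\<^bsub>EL\<^esub> a) b"
    unfolding gen_bracket_l_def fst_inc_mult zeta_right[OF ER_EL ER_EL, OF assms] ..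
  then show ?thesis using gen_bracket_l_zeta1[OF assms] by simp
qed

lemma brl_N1: "p \<in> N \<Longrightarrow> Poly_Mapping.keys q \<subseteq> ER \<Longrightarrow> brl p q \<in> N"
proof (induction p rule: N_induct)
  case (rel a)
  let ?r = "Poly_Mapping.single (inc \<zeta> \<otimes>\<^bsub>EL\<^esub> a) 1 - Poly_Mapping.single a \<zeta>"
  from rel(2,1) show ?case
  proof (induction q rule: free_induct)
    case (single b x)
    have "brl ?r (Poly_Mapping.single b x) = Poly_Mapping.map ((*) x) (gen_bracket_l (inc \<zeta> \<otimes>\<^bsub>EL\<^esub> a) b - Poly_Mapping.map ((*) \<zeta>) (gen_bracket_l a b))"
      by (simp del: EL_simps add: brl_diff1 brl_single flip: map_mult_mult) (simp add: mult.commute)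
    then show ?case using N_facts(4)[OF gen_bracket_l_zeta1[of a b]] single by metis
  qed (simp_all del: EL_simps add: brl_add2 N_facts, simp add: brl_alt N_facts)
qed (auto simp: brl_add1 brl_scale1 N_facts, simp add: brl_alt N_facts)

lemma brl_N2: "q \<in> N \<Longrightarrow> Poly_Mapping.keys p \<subseteq> ER \<Longrightarrow> brl p q \<in> N"
proof (induction q rule: N_induct)
  case (rel a)
  let ?r = "Poly_Mapping.single (inc \<zeta> \<otimes>\<^bsub>EL\<^esub> a) 1 - Poly_Mapping.single a \<zeta>"
  from rel(2,1) show ?case
  proof (induction p rule: free_induct)
    case (single b x)
    have "brl (Poly_Mapping.single b x) ?r = Poly_Mapping.map ((*) x) (gen_bracket_l b (inc \<zeta> \<otimes>\<^bsub>EL\<^esub> a) - Poly_Mapping.map ((*) \<zeta>) (gen_bracket_l b a))"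
      by (simp del: EL_simps add: brl_diff2 brl_single flip: map_mult_mult)
    then show ?case using N_facts(4)[OF gen_bracket_l_zeta2[of b a]] single by metis
  qed (simp_all del: EL_simps add: brl_add1 N_facts, simp add: brl_alt N_facts)
qed (auto simp: brl_add2 brl_scale2 N_facts, simp add: brl_alt N_facts)

private abbreviation (input) "hbr \<equiv> h_bracket ip w \<zeta> H \<iota> \<pi> \<epsilon>"

lemma cls_keys: assumes "Poly_Mapping.keys p \<subseteq> ER" "x \<in> cls p" shows "Poly_Mapping.keys x \<subseteq> ER"
proof -
  have "x = p + (x - p)" by simp
  moreover have "Poly_Mapping.keys (x - p) \<subseteq> ER" using assms(2) N_facts(1) by (auto simp: mem_cls)
  ultimately show ?thesis using assms(1) Poly_Mapping.keys_add[of p "x - p"] by auto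
qed

lemma h_bracket_cls:
  assumes p: "Poly_Mapping.keys p \<subseteq> ER" and q: "Poly_Mapping.keys q \<subseteq> ER"
  shows "hbr (f, cls p) (g, cls q) = (brt p q, cls (tact f q - tact g p + brl p q))"
proof -
  have t: "brt p' q' = brt p q" if "p' \<in> cls p" "q' \<in> cls q" for p' q'
  proof
    fix x
    have "brt (p' - p) q' x = 0" "brt p (q' - q) x = 0"
      using that p cls_keys[OF q] by (auto intro: brt_N1 brt_N2 simp: mem_cls)
    then show "brt p' q' x = brt p q x" by (simp add: brt_diff1 brt_diff2)
  qed
  have l: "cls (tact f q' - tact g p' + brl p' q') = cls (tact f q - tact g p + brl p q)"
    if "p' \<in> cls p" "q' \<in> cls q" for p' q'
  proof (rule cls_eq)
    have "tact f (q' - q) \<in> N" "tact g (p' - p) \<in> N" "brl (p' - p) q' \<in> N" "brl p (q' - q) \<in> N"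
      using that p cls_keys[OF q] by (auto intro: brl_N1 brl_N2 tact_N simp: mem_cls)
    then have "tact f (q' - q) - tact g (p' - p) + (brl (p' - p) q' + brl p (q' - q)) \<in> N"
      by (intro N_facts N_diff)
    then show "tact f q' - tact g p' + brl p' q' - (tact f q - tact g p + brl p q) \<in> N"
      by (simp add: tact_diff brl_diff1 brl_diff2 algebra_simps)
  qed
  have "(\<Union>p'\<in>cls p. \<Union>q'\<in>cls q. {brt p' q'}) = {brt p q}"
    by (intro UN_cls) (simp add: t)
  moreover have "(\<Union>p'\<in>cls p. \<Union>q'\<in>cls q. cls (tact f q' - tact g p' + brl p' q')) = cls (tact f q - tact g p + brl p q)"
    by (intro UN_cls) (simp add: l)
  ultimately show ?thesis unfolding h_bracket_def by simp
qed

private abbreviation (input) "h \<equiv> h_alg ip w \<zeta> H \<iota> \<pi> \<epsilon>"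
private abbreviation (input) "cr \<equiv> h_coroot ip w \<zeta> H \<iota> \<pi>"
private abbreviation (input) "XX \<equiv> h_X ip w \<zeta> H \<iota> \<pi>"

lemma h_simps: "(f, cls p) \<oplus>\<^bsub>h\<^esub> (g, cls q) = (\<lambda>x. f x + g x, cls (p + q))"
  "c \<odot>\<^bsub>h\<^esub> (f, cls p) = (\<lambda>x. c * f x, cls (Poly_Mapping.map ((*) c) p))"
  "\<zero>\<^bsub>h\<^esub> = (\<lambda>_. 0, cls 0)"
  by (simp_all add: h_alg_def t_space_def l_add l_smult l_zero)

lemma cr_alt: "cr \<alpha> = (coroot ip \<alpha>, cls 0)" by (simp add: h_coroot_def l_zero)
lemma X_alt: "XX a = (\<lambda>_. 0, cls (Poly_Mapping.single a 1))" by (simp add: h_X_def t_space_def)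

lemma zero_br [simp]: "brt 0 q = (\<lambda>_. 0)" "brt p 0 = (\<lambda>_. 0)" "brl 0 q = 0" "brl p 0 = 0" "tact f 0 = 0" "tact (\<lambda>_. 0) p = 0"
  by (simp_all add: brt_alt[abs_def] brl_alt free_t_action_def fun_eq_iff brt_alt)

lemma h_X_scale: "a \<in> ER \<Longrightarrow> XX (inc \<zeta> \<otimes>\<^bsub>EL\<^esub> a) = \<zeta> \<odot>\<^bsub>h\<^esub> XX a"
  unfolding X_alt h_simps using cls_eq[OF N_rel[of a]] by simp

lemma h_bracket_coroot_coroot: "lie_bracket h (cr \<alpha>) (cr \<beta>) = \<zero>\<^bsub>h\<^esub>"
  by (simp add: h_alg_def[of _ _ _ _ _ _ \<epsilon>] cr_alt h_bracket_cls) (simp add: h_simps(3) t_space_def l_zero)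

lemma h_bracket_coroot_X:
  "b \<in> ER \<Longrightarrow> lie_bracket h (cr \<alpha>) (XX b) = of_int (ip \<alpha> (fst b)) \<odot>\<^bsub>h\<^esub> XX b"
  "b \<in> ER \<Longrightarrow> lie_bracket h (XX b) (cr \<alpha>) = (- of_int (ip \<alpha> (fst b))) \<odot>\<^bsub>h\<^esub> XX b"
  unfolding X_alt cr_alt h_simps
  by (simp_all add: h_alg_def h_bracket_cls tact_single coroot_def single_uminus)

lemma h_bracket_X_X_opposite:
  assumes "a \<in> ER" "b \<in> ER" "fst a + fst b = 0"
  shows "lie_bracket h (XX a) (XX b) = (\<epsilon> (fst a) (fst b) * sc (a \<otimes>\<^bsub>EL\<^esub> b)) \<odot>\<^bsub>h\<^esub> cr (fst a)"
proof -
  have "ip 0 0 = 0" using D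
    by (metis input_datum_def simply_laced_root_lattice_def int_lattice_def add_cancel_right_left add_0)
  then have "0 \<notin> roots ip" by (simp add: roots_def)
  then show ?thesis unfolding X_alt cr_alt h_simps using assms
    by (simp del: EL_simps add: h_alg_def h_bracket_cls brl_single brt_single gen_bracket_l_def gen_bracket_t_def fun_eq_iff)
qed

lemma h_bracket_X_X_root:
  assumes "a \<in> ER" "b \<in> ER" "fst a + fst b \<in> roots ip"
  shows "lie_bracket h (XX a) (XX b) = \<epsilon> (fst a) (fst b) \<odot>\<^bsub>h\<^esub> XX (a \<otimes>\<^bsub>EL\<^esub> b)"
proof -
  have "ip 0 0 = 0" using D
    by (metis input_datum_def simply_laced_root_lattice_def int_lattice_def add_cancel_right_left add_0)
  then have "0 \<notin> roots ip" by (simp add: roots_def)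
  then have "fst a + fst b \<noteq> 0" using assms by metis
  then show ?thesis unfolding X_alt cr_alt h_simps using assms
    by (simp del: EL_simps add: h_alg_def h_bracket_cls brl_single brt_single[abs_def] gen_bracket_l_def gen_bracket_t_def fun_eq_iff brt_single)
qed

lemma h_bracket_X_X_zero:
  assumes "a \<in> ER" "b \<in> ER" "fst a + fst b \<noteq> 0" "fst a + fst b \<notin> roots ip"
  shows "lie_bracket h (XX a) (XX b) = \<zero>\<^bsub>h\<^esub>"
  unfolding X_alt h_simps using assms
    by (simp del: EL_simps add: h_alg_def h_bracket_cls brl_single gen_bracket_l_def gen_bracket_t_def fun_eq_iff brt_single)


lemma h_carrier: "x \<in> carrier h \<longleftrightarrow>
    (\<exists>f p. x = (f, cls p) \<and> (\<forall>u v. f (u + v) = f u + f v) \<and> Poly_Mapping.keys p \<subseteq> ER)"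
  by (cases x) (auto simp: h_alg_def t_space_def l_carrier)

lemma h_bracket_bilinear:
  assumes "x \<in> carrier h" "y \<in> carrier h" "z \<in> carrier h"
  shows "lie_bracket h (x \<oplus>\<^bsub>h\<^esub> y) z = lie_bracket h x z \<oplus>\<^bsub>h\<^esub> lie_bracket h y z"
    and "lie_bracket h z (x \<oplus>\<^bsub>h\<^esub> y) = lie_bracket h z x \<oplus>\<^bsub>h\<^esub> lie_bracket h z y"
    and "lie_bracket h (c \<odot>\<^bsub>h\<^esub> x) z = c \<odot>\<^bsub>h\<^esub> lie_bracket h x z"
    and "lie_bracket h z (c \<odot>\<^bsub>h\<^esub> x) = c \<odot>\<^bsub>h\<^esub> lie_bracket h z x"
proof -
  obtain e p f q g r where d: "x = (e, cls p)" "y = (f, cls q)" "z = (g, cls r)"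
      "Poly_Mapping.keys p \<subseteq> ER" "Poly_Mapping.keys q \<subseteq> ER" "Poly_Mapping.keys r \<subseteq> ER"
    using assms by (auto simp: h_carrier)
  have k: "Poly_Mapping.keys (p + q) \<subseteq> ER" "Poly_Mapping.keys (Poly_Mapping.map ((*) c) p) \<subseteq> ER"
    using d Poly_Mapping.keys_add[of p q] keys_map_mult[of c p] by auto
  have b: "lie_bracket h = hbr" by (simp add: h_alg_def)
  have t: "tact (\<lambda>x. c * e x) r = Poly_Mapping.map ((*) c) (tact e r)"
    by (simp add: free_t_action_def map_mult_sum mult.assoc)
  note e = d b h_simps h_bracket_cls k prod.inject fun_eq_iff
    tact_add tact_add2 tact_scale t brt_add1 brt_add2 brt_scale1 brt_scale2 brl_add1 brl_add2 brl_scale1 brl_scale2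
  show "lie_bracket h (x \<oplus>\<^bsub>h\<^esub> y) z = lie_bracket h x z \<oplus>\<^bsub>h\<^esub> lie_bracket h y z"
    by (simp add: e) (simp add: algebra_simps)
  show "lie_bracket h z (x \<oplus>\<^bsub>h\<^esub> y) = lie_bracket h z x \<oplus>\<^bsub>h\<^esub> lie_bracket h z y"
    by (simp add: e) (simp add: algebra_simps)
  show "lie_bracket h (c \<odot>\<^bsub>h\<^esub> x) z = c \<odot>\<^bsub>h\<^esub> lie_bracket h x z" by (simp add: e)
  show "lie_bracket h z (c \<odot>\<^bsub>h\<^esub> x) = c \<odot>\<^bsub>h\<^esub> lie_bracket h z x" by (simp add: e)
qed

private abbreviation (input) "tr \<equiv> (\<lambda>p. \<Sum>a\<in>Poly_Mapping.keys p. Poly_Mapping.single (w (fst a), snd a) (Poly_Mapping.lookup p a)) :: ('l \<times> 'h \<Rightarrow>\<^sub>0 'k) \<Rightarrow> _"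

lemma w_facts: "bij w" "ip (w x) (w y) = ip x y" "w (x + y) = w x + w y"
    using D by (auto simp: input_datum_def lattice_aut_def iso_def add_grp_def hom_def)

lemma w0: "w 0 = 0" using w_facts(3)[of 0 0] by simp

lemma coinv_w: "coinv_class w (w x) = coinv_class w x"
proof -
  have d: "w (x - y) = w x - w y" for x y using w_facts(3)[of "x - y" y] by (simp add: algebra_simps)
  have "\<exists>b. a - w a + w x = b - w b + x" for a by (rule exI[of _ "a - x"]) (simp add: d)
  moreover have "\<exists>b. a - w a + x = b - w b + w x" for a by (rule exI[of _ "a + x"]) (simp add: w_facts(3))
  ultimately show ?thesis by (auto simp: coinv_class_def r_coset_def add_grp_def image_iff)
qed

lemma w_ER: "a \<in> ER \<Longrightarrow> (w (fst a), snd a) \<in> ER"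
  by (auto simp: ext_roots_def coinv_w roots_def w_facts)

lemma tr_add: "tr (p + q) = tr p + tr q"
  by (rule sum_keys_add) (auto simp: single_add)
lemma tr_scale: "tr (Poly_Mapping.map ((*) c) p) = Poly_Mapping.map ((*) c) (tr p)"
  by (rule sum_keys_scale) auto
lemma tr_single: "tr (Poly_Mapping.single a x) = Poly_Mapping.single (w (fst a), snd a) x"
  by (cases "x = 0") auto
lemma tr_diff: "tr (p - q) = tr p - tr q"
  using tr_add[of p "- q"] tr_scale[of "-1" q] by (simp add: neg_scale[symmetric])

lemma tr_N: "p \<in> N \<Longrightarrow> tr p \<in> N"
proof (induction p rule: N_induct)
  case zero then show ?case by (simp add: N_facts)
next
  case (add p q) then show ?case by (simp only: tr_add N_facts)
next
  case (scale c p) then show ?case by (simp only: tr_scale N_facts)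
next
  case (rel a)
  have "tr (Poly_Mapping.single (inc \<zeta> \<otimes>\<^bsub>EL\<^esub> a) 1 - Poly_Mapping.single a \<zeta>) =
      Poly_Mapping.single (inc \<zeta> \<otimes>\<^bsub>EL\<^esub> (w (fst a), snd a)) 1 - Poly_Mapping.single (w (fst a), snd a) \<zeta>"
    unfolding tr_diff tr_single by (simp add: ext_incl_def)
  then show ?case using N_rel[OF w_ER[OF rel]] by metis
qed

lemma w_lift_cls: "w_lift ip w \<zeta> H \<iota> \<pi> (f, cls p) = (f \<circ> inv_into UNIV w, cls (tr p))"
proof -
  have "(\<Union>q\<in>cls p. cls (tr q)) = cls (tr p)"
    by (rule UN_cls, rule cls_eq, subst tr_diff[symmetric], rule tr_N) (simp add: mem_cls)
  then show ?thesis by (simp add: w_lift_def)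
qed

lemma w_lift_coroot: "w_lift ip w \<zeta> H \<iota> \<pi> (cr \<alpha>) = cr (w \<alpha>)"
proof -
  have "coroot ip \<alpha> (inv_into UNIV w x) = (coroot ip (w \<alpha>) x :: 'k)" for x
    using w_facts(2)[of \<alpha> "inv_into UNIV w x"] bij_is_surj[OF w_facts(1)] by (simp add: coroot_def surj_f_inv_f)
  then show ?thesis by (simp add: cr_alt w_lift_cls fun_eq_iff comp_def)
qed

lemma w_lift_X: "w_lift ip w \<zeta> H \<iota> \<pi> (XX a) = XX (w (fst a), snd a)"
  unfolding X_alt w_lift_cls tr_single by (simp add: fun_eq_iff)

end

end

theory Submission
  imports Defs
begin

text \<open>
  A triple \<open>(s, u, v)\<close> of compatible automorphisms of \<open>k\<close>, \<open>\<Lambda>\<close> and \<open>\<H>\<close> induces an \<open>s\<close>-linear map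
  \<open>f \<mapsto> s f u\<^sup>-\<^sup>1\<close>, \<open>X\<^bsub>(\<alpha>,a)\<^esub> \<mapsto> X\<^bsub>(u\<alpha>,va)\<^esub>\<close> of \<open>h\<close> that respects the bracket.  Both the lift of \<open>w\<close>, from
  \<open>(1, w, 1)\<close>, and the action of \<open>\<sigma> \<in> \<Gamma>\<close>, from its given actions, arise in this way; so the relation
  \<open>w \<sigma> = \<sigma> w\<^sup>m\<close>, where \<open>\<sigma>(\<zeta>\<^sup>m) = \<zeta>\<close>, shows that \<open>\<Gamma>\<close> preserves \<open>g\<close>.  The forms come
  from Galois descent.
\<close>

section \<open>Galois groups\<close>

text \<open>Two points need more than formal checking. A single \<sigma> need not commute with the
  lift of w; it only permutes the powers of w by conjugation. Preservation of g therefore rests on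
  the fact that a vector fixed by the lift of w is fixed by every power of it. And (A3) compares two
  maps that are each defined through a choice of representative, so it says something about classes
  only once both choices are known to be harmless: \<sigma> stabilises
  \<open>(1 - w) \<Lambda>\<close> by (A1), and the central copy of the roots of unity in H by (A2).

  For descent, the tensor product is a quotient of a free abelian group by explicit relations, not a
  space with a chosen basis. So the inverse map is written down from the trace and a finite system
  \<open>e\<close>, \<open>c\<close>, the coordinates of the separability idempotent of
  \<open>k\<close> over \<open>k\<^sub>0\<close>, and is verified on generators modulo the
  relations. The argument counts no dimensions and uses only the module structure, hence it applies
  alike to h and to g.\<close>

lemma fld_ops [simp]:
  "\<one>\<^bsub>fld\<^esub> = (1 :: 'k::field)" "(x :: 'k) \<otimes>\<^bsub>fld\<^esub> y = x * y" "x \<oplus>\<^bsub>fld\<^esub> y = x + y"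
  by (simp_all add: ring_of_type_algebra_def)

lemma galois_group_simps [simp]:
  "\<sigma> \<otimes>\<^bsub>galois_group k\<^sub>0\<^esub> \<tau> = \<sigma> \<circ> \<tau>" "\<one>\<^bsub>galois_group k\<^sub>0\<^esub> = id"
  by (simp_all add: galois_group_def)

lemma galois_group_iff:
  "\<sigma> \<in> carrier (galois_group k\<^sub>0) \<longleftrightarrow> bij \<sigma> \<and> (\<forall>x y. \<sigma> (x + y) = \<sigma> x + \<sigma> y) \<and>
     (\<forall>x y. \<sigma> (x * y) = \<sigma> x * \<sigma> y) \<and> \<sigma> 1 = 1 \<and> (\<forall>x\<in>k\<^sub>0. \<sigma> x = x)"
  by (auto simp: galois_group_def ring_iso_def ring_hom_def)

lemma galois_group_id: "id \<in> carrier (galois_group k\<^sub>0)"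
  by (simp add: galois_group_iff)

lemma galois_group_comp:
  assumes "\<sigma> \<in> carrier (galois_group k\<^sub>0)" "\<tau> \<in> carrier (galois_group k\<^sub>0)"
  shows "\<sigma> \<circ> \<tau> \<in> carrier (galois_group k\<^sub>0)"
  using assms by (simp add: galois_group_iff bij_comp)

lemma galois_group_inv:
  assumes "\<sigma> \<in> carrier (galois_group k\<^sub>0)"
  shows "inv_into UNIV \<sigma> \<in> carrier (galois_group k\<^sub>0)"
proof -
  have \<sigma>: "bij \<sigma>" using assms by (simp add: galois_group_iff)
  have inv: "\<sigma> (inv_into UNIV \<sigma> x) = x" for x
    using \<sigma> by (simp add: bij_is_surj surj_f_inv_f)
  have inv': "inv_into UNIV \<sigma> y = x" if "\<sigma> x = y" for x y
    using that \<sigma> by (auto simp: bij_is_inj)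
  show ?thesis
    unfolding galois_group_iff using assms
    by (auto simp: galois_group_iff bij_imp_bij_inv inv intro!: inv')
qed

lemma group_galois_group: "group (galois_group k\<^sub>0)"
proof (rule groupI)
  fix \<sigma> assume \<sigma>: "\<sigma> \<in> carrier (galois_group k\<^sub>0)"
  then have "inv_into UNIV \<sigma> \<circ> \<sigma> = id"
    by (simp add: galois_group_iff bij_is_inj)
  then show "\<exists>\<tau>\<in>carrier (galois_group k\<^sub>0). \<tau> \<otimes>\<^bsub>galois_group k\<^sub>0\<^esub> \<sigma> = \<one>\<^bsub>galois_group k\<^sub>0\<^esub>"
    using galois_group_inv[OF \<sigma>] by auto
qed (auto simp: galois_group_id galois_group_comp comp_assoc)

lemma galois_group_zero:
  assumes "\<sigma> \<in> carrier (galois_group k\<^sub>0)" shows "\<sigma> 0 = 0"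
proof -
  have "\<sigma> (0 + 0) = \<sigma> 0 + \<sigma> 0" using assms unfolding galois_group_iff by blast
  then show ?thesis by (simp only: add_0_left add_cancel_right_right)
qed

lemma galois_group_minus:
  assumes "\<sigma> \<in> carrier (galois_group k\<^sub>0)" shows "\<sigma> (- x) = - \<sigma> x"
proof -
  have "\<sigma> (x + - x) = \<sigma> x + \<sigma> (- x)" using assms unfolding galois_group_iff by blast
  then show ?thesis using galois_group_zero[OF assms] by (simp add: minus_unique)
qed

lemma galois_group_sum:
  assumes "\<sigma> \<in> carrier (galois_group k\<^sub>0)"
  shows "\<sigma> (sum f A) = (\<Sum>a\<in>A. \<sigma> (f a))"
  using assms galois_group_zero[OF assms]
  by (induction A rule: infinite_finite_induct) (auto simp: galois_group_iff)

text \<open>Reindexing a sum over the group by left translation is what makes traces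
  invariant.\<close>

lemma galois_group_translate:
  assumes "\<tau> \<in> carrier (galois_group k\<^sub>0)"
  shows "bij_betw (\<lambda>\<sigma>. \<tau> \<circ> \<sigma>) (carrier (galois_group k\<^sub>0)) (carrier (galois_group k\<^sub>0))"
proof (rule bij_betw_byWitness[where f' = "\<lambda>\<sigma>. inv_into UNIV \<tau> \<circ> \<sigma>"])
  have "bij \<tau>" using assms by (simp add: galois_group_iff)
  then show "\<forall>\<sigma>\<in>carrier (galois_group k\<^sub>0). inv_into UNIV \<tau> \<circ> (\<tau> \<circ> \<sigma>) = \<sigma>"
    and "\<forall>\<sigma>\<in>carrier (galois_group k\<^sub>0). \<tau> \<circ> (inv_into UNIV \<tau> \<circ> \<sigma>) = \<sigma>"
    by (auto simp: fun_eq_iff bij_is_inj bij_is_surj surj_f_inv_f)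
qed (use assms in \<open>auto simp: galois_group_comp galois_group_inv\<close>)

lemma galois_group_ring_hom:
  assumes "\<sigma> \<in> carrier (galois_group k\<^sub>0)"
  shows "ring_hom_ring fld fld \<sigma>"
  using assms by (intro ring_hom_ringI2 ring_from_type_algebra) (simp add: galois_group_def ring_iso_def)

text \<open>An automorphism over \<open>k\<^sub>0\<close> is determined by its values on a finite
  spanning list, and each value is a root of a polynomial over \<open>k\<^sub>0\<close> that
  annihilates the list element, so only finitely many automorphisms are possible.\<close>

lemma finite_galois_group:
  fixes k\<^sub>0 :: "'k::field set"
  assumes "finite_galois_extension k\<^sub>0"
  shows "finite (carrier (galois_group k\<^sub>0))"
proof -
  interpret F: field "fld :: 'k ring" by (rule field_from_type_algebra)
  have K: "subfield k\<^sub>0 fld" and fd: "F.finite_dimension k\<^sub>0 UNIV"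
    using assms by (auto simp: finite_galois_extension_def)
  obtain n where "F.dimension n k\<^sub>0 UNIV" using fd by auto
  then obtain Us where Us: "F.Span k\<^sub>0 Us = UNIV" using F.exists_base[OF K] by metis
  have alg: "(F.algebraic over k\<^sub>0) x" for x :: 'k
    using F.finite_dimension_imp_algebraic[OF K F.carrier_is_subring] fd by simp
  have "finite {\<sigma> x | \<sigma>. \<sigma> \<in> carrier (galois_group k\<^sub>0)}" for x
  proof -
    obtain p where p: "p \<in> carrier (univ_poly fld k\<^sub>0)" "p \<noteq> []" "F.eval p x = 0"
      using F.algebraicE[OF subfieldE(1)[OF K] _ alg[of x]] by auto
    have "{\<sigma> x | \<sigma>. \<sigma> \<in> carrier (galois_group k\<^sub>0)} \<subseteq> {y. F.is_root p y}"
    proof safe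
      fix \<sigma> assume \<sigma>: "\<sigma> \<in> carrier (galois_group k\<^sub>0)"
      interpret ring_hom_ring fld fld \<sigma> by (rule galois_group_ring_hom[OF \<sigma>])
      have "set p \<subseteq> k\<^sub>0" using p(1) by (auto simp: univ_poly_def polynomial_def)
      then have "map \<sigma> p = p" using \<sigma> by (auto simp: galois_group_iff intro!: map_idI)
      then show "F.is_root p (\<sigma> x)"
        using eval_hom[OF subfieldE(1)[OF K] _ p(1), of x] p galois_group_zero[OF \<sigma>]
        by (simp add: F.is_root_def)
    qed
    \<comment> \<open>The same coefficient list read as a polynomial over all of \<open>k\<close>,
      where it has finitely many roots.\<close>
    moreover have "p \<in> carrier (univ_poly fld UNIV)"
      using p(1) by (auto simp: univ_poly_def polynomial_def)
    ultimately show ?thesis using F.finite_number_of_roots[of p] finite_subset by auto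
  qed
  then have "finite (PiE (set Us) (\<lambda>x. {\<sigma> x | \<sigma>. \<sigma> \<in> carrier (galois_group k\<^sub>0)}))"
    by (intro finite_PiE) auto
  moreover have "(\<lambda>\<sigma>. restrict \<sigma> (set Us)) ` carrier (galois_group k\<^sub>0) \<subseteq>
      PiE (set Us) (\<lambda>x. {\<sigma> x | \<sigma>. \<sigma> \<in> carrier (galois_group k\<^sub>0)})"
    by auto
  moreover have "inj_on (\<lambda>\<sigma>. restrict \<sigma> (set Us)) (carrier (galois_group k\<^sub>0))"
  proof (rule inj_onI)
    fix \<sigma> \<tau>
    assume \<sigma>: "\<sigma> \<in> carrier (galois_group k\<^sub>0)" and \<tau>: "\<tau> \<in> carrier (galois_group k\<^sub>0)"
      and eq: "restrict \<sigma> (set Us) = restrict \<tau> (set Us)"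
    \<comment> \<open>The set of agreement enters only as an additive subgroup: once it contains all
      \<open>k\<^sub>0\<close>-multiples of the spanning list, \<open>Span_min\<close> puts the
      whole span inside it.\<close>
    let ?E = "{x. \<sigma> x = \<tau> x}"
    have "subgroup ?E (add_monoid fld)"
    proof (rule group.subgroupI[OF F.a_group])
      fix x assume x: "x \<in> ?E"
      have "inv\<^bsub>add_monoid fld\<^esub> x = - x"
        by (rule group.inv_equality[OF F.a_group]) auto
      then show "inv\<^bsub>add_monoid fld\<^esub> x \<in> ?E"
        using x galois_group_minus[OF \<sigma>] galois_group_minus[OF \<tau>] by simp
    qed (use \<sigma> \<tau> galois_group_zero[OF \<sigma>] galois_group_zero[OF \<tau>] in
        \<open>auto simp: galois_group_iff intro: exI[of _ 0]\<close>)
    moreover have "k\<^sub>0 <#>\<^bsub>fld\<^esub> set Us \<subseteq> ?E"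
      using \<sigma> \<tau> eq by (auto simp: set_mult_def galois_group_iff restrict_def fun_eq_iff) metis
    ultimately have "F.Span k\<^sub>0 Us \<subseteq> ?E"
      using F.Span_min[OF K, of Us ?E] by simp
    then show "\<sigma> = \<tau>" using Us by auto
  qed
  ultimately show ?thesis by (meson finite_imageD finite_subset)
qed

text \<open>
  The functions \<open>\<tau> \<mapsto> \<Sum>\<^sub>i e\<^sub>i \<tau>(c\<^sub>i)\<close> are closed under products, and for \<open>\<sigma> \<noteq> 1\<close> one of them,
  \<open>(\<tau>(x) - \<sigma>(x)) / (x - \<sigma>(x))\<close>, separates \<open>\<sigma>\<close> from \<open>1\<close>.
\<close>

lemma galois_dual_bases:
  fixes k\<^sub>0 :: "'k::field set"
  assumes "finite (carrier (galois_group k\<^sub>0))"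
  obtains n and e c :: "nat \<Rightarrow> 'k"
  where "\<And>\<sigma>. \<sigma> \<in> carrier (galois_group k\<^sub>0) \<Longrightarrow> (\<Sum>i<n. e i * \<sigma> (c i)) = (if \<sigma> = id then 1 else 0)"
proof -
  define ev where "ev xs \<tau> = (\<Sum>(e, c)\<leftarrow>xs. e * \<tau> c)" for xs and \<tau> :: "'k \<Rightarrow> 'k"
  have "\<exists>xs. ev xs id = 1 \<and> (\<forall>\<sigma>\<in>A. ev xs \<sigma> = 0)"
    if "finite A" "A \<subseteq> carrier (galois_group k\<^sub>0) - {id}" for A
    using that
  proof (induction A rule: finite_induct)
    case empty
    have "ev [(1, 1)] id = 1" by (simp add: ev_def)
    then show ?case by blast
  next
    case (insert \<sigma> A)
    then obtain xs where xs: "ev xs id = 1" "\<forall>\<tau>\<in>A. ev xs \<tau> = 0"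
      using insert.IH insert.prems by blast
    obtain x where x: "\<sigma> x \<noteq> x" using insert.prems by (auto simp: fun_eq_iff)
    define a where "a = 1 / (x - \<sigma> x)"
    \<comment> \<open>Expands the product of \<open>a * (\<tau> x - \<sigma> x)\<close> with each
      \<open>e * \<tau> c\<close>: the first half absorbs \<open>x\<close> into the argument of
      \<tau>, the second keeps \<open>\<sigma> x\<close> as a constant factor. The scalar
      \<open>a\<close> normalises the value at \<open>id\<close> to 1.\<close>
    define ys where "ys = map (\<lambda>(e, c). (a * e, x * c)) xs @ map (\<lambda>(e, c). (- a * \<sigma> x * e, c)) xs"
    have "ev ys \<tau> = a * (\<tau> x - \<sigma> x) * ev xs \<tau>" if "\<tau> \<in> carrier (galois_group k\<^sub>0)" for \<tau>
    proof -
      have "\<tau> (x * c) = \<tau> x * \<tau> c" for c using that by (simp add: galois_group_iff)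
      then show ?thesis
        unfolding ys_def ev_def by (induction xs) (auto simp: algebra_simps)
    qed
    then have "ev ys id = 1" "\<forall>\<tau>\<in>insert \<sigma> A. ev ys \<tau> = 0"
      using xs x insert.prems galois_group_id[of k\<^sub>0] by (auto simp: a_def)
    then show ?case by blast
  qed
  from this[of "carrier (galois_group k\<^sub>0) - {id}"] assms
  obtain xs where "ev xs id = 1" "\<forall>\<sigma>\<in>carrier (galois_group k\<^sub>0) - {id}. ev xs \<sigma> = 0"
    by auto
  moreover have "ev xs \<tau> = (\<Sum>i<length xs. fst (xs ! i) * \<tau> (snd (xs ! i)))" for \<tau>
    by (simp add: ev_def sum_list_sum_nth atLeast0LessThan case_prod_beta)
  ultimately show ?thesis
    by (intro that[of "\<lambda>i. fst (xs ! i)" "\<lambda>i. snd (xs ! i)" "length xs"]) auto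
qed

section \<open>Galois descent\<close>

text \<open>Set up so that descent is proved once and used for both h and g. The action is
  constrained on the carrier only, so one and the same \<open>act\<close> serves both.\<close>

locale galois_module = module "fld :: 'k::field ring" M
  for M :: "('k::field, 'v, 'm) module_scheme" (structure) +
  fixes k\<^sub>0 :: "'k::field set" and act :: "('k::field \<Rightarrow> 'k) \<Rightarrow> 'v \<Rightarrow> 'v"
  assumes galois: "finite_galois_extension k\<^sub>0"
    and act_closed: "\<lbrakk>\<gamma> \<in> carrier (galois_group k\<^sub>0); x \<in> carrier M\<rbrakk> \<Longrightarrow> act \<gamma> x \<in> carrier M"
    and act_add: "\<lbrakk>\<gamma> \<in> carrier (galois_group k\<^sub>0); x \<in> carrier M; y \<in> carrier M\<rbrakk> \<Longrightarrow>
      act \<gamma> (x \<oplus> y) = act \<gamma> x \<oplus> act \<gamma> y"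
    and act_smult: "\<lbrakk>\<gamma> \<in> carrier (galois_group k\<^sub>0); x \<in> carrier M\<rbrakk> \<Longrightarrow>
      act \<gamma> (c \<odot> x) = \<gamma> c \<odot> act \<gamma> x"
    and act_comp: "\<lbrakk>\<gamma> \<in> carrier (galois_group k\<^sub>0); \<tau> \<in> carrier (galois_group k\<^sub>0); x \<in> carrier M\<rbrakk> \<Longrightarrow>
      act (\<gamma> \<circ> \<tau>) x = act \<gamma> (act \<tau> x)"
    and act_id: "x \<in> carrier M \<Longrightarrow> act id x = x"
begin

abbreviation \<Gamma> where "\<Gamma> \<equiv> galois_group k\<^sub>0"
abbreviation V where "V \<equiv> fixed_points \<Gamma> M act"
abbreviation K where "K \<equiv> (fld\<lparr>carrier := k\<^sub>0\<rparr> :: 'k ring)"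

lemma finite_\<Gamma> [simp]: "finite (carrier \<Gamma>)"
  by (rule finite_galois_group[OF galois])

lemma V_carrier: "x \<in> V \<Longrightarrow> x \<in> carrier M"
  by (simp add: fixed_points_def)

lemma act_V: "x \<in> V \<Longrightarrow> \<gamma> \<in> carrier \<Gamma> \<Longrightarrow> act \<gamma> x = x"
  by (simp add: fixed_points_def)

lemma act_zero: "\<gamma> \<in> carrier \<Gamma> \<Longrightarrow> act \<gamma> \<zero> = \<zero>"
  using act_add[of \<gamma> \<zero> \<zero>] act_closed[of \<gamma> \<zero>] by (metis M.add.l_cancel_one' M.l_zero M.zero_closed)

lemma act_minus: "\<gamma> \<in> carrier \<Gamma> \<Longrightarrow> x \<in> carrier M \<Longrightarrow> act \<gamma> (\<ominus> x) = \<ominus> act \<gamma> x"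
  using act_add[of \<gamma> "\<ominus> x" x] act_closed by (simp add: M.l_neg act_zero M.minus_equality)

lemma submodule_V: "submodule V K M"
proof (intro submodule.intro M.add.subgroupI submodule_axioms.intro)
  have "\<zero> \<in> V" by (simp add: fixed_points_def act_zero)
  then show "V \<noteq> {}" by blast
qed (auto simp: fixed_points_def act_add act_smult galois_group_iff act_minus simp flip: a_inv_def)

lemma smult_sum:
  "finite A \<Longrightarrow> x \<in> carrier M \<Longrightarrow> sum f A \<odot> x = (\<Oplus>a\<in>A. f a \<odot> x)"
proof (induction A rule: finite_induct)
  case empty
  then show ?case using smult_l_null[of x] by simp
next
  case (insert a A)
  then show ?case using smult_l_distr[of "f a" "sum f A" x] by simp
qed

lemma act_finsum:
  "finite A \<Longrightarrow> f \<in> A \<rightarrow> carrier M \<Longrightarrow> \<gamma> \<in> carrier \<Gamma> \<Longrightarrow>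
    act \<gamma> (\<Oplus>a\<in>A. f a) = (\<Oplus>a\<in>A. act \<gamma> (f a))"
proof (induction A rule: finite_induct)
  case (insert a A)
  then show ?case using act_closed by (simp add: act_add Pi_def)
qed (simp add: act_zero)

section \<open>The trace into the fixed vectors\<close>

definition trc :: "'v \<Rightarrow> 'v" where "trc x = (\<Oplus>\<gamma>\<in>carrier \<Gamma>. act \<gamma> x)"

lemma trc_closed: "x \<in> carrier M \<Longrightarrow> trc x \<in> carrier M"
  unfolding trc_def by (intro M.finsum_closed) (auto simp: act_closed)

lemma trc_V:
  assumes "x \<in> carrier M" shows "trc x \<in> V"
  unfolding fixed_points_def
proof (intro CollectI conjI ballI trc_closed[OF assms])
  fix \<tau> assume \<tau>: "\<tau> \<in> carrier \<Gamma>"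
  note inj = bij_betw_imp_inj_on[OF galois_group_translate[OF \<tau>]]
  have "trc x = (\<Oplus>\<gamma>\<in>(\<lambda>\<gamma>. \<tau> \<circ> \<gamma>) ` carrier \<Gamma>. act \<gamma> x)"
    by (simp only: trc_def bij_betw_imp_surj_on[OF galois_group_translate[OF \<tau>]])
  also have "\<dots> = (\<Oplus>\<gamma>\<in>carrier \<Gamma>. act (\<tau> \<circ> \<gamma>) x)"
    by (intro M.finsum_reindex inj) (use assms \<tau> in \<open>auto simp: act_closed galois_group_comp\<close>)
  also have "\<dots> = (\<Oplus>\<gamma>\<in>carrier \<Gamma>. act \<tau> (act \<gamma> x))"
    by (intro M.finsum_cong') (use assms \<tau> in \<open>auto simp: act_closed act_comp\<close>)
  also have "\<dots> = act \<tau> (trc x)"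
    unfolding trc_def by (rule act_finsum[symmetric]) (use assms \<tau> in \<open>auto simp: act_closed\<close>)
  finally show "act \<tau> (trc x) = trc x" by simp
qed

lemma trc_add:
  assumes "x \<in> carrier M" "y \<in> carrier M"
  shows "trc (x \<oplus> y) = trc x \<oplus> trc y"
proof -
  have "trc (x \<oplus> y) = (\<Oplus>\<gamma>\<in>carrier \<Gamma>. act \<gamma> x \<oplus> act \<gamma> y)"
    unfolding trc_def using assms by (intro M.finsum_cong') (auto simp: act_closed act_add)
  also have "\<dots> = trc x \<oplus> trc y"
    unfolding trc_def using assms by (intro M.finsum_addf) (auto simp: act_closed)
  finally show ?thesis .
qed

text \<open>On a fixed vector only the scalar moves, so the trace of the action becomes the field
  trace of \<open>c\<close>. By \<open>trace_in_base\<close> that scalar lies in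
  \<open>k\<^sub>0\<close> and may be carried across the tensor sign.\<close>

lemma trc_smult:
  assumes "x \<in> V"
  shows "trc (c \<odot> x) = (\<Sum>\<gamma>\<in>carrier \<Gamma>. \<gamma> c) \<odot> x"
proof -
  have "trc (c \<odot> x) = (\<Oplus>\<gamma>\<in>carrier \<Gamma>. \<gamma> c \<odot> x)"
    unfolding trc_def using assms
    by (intro M.finsum_cong') (auto simp: act_smult act_V V_carrier)
  then show ?thesis using smult_sum[of "carrier \<Gamma>" x "\<lambda>\<gamma>. \<gamma> c"] assms by (simp add: V_carrier)
qed

text \<open>Translation permutes the summands, so the sum is fixed by the whole group, and the fixed
  field is \<open>k\<^sub>0\<close> because the extension is Galois.\<close>

lemma trace_in_base: "(\<Sum>\<gamma>\<in>carrier \<Gamma>. \<gamma> c) \<in> k\<^sub>0"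
proof -
  have "\<tau> (\<Sum>\<gamma>\<in>carrier \<Gamma>. \<gamma> c) = (\<Sum>\<gamma>\<in>carrier \<Gamma>. \<gamma> c)" if \<tau>: "\<tau> \<in> carrier \<Gamma>" for \<tau>
  proof -
    note inj = bij_betw_imp_inj_on[OF galois_group_translate[OF \<tau>]]
    have "(\<Sum>\<gamma>\<in>carrier \<Gamma>. \<gamma> c) = (\<Sum>\<gamma>\<in>(\<lambda>\<gamma>. \<tau> \<circ> \<gamma>) ` carrier \<Gamma>. \<gamma> c)"
      by (simp only: bij_betw_imp_surj_on[OF galois_group_translate[OF \<tau>]])
    also have "\<dots> = \<tau> (\<Sum>\<gamma>\<in>carrier \<Gamma>. \<gamma> c)"
      by (simp add: sum.reindex[OF inj] galois_group_sum[OF \<tau>])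
    finally show ?thesis by simp
  qed
  then show ?thesis using galois by (auto simp: finite_galois_extension_def)
qed

subsection \<open>The descent isomorphism\<close>

abbreviation MV where "MV \<equiv> M\<lparr>carrier := V\<rparr>"
abbreviation free_tensor where "free_tensor \<equiv> tensor_free MV (fld_module :: ('k, 'k) module)"
text \<open>The subgroup by which the tensor product is a quotient. Identities between tensors are
  proved as congruences modulo \<open>rels\<close> in the free abelian group, without handling
  cosets.\<close>

abbreviation rels where
  "rels \<equiv> generate free_tensor (tensor_relations K MV (fld_module :: ('k, 'k) module))"

lemma V_zero: "\<zero> \<in> V" and V_add: "x \<in> V \<Longrightarrow> y \<in> V \<Longrightarrow> x \<oplus> y \<in> V"
  and V_smult: "x \<in> V \<Longrightarrow> c \<in> k\<^sub>0 \<Longrightarrow> c \<odot> x \<in> V"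
  by (auto simp: fixed_points_def act_zero act_add act_smult galois_group_iff)

lemma free_tensor_group: "group free_tensor"
  by (simp add: tensor_free_def)

lemma free_tensor_carrier: "carrier free_tensor = {p. Poly_Mapping.keys p \<subseteq> V \<times> UNIV}"
  by (auto simp: tensor_free_def fld_module_def)

lemma free_tensor_mult: "p \<otimes>\<^bsub>free_tensor\<^esub> q = p + q"
  by (simp add: tensor_free_def)

lemma tensor_relations_closed: "tensor_relations K MV fld_module \<subseteq> carrier free_tensor"
  unfolding free_tensor_carrier tensor_relations_def
  by (auto simp: fld_module_def V_add V_smult
        dest!: subsetD[OF keys_diff] split: if_splits)

lemma rels_subgroup: "subgroup rels free_tensor"
  by (rule group.generate_is_subgroup[OF free_tensor_group tensor_relations_closed])

lemma rels_zero: "0 \<in> rels"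
  using subgroup.one_closed[OF rels_subgroup] by (simp add: tensor_free_def)

lemma rels_add: "p \<in> rels \<Longrightarrow> q \<in> rels \<Longrightarrow> p + q \<in> rels"
  using subgroup.m_closed[OF rels_subgroup] by (simp add: tensor_free_def)

lemma rels_minus: "p \<in> rels \<Longrightarrow> - p \<in> rels"
  using subgroup.m_inv_closed[OF rels_subgroup, of p] subgroup.subset[OF rels_subgroup]
  by (auto simp: tensor_free_def fld_module_def subset_iff)

lemma rels_diff: "p \<in> rels \<Longrightarrow> q \<in> rels \<Longrightarrow> p - q \<in> rels"
  using rels_add[OF _ rels_minus, of p q] by simp

lemma rels_sum: "(\<And>i. i \<in> A \<Longrightarrow> f i \<in> rels) \<Longrightarrow> sum f A \<in> rels"
  by (induction A rule: infinite_finite_induct) (auto simp: rels_zero rels_add)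

lemma rels_add_left:
  "x \<in> V \<Longrightarrow> x' \<in> V \<Longrightarrow> frag_of (x \<oplus> x', c) - frag_of (x, c) - frag_of (x', c) \<in> rels"
  by (rule generate.incl) (force simp: tensor_relations_def fld_module_def)

lemma rels_add_right:
  "x \<in> V \<Longrightarrow> frag_of (x, c + c') - frag_of (x, c) - frag_of (x, c') \<in> rels"
  by (rule generate.incl) (force simp: tensor_relations_def fld_module_def)

lemma rels_smult:
  "x \<in> V \<Longrightarrow> a \<in> k\<^sub>0 \<Longrightarrow> frag_of (a \<odot> x, c) - frag_of (x, a * c) \<in> rels"
  by (rule generate.incl) (force simp: tensor_relations_def fld_module_def)

text \<open>Additivity in the second entry at \<open>0 + 0\<close> leaves just
  \<open>- frag_of (x, 0)\<close>.\<close>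

lemma rels_zero_right: "x \<in> V \<Longrightarrow> frag_of (x, 0) \<in> rels"
  using rels_minus[OF rels_add_right[of x 0 0]] by simp

lemma rels_sum_right:
  assumes "finite A" "x \<in> V"
  shows "frag_of (x, sum f A) - (\<Sum>i\<in>A. frag_of (x, f i)) \<in> rels"
  using assms
proof (induction A rule: finite_induct)
  case (insert i A)
  have "frag_of (x, sum f (insert i A)) - (\<Sum>i\<in>insert i A. frag_of (x, f i)) =
      (frag_of (x, f i + sum f A) - frag_of (x, f i) - frag_of (x, sum f A)) +
      (frag_of (x, sum f A) - (\<Sum>i\<in>A. frag_of (x, f i)))"
    using insert.hyps by simp
  then show ?case
    using rels_add[OF rels_add_right insert.IH, of x "f i" "sum f A"] insert.prems by metis
qed (simp add: rels_zero_right)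

text \<open>
  With \<open>\<Sum>\<^sub>i e\<^sub>i \<sigma>(c\<^sub>i) = \<delta>\<^bsub>\<sigma>,1\<^esub>\<close>, the inverse of \<open>x \<otimes> c \<mapsto> c x\<close> is \<open>v \<mapsto> \<Sum>\<^sub>i Tr(c\<^sub>i v) \<otimes> e\<^sub>i\<close>.
\<close>

lemma descent:
  obtains \<phi> where "\<phi> \<in> iso (tensor_product K MV fld_module) (add_monoid M)"
    "\<And>x c. x \<in> V \<Longrightarrow> \<phi> (pure_tensor K MV fld_module x c) = c \<odot> x"
proof -
  obtain n and e c :: "nat \<Rightarrow> 'k"
    where dual: "\<And>\<gamma>. \<gamma> \<in> carrier \<Gamma> \<Longrightarrow> (\<Sum>i<n. e i * \<gamma> (c i)) = (if \<gamma> = id then 1 else 0)"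
    using galois_dual_bases[OF finite_\<Gamma>] by metis
  have "(\<lambda>(x, a). a \<odot> x) ` (V \<times> UNIV) \<subseteq> carrier (add_monoid M)"
    using V_carrier by auto
  then obtain \<Phi> where "\<Phi> \<in> hom (free_Abelian_group (V \<times> UNIV)) (add_monoid M)"
    and "\<And>y. y \<in> V \<times> UNIV \<Longrightarrow> \<Phi> (frag_of y) = (\<lambda>(x, a). a \<odot> x) y"
    by (rule comm_group.free_Abelian_group_universal[OF M.a_comm_group]) blast
  then have \<Phi>_hom: "\<Phi> \<in> hom free_tensor (add_monoid M)"
    and \<Phi>_frag: "\<And>x a. x \<in> V \<Longrightarrow> \<Phi> (frag_of (x, a)) = a \<odot> x"
    by (auto simp: tensor_free_def fld_module_def)
  interpret \<Phi>: group_hom free_tensor "add_monoid M" \<Phi>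
    by (intro group_hom.intro group_hom_axioms.intro free_tensor_group \<Phi>_hom M.a_group)
  have \<Phi>_add: "\<Phi> (p + q) = \<Phi> p \<oplus> \<Phi> q"
    if "p \<in> carrier free_tensor" "q \<in> carrier free_tensor" for p q
    using \<Phi>.hom_mult[OF that] by (simp add: tensor_free_def)
  have \<Phi>_zero: "\<Phi> 0 = \<zero>"
    using \<Phi>.hom_one by (simp add: tensor_free_def)
  have \<Phi>_closed: "\<Phi> p \<in> carrier M" if "p \<in> carrier free_tensor" for p
    using \<Phi>.hom_closed[OF that] by simp
  have closed_diff: "p - q \<in> carrier free_tensor"
    if "p \<in> carrier free_tensor" "q \<in> carrier free_tensor" for p q
    using that unfolding free_tensor_carrier by (auto dest!: subsetD[OF keys_diff])
  have \<Phi>_diff: "\<Phi> (p - q) = \<Phi> p \<ominus> \<Phi> q"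
    if "p \<in> carrier free_tensor" "q \<in> carrier free_tensor" for p q
  proof -
    have "\<Phi> p = \<Phi> (p - q) \<oplus> \<Phi> q"
      using \<Phi>_add[OF closed_diff[OF that] that(2)] by simp
    then show ?thesis
      using \<Phi>_closed that closed_diff by (simp add: M.minus_eq M.a_assoc M.r_neg)
  qed

  \<comment> \<open>The candidate inverse takes values in the free abelian group, so it is additive
    only modulo \<open>rels\<close>.\<close>
  define \<psi> where "\<psi> v = (\<Sum>i<n. frag_of (trc (c i \<odot> v), e i))" for v
  have \<psi>_closed: "\<psi> v \<in> carrier free_tensor" if "v \<in> carrier M" for v
  proof -
    have "frag_of (trc (c i \<odot> v), e i) \<in> carrier free_tensor" for i
      using that by (simp add: free_tensor_carrier trc_V)
    then show ?thesis
      unfolding \<psi>_def tensor_free_def by (rule sum_closed_free_Abelian_group)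
  qed
  have \<psi>_add: "\<psi> (u \<oplus> v) - \<psi> u - \<psi> v \<in> rels" if "u \<in> carrier M" "v \<in> carrier M" for u v
  proof -
    have "\<psi> (u \<oplus> v) - \<psi> u - \<psi> v = (\<Sum>i<n. frag_of (trc (c i \<odot> u) \<oplus> trc (c i \<odot> v), e i)
        - frag_of (trc (c i \<odot> u), e i) - frag_of (trc (c i \<odot> v), e i))"
      using that by (simp add: \<psi>_def sum_subtractf smult_r_distr trc_add)
    then show ?thesis
      using that by (auto intro!: rels_sum rels_add_left trc_V)
  qed
  \<comment> \<open>\<open>\<psi> \<zero>\<close> is a formal sum of symbols with first entry
    \<open>\<zero>\<close>: it need not vanish, but it is a relation.\<close>
  have \<psi>_zero: "\<psi> \<zero> \<in> rels"
    using rels_minus[OF \<psi>_add[of \<zero> \<zero>]] by simp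
  have \<psi>_\<Phi>: "p - \<psi> (\<Phi> p) \<in> rels" if "p \<in> carrier free_tensor" for p
  proof -
    \<comment> \<open>Membership in the carrier is part of the induction because
      \<open>\<Phi>\<close> is known to be additive only there.\<close>
    have "p \<in> carrier free_tensor \<and> p - \<psi> (\<Phi> p) \<in> rels"
      using that unfolding free_tensor_carrier mem_Collect_eq
    proof (induction p rule: frag_induction)
      case zero
      show ?case using rels_minus[OF \<psi>_zero] by (simp add: \<Phi>_zero)
    next
      case (one y)
      obtain x a where y: "y = (x, a)" "x \<in> V" using one by auto
      define t where "t b = (\<Sum>\<gamma>\<in>carrier \<Gamma>. \<gamma> b)" for b
      \<comment> \<open>Exchanging the sums over \<open>i\<close> and over the group brings out the
        dual system, which annihilates every term except the one for \<open>id\<close>.\<close>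
      have "(\<Sum>i<n. t (c i * a) * e i) = (\<Sum>\<gamma>\<in>carrier \<Gamma>. (\<Sum>i<n. e i * \<gamma> (c i)) * \<gamma> a)"
        unfolding t_def sum_distrib_right
        by (subst sum.swap) (auto simp: galois_group_iff algebra_simps intro!: sum.cong)
      also have "\<dots> = (\<Sum>\<gamma>\<in>carrier \<Gamma>. if \<gamma> = id then a else 0)"
        by (intro sum.cong) (auto simp: dual)
      also have "\<dots> = a"
        by (simp add: galois_group_id)
      finally have a: "(\<Sum>i<n. t (c i * a) * e i) = a" .
      have "\<psi> (\<Phi> (frag_of y)) = (\<Sum>i<n. frag_of (t (c i * a) \<odot> x, e i))"
        unfolding \<psi>_def y \<Phi>_frag[OF y(2)] t_def
        using y by (auto intro!: sum.cong simp: trc_smult V_carrier simp flip: smult_assoc1)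
      \<comment> \<open>The first bracket splits the second entry of the tensor as a sum; the second
        moves each scalar \<open>t (c i * a)\<close>, an element of \<open>k\<^sub>0\<close>, from
        one entry to the other.\<close>
      then have "frag_of y - \<psi> (\<Phi> (frag_of y)) =
          (frag_of (x, \<Sum>i<n. t (c i * a) * e i) - (\<Sum>i<n. frag_of (x, t (c i * a) * e i))) -
          (\<Sum>i<n. frag_of (t (c i * a) \<odot> x, e i) - frag_of (x, t (c i * a) * e i))"
        unfolding a by (simp add: y sum_subtractf)
      also have "\<dots> \<in> rels"
        using y by (intro rels_diff rels_sum rels_sum_right rels_smult)
          (auto simp: t_def trace_in_base)
      finally show ?case using one by simp
    next
      case (diff p q)
      then have pq: "p \<in> carrier free_tensor" "q \<in> carrier free_tensor"
        by (auto simp: free_tensor_carrier)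
      \<comment> \<open>Writing \<open>p\<close> as \<open>(p - q) + q\<close> lets additivity of
        \<open>\<psi>\<close> modulo \<open>rels\<close> settle the difference.\<close>
      have "\<Phi> p = \<Phi> (p - q) \<oplus> \<Phi> q"
        using \<Phi>_add[OF closed_diff[OF pq] pq(2)] by simp
      then have "\<psi> (\<Phi> p) - \<psi> (\<Phi> (p - q)) - \<psi> (\<Phi> q) \<in> rels"
        using \<psi>_add[of "\<Phi> (p - q)" "\<Phi> q"] \<Phi>_closed pq closed_diff by simp
      moreover have "(p - \<psi> (\<Phi> p)) - (q - \<psi> (\<Phi> q)) \<in> rels"
        using diff by (blast intro: rels_diff)
      ultimately have "(p - \<psi> (\<Phi> p)) - (q - \<psi> (\<Phi> q)) +
          (\<psi> (\<Phi> p) - \<psi> (\<Phi> (p - q)) - \<psi> (\<Phi> q)) \<in> rels"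
        by (intro rels_add)
      then show ?case
        using closed_diff[OF pq] by (simp add: free_tensor_carrier)
    qed
    then show ?thesis ..
  qed

  have \<Phi>_sum: "\<Phi> (\<Sum>i\<in>A. frag_of (f i, g i)) = (\<Oplus>i\<in>A. g i \<odot> f i)"
    if "finite A" "\<And>i. i \<in> A \<Longrightarrow> f i \<in> V" for A :: "nat set" and f g
    using that
  proof (induction A rule: finite_induct)
    case (insert i A)
    have "(\<Sum>i\<in>A. frag_of (f i, g i)) \<in> carrier free_tensor"
      unfolding tensor_free_def
      by (rule sum_closed_free_Abelian_group) (use insert in \<open>simp add: fld_module_def\<close>)
    then have "\<Phi> (\<Sum>i\<in>insert i A. frag_of (f i, g i)) =
        \<Phi> (frag_of (f i, g i)) \<oplus> \<Phi> (\<Sum>i\<in>A. frag_of (f i, g i))"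
      using insert by (simp add: \<Phi>_add free_tensor_carrier)
    then show ?case
      using insert by (simp add: \<Phi>_frag Pi_def V_carrier)
  qed (simp add: \<Phi>_zero)
  have \<Phi>_\<psi>: "\<Phi> (\<psi> v) = v" if v: "v \<in> carrier M" for v
  proof -
    \<comment> \<open>An interchange of summations, stated for arbitrary finite subsets of the group
      so that induction applies; it collects the coefficients \<open>e i * \<gamma> (c i)\<close> in
      front of \<open>act \<gamma> v\<close>.\<close>
    have swap: "(\<Oplus>i\<in>{..<n}. e i \<odot> (\<Oplus>\<gamma>\<in>A. act \<gamma> (c i \<odot> v))) =
        (\<Oplus>\<gamma>\<in>A. (\<Sum>i<n. e i * \<gamma> (c i)) \<odot> act \<gamma> v)" if "finite A" "A \<subseteq> carrier \<Gamma>" for A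
      using that
    proof (induction A rule: finite_induct)
      case empty
      have "e i \<odot> \<zero> = \<zero>" for i using smult_r_null[of "e i"] by simp
      then show ?case by (simp add: M.finsum_zero)
    next
      case (insert \<gamma> A)
      have A: "act \<tau> (c i \<odot> v) \<in> carrier M" if "\<tau> \<in> A" for \<tau> i
        using insert that v by (auto intro!: act_closed)
      have "(\<Oplus>i\<in>{..<n}. e i \<odot> (\<Oplus>\<tau>\<in>insert \<gamma> A. act \<tau> (c i \<odot> v))) =
          (\<Oplus>i\<in>{..<n}. (e i * \<gamma> (c i)) \<odot> act \<gamma> v \<oplus> e i \<odot> (\<Oplus>\<tau>\<in>A. act \<tau> (c i \<odot> v)))"
      proof (rule M.finsum_cong')
        fix i
        have "(\<Oplus>\<tau>\<in>insert \<gamma> A. act \<tau> (c i \<odot> v)) = \<gamma> (c i) \<odot> act \<gamma> v \<oplus> (\<Oplus>\<tau>\<in>A. act \<tau> (c i \<odot> v))"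
          using insert v A by (simp add: act_closed act_smult Pi_def)
        then show "e i \<odot> (\<Oplus>\<tau>\<in>insert \<gamma> A. act \<tau> (c i \<odot> v)) =
            (e i * \<gamma> (c i)) \<odot> act \<gamma> v \<oplus> e i \<odot> (\<Oplus>\<tau>\<in>A. act \<tau> (c i \<odot> v))"
          using smult_r_distr[of "e i" "\<gamma> (c i) \<odot> act \<gamma> v" "\<Oplus>\<tau>\<in>A. act \<tau> (c i \<odot> v)"]
            smult_assoc1[of "e i" "\<gamma> (c i)" "act \<gamma> v"] A insert.prems v
          by (simp add: act_closed Pi_def)
      qed (use insert v A in \<open>auto simp: act_closed intro!: M.finsum_closed\<close>)
      also have "\<dots> = (\<Oplus>i\<in>{..<n}. (e i * \<gamma> (c i)) \<odot> act \<gamma> v) \<oplus>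
          (\<Oplus>i\<in>{..<n}. e i \<odot> (\<Oplus>\<tau>\<in>A. act \<tau> (c i \<odot> v)))"
        by (rule M.finsum_addf) (use insert v A in \<open>auto simp: act_closed\<close>)
      also have "\<dots> = (\<Oplus>\<tau>\<in>insert \<gamma> A. (\<Sum>i<n. e i * \<tau> (c i)) \<odot> act \<tau> v)"
        using insert v by (subst M.finsum_insert) (auto simp: act_closed smult_sum subset_iff)
      finally show ?case .
    qed
    have "\<Phi> (\<psi> v) = (\<Oplus>i\<in>{..<n}. e i \<odot> trc (c i \<odot> v))"
      unfolding \<psi>_def by (rule \<Phi>_sum) (use v in \<open>auto intro: trc_V\<close>)
    also have "\<dots> = (\<Oplus>\<gamma>\<in>carrier \<Gamma>. (\<Sum>i<n. e i * \<gamma> (c i)) \<odot> act \<gamma> v)"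
      unfolding trc_def by (rule swap) auto
    also have "\<dots> = (\<Oplus>\<gamma>\<in>carrier \<Gamma>. if id = \<gamma> then v else \<zero>)"
      using smult_one[of v] smult_l_null v
      by (intro M.finsum_cong') (auto simp: dual act_id act_closed)
    also have "\<dots> = v"
      using v by (subst M.finsum_singleton) (auto simp: galois_group_id)
    finally show ?thesis .
  qed

  \<comment> \<open>If \<open>\<Phi> p\<close> vanishes, then \<open>p\<close> agrees with
    \<open>\<psi> \<zero>\<close> modulo \<open>rels\<close>, and \<open>\<psi> \<zero>\<close> is
    itself a relation. Conversely each of the three families of relations is killed by a module
    axiom.\<close>
  have ker: "kernel free_tensor (add_monoid M) \<Phi> = rels"
  proof
    show "kernel free_tensor (add_monoid M) \<Phi> \<subseteq> rels"
    proof
      fix p assume "p \<in> kernel free_tensor (add_monoid M) \<Phi>"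
      then have "p - \<psi> \<zero> \<in> rels" using \<psi>_\<Phi>[of p] by (simp add: kernel_def)
      then show "p \<in> rels" using rels_add[OF _ \<psi>_zero] by fastforce
    qed
    have "tensor_relations K MV fld_module \<subseteq> kernel free_tensor (add_monoid M) \<Phi>"
    proof
      fix p assume p: "p \<in> tensor_relations K MV fld_module"
      have fr: "frag_of (x, a) \<in> carrier free_tensor" if "x \<in> V" for x a
        using that by (simp add: free_tensor_carrier)
      have cancel: "(u \<oplus> v) \<ominus> u \<ominus> v = \<zero>" if "u \<in> carrier M" "v \<in> carrier M" for u v
        using that by (simp add: M.minus_eq M.a_comm[of u v] M.a_assoc M.r_neg)
      have comm: "(a * b) \<odot> x = b \<odot> (a \<odot> x)" if "x \<in> V" for a b x
        using smult_assoc1[of b a x] that by (simp add: V_carrier mult.commute)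
      have "\<Phi> p = \<zero>"
        using p smult_r_distr smult_l_distr
        unfolding tensor_relations_def fld_module_def
        by (auto simp: \<Phi>_diff closed_diff fr \<Phi>_frag V_add V_smult V_carrier cancel comm)
          (auto simp: M.minus_eq M.r_neg V_carrier)
      then show "p \<in> kernel free_tensor (add_monoid M) \<Phi>"
        using p tensor_relations_closed by (auto simp: kernel_def)
    qed
    then show "rels \<subseteq> kernel free_tensor (add_monoid M) \<Phi>"
      by (rule group.generate_subgroup_incl[OF free_tensor_group _ \<Phi>.subgroup_kernel])
  qed
  define \<phi> where "\<phi> C = the_elem (\<Phi> ` C)" for C
  have "\<Phi> ` carrier free_tensor = carrier (add_monoid M)"
  proof
    show "carrier (add_monoid M) \<subseteq> \<Phi> ` carrier free_tensor"
      using \<Phi>_\<psi> \<psi>_closed by (metis image_eqI partial_object.select_convs(1) subsetI)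
  qed (use \<Phi>_closed in auto)
  from \<Phi>.FactGroup_iso_set[OF this]
  have "\<phi> \<in> iso (tensor_product K MV fld_module) (add_monoid M)"
    by (simp add: ker tensor_product_def \<phi>_def[abs_def])
  moreover have "\<phi> (pure_tensor K MV fld_module x a) = a \<odot> x" if x: "x \<in> V" for x a
  proof -
    have fr: "frag_of (x, a) \<in> carrier free_tensor"
      using x by (simp add: free_tensor_carrier)
    \<comment> \<open>\<open>\<Phi>\<close> is constant on the coset, which is what
      \<open>the_elem\<close> in the definition of \<open>\<phi>\<close> requires.\<close>
    have "\<Phi> p = a \<odot> x" if p: "p \<in> pure_tensor K MV fld_module x a" for p
    proof -
      obtain r where r: "r \<in> rels" "p = r + frag_of (x, a)"
        using p unfolding pure_tensor_def r_coset_def free_tensor_mult by blast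
      then have "r \<in> carrier free_tensor" "\<Phi> r = \<zero>"
        using ker by (auto simp: kernel_def)
      then show ?thesis using r fr x by (simp add: \<Phi>_add \<Phi>_frag V_carrier)
    qed
    moreover have "frag_of (x, a) \<in> pure_tensor K MV fld_module x a"
      using rels_zero by (force simp: pure_tensor_def r_coset_def free_tensor_mult)
    ultimately have "\<Phi> ` pure_tensor K MV fld_module x a = {a \<odot> x}"
      by (intro Set.set_eqI iffI) (auto intro: rev_image_eqI)
    then show ?thesis by (simp add: \<phi>_def)
  qed
  ultimately show ?thesis by (rule that)
qed

end

text \<open>Descent is purely linear, so the bracket enters only through the stability of the fixed
  points under it.\<close>

lemma is_form_fixed_points:
  fixes L :: "('k::field, 'v, 'm) lie_algebra_scheme"
  assumes "galois_module L k\<^sub>0 act"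
    and "\<And>x y. \<lbrakk>x \<in> fixed_points (galois_group k\<^sub>0) L act; y \<in> fixed_points (galois_group k\<^sub>0) L act\<rbrakk> \<Longrightarrow>
      lie_bracket L x y \<in> fixed_points (galois_group k\<^sub>0) L act"
  shows "is_form k\<^sub>0 L (fixed_points (galois_group k\<^sub>0) L act)"
proof -
  interpret galois_module L k\<^sub>0 act by fact
  show ?thesis
    using descent submodule_V assms(2) unfolding is_form_def by metis
qed

section \<open>Twisting the Lie algebra by compatible automorphisms\<close>

declare EL_simps [simp del] root_simps [simp del]

definition twist_free ::
    "('k::field \<Rightarrow> 'k) \<Rightarrow> ('l \<Rightarrow> 'l) \<Rightarrow> ('h \<Rightarrow> 'h) \<Rightarrow> ('l \<times> 'h \<Rightarrow>\<^sub>0 'k) \<Rightarrow> ('l \<times> 'h \<Rightarrow>\<^sub>0 'k)"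
  where "twist_free s u v p = (\<Sum>a\<in>Poly_Mapping.keys p.
    Poly_Mapping.single (u (fst a), v (snd a)) (s (Poly_Mapping.lookup p a)))"

locale input_data =
  fixes ip :: "'l::ab_group_add \<Rightarrow> 'l \<Rightarrow> int"
    and w :: "'l \<Rightarrow> 'l"
    and \<zeta> :: "'k::field_char_0"
    and H :: "('h, 'm) monoid_scheme"
    and \<iota> :: "'k \<Rightarrow> 'h"
    and \<pi> :: "'h \<Rightarrow> 'l set"
    and \<epsilon> :: "'l \<Rightarrow> 'l \<Rightarrow> 'k"
    and d :: nat
  assumes D: "input_datum ip w \<zeta> H \<iota> \<pi> \<epsilon> d"
begin

abbreviation "Z \<equiv> root_of_unity_grp \<zeta>"
abbreviation "EL \<equiv> ext_lattice w H \<pi>"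
abbreviation "ER \<equiv> ext_roots ip w H \<pi>"
abbreviation "N \<equiv> symbol_relations ip w \<zeta> H \<iota> \<pi>"
abbreviation "cls \<equiv> l_class ip w \<zeta> H \<iota> \<pi>"
abbreviation "inc \<equiv> ext_incl \<iota> :: 'k \<Rightarrow> 'l \<times> 'h"
abbreviation "h \<equiv> h_alg ip w \<zeta> H \<iota> \<pi> \<epsilon>"
abbreviation "g \<equiv> g_alg ip w \<zeta> H \<iota> \<pi> \<epsilon>"

lemmas EL_simps' [simp] = EL_simps[OF D]
lemmas N_induct' = N_induct[OF D, consumes 1, case_names zero add scale rel]
lemmas free_induct' = free_induct[OF D, consumes 1, case_names zero add single]

lemma ER_iff: "a \<in> ER \<longleftrightarrow> snd a \<in> carrier H \<and> \<pi> (snd a) = coinv_class w (fst a) \<and> fst a \<in> roots ip"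
  by (auto simp: ext_roots_def)

lemma ip_add: "ip (x + y) z = ip x z + ip y z" and ip_commute: "ip x y = ip y x"
  using D by (auto simp: input_datum_def simply_laced_root_lattice_def int_lattice_def)

section \<open>Roots of unity and the symbol relations\<close>

lemma root_of_unity_pow: "\<zeta> ^ i \<in> carrier Z"
proof (induction i)
  case 0
  then show ?case using monoid.one_closed[OF group.is_monoid[OF groups(2)[OF D]]] by (simp add: root_simps[OF D])
next
  case (Suc i)
  then show ?case
    using monoid.m_closed[OF group.is_monoid[OF groups(2)[OF D]] zeta_in[OF D] Suc]
    by (simp add: root_simps[OF D])
qed

text \<open>The \<open>d\<close> distinct powers of \<zeta> exhaust the solutions of
  \<open>z ^ d = 1\<close>, of which there are at most \<open>d\<close>. The equation does not
  mention \<zeta>, so every field automorphism preserves the group. Nonnegative exponents suffice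
  because \<open>d > 0\<close>.\<close>

lemma root_of_unity_iff: "z \<in> carrier Z \<longleftrightarrow> z ^ d = 1"
  and root_of_unity_powE: "z \<in> carrier Z \<Longrightarrow> \<exists>i. z = \<zeta> ^ i"
proof -
  interpret F: field "fld :: 'k ring" by (rule field_from_type_algebra)
  interpret U: group "mult_of (fld :: 'k ring)" 
    using F.field_mult_group
    by (simp add: Ring_Divisibility.mult_of_def Multiplicative_Group.mult_of_def)
  have d: "d > 0" "U.ord \<zeta> = d" and \<zeta>: "\<zeta> \<in> carrier (mult_of fld)"
    using D by (auto simp: input_datum_def)
  have pow: "x [^]\<^bsub>mult_of fld\<^esub> (i::nat) = x ^ i" for x :: 'k and i
    by (induction i) (simp_all add: ring_of_type_algebra_def mult.commute)
  have Z: "carrier Z = range (\<lambda>i::nat. \<zeta> ^ i)"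
    using \<zeta> U.generate_pow_nat[OF \<zeta>] d
    by (auto simp: root_of_unity_grp_def carrier_subgroup_generated pow)
  then show "z \<in> carrier Z \<Longrightarrow> \<exists>i. z = \<zeta> ^ i" by auto
  have \<zeta>d: "\<zeta> ^ d = 1"
    using U.pow_ord_eq_1[OF \<zeta>] d by (simp add: pow)
  define r :: "'k poly" where "r = Polynomial.monom 1 d - 1"
  have "r \<noteq> 0" "Polynomial.degree r = d"
    using d degree_add_eq_left[of "- 1" "Polynomial.monom (1::'k) d"] degree_monom_eq[of "1::'k" d]
    by (auto simp: r_def)
  moreover have "poly r z = 0 \<longleftrightarrow> z ^ d = 1" for z
    by (simp add: r_def poly_monom)
  ultimately have fin: "finite {z::'k. z ^ d = 1}" and card: "card {z::'k. z ^ d = 1} \<le> d"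
    using poly_roots_finite[of r] card_poly_roots_bound[of r] by auto
  \<comment> \<open>The interval \<open>{0..d - 1}\<close> has exactly \<open>d\<close> elements
    because \<open>d > 0\<close>.\<close>
  have "inj_on (\<lambda>i. \<zeta> ^ i) {0..d - 1}"
    using U.ord_inj[OF \<zeta>] d by (simp add: pow)
  then have "card ((\<lambda>i. \<zeta> ^ i) ` {0..d - 1}) = d"
    using d by (simp add: card_image)
  moreover have sub: "range (\<lambda>i::nat. \<zeta> ^ i) \<subseteq> {z. z ^ d = 1}"
  proof safe
    fix i :: nat
    have "(\<zeta> ^ i) ^ d = (\<zeta> ^ d) ^ i" by (simp add: mult.commute flip: power_mult)
    then show "(\<zeta> ^ i) ^ d = 1" using \<zeta>d by simp
  qed
  ultimately have "(\<lambda>i. \<zeta> ^ i) ` {0..d - 1} = {z. z ^ d = 1}"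
    using fin card by (intro card_seteq) auto
  then have "{z. z ^ d = 1} = carrier Z" using sub Z by blast
  then show "z \<in> carrier Z \<longleftrightarrow> z ^ d = 1" by auto
qed

text \<open>Only the relation for \<zeta> itself is imposed, but an automorphism may send \<zeta> to
  another power. Adding the relation at \<open>\<zeta> ^ i\<close> times \<open>a\<close> to \<zeta>
  times the relation for \<open>\<zeta> ^ i\<close> telescopes to the one for the next power; the
  first summand requires the intermediate element to lie over a root, hence the conjunction.\<close>

lemma N_rel_pow:
  assumes "a \<in> ER"
  shows "inc (\<zeta> ^ i) \<otimes>\<^bsub>EL\<^esub> a \<in> ER \<and>
    Poly_Mapping.single (inc (\<zeta> ^ i) \<otimes>\<^bsub>EL\<^esub> a) 1 - Poly_Mapping.single a (\<zeta> ^ i) \<in> N"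
proof (induction i)
  case 0
  have "\<iota> 1 = \<one>\<^bsub>H\<^esub>"
  proof -
    have "\<iota> \<in> hom Z H" using CE[OF D] by (auto simp: central_extension_def mon_def)
    then have "\<iota> \<one>\<^bsub>Z\<^esub> = \<one>\<^bsub>H\<^esub>" by (rule hom_one) (rule groups[OF D])+
    then show ?thesis by (simp add: root_simps[OF D])
  qed
  then have "inc (\<zeta> ^ 0) \<otimes>\<^bsub>EL\<^esub> a = a"
    using assms groups(1)[OF D] by (cases a) (simp add: ext_incl_def ER_iff group.is_monoid)
  then show ?case using assms N_facts(2)[OF D] by simp
next
  case (Suc i)
  let ?b = "inc (\<zeta> ^ i) \<otimes>\<^bsub>EL\<^esub> a"
  have b: "?b \<in> ER" using Suc by simp
  have eq: "inc (\<zeta> ^ Suc i) \<otimes>\<^bsub>EL\<^esub> a = inc \<zeta> \<otimes>\<^bsub>EL\<^esub> ?b"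
    using inc_mult[OF D zeta_in[OF D] root_of_unity_pow[of i]]
      EL_assoc[OF D inc_in[OF D zeta_in[OF D]] inc_in[OF D root_of_unity_pow] ER_EL[OF D assms], of i]
    by (simp del: EL_simps')
  have "Poly_Mapping.single (inc \<zeta> \<otimes>\<^bsub>EL\<^esub> ?b) 1 - Poly_Mapping.single ?b \<zeta> +
      Poly_Mapping.map ((*) \<zeta>) (Poly_Mapping.single ?b 1 - Poly_Mapping.single a (\<zeta> ^ i)) \<in> N"
    using N_rel[OF D b] Suc N_facts(3,4)[OF D] by blast
  then show ?case
    unfolding eq using inc_zeta_root[OF D b] by (simp del: EL_simps')
qed

lemma N_rel_root_of_unity:
  assumes "a \<in> ER" "z \<in> carrier Z"
  shows "Poly_Mapping.single (inc z \<otimes>\<^bsub>EL\<^esub> a) 1 - Poly_Mapping.single a z \<in> N"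
  using N_rel_pow[OF assms(1)] root_of_unity_powE[OF assms(2)] by auto

section \<open>The underlying vector space of h\<close>

lemma h_carrierE:
  assumes "x \<in> carrier h"
  obtains f p where "x = (f, cls p)" "\<forall>y z. f (y + z) = f y + f z" "Poly_Mapping.keys p \<subseteq> ER"
  using assms by (auto simp: h_carrier[OF D])

lemma h_carrierI:
  "(\<And>y z. f (y + z) = f y + f z) \<Longrightarrow> Poly_Mapping.keys p \<subseteq> ER \<Longrightarrow> (f, cls p) \<in> carrier h"
  by (auto simp: h_carrier[OF D])

lemma h_X_carrier: "a \<in> ER \<Longrightarrow> h_X ip w \<zeta> H \<iota> \<pi> a \<in> carrier h"
  unfolding X_alt[OF D] by (rule h_carrierI) auto

lemma h_coroot_carrier: "h_coroot ip w \<zeta> H \<iota> \<pi> \<alpha> \<in> carrier h"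
  unfolding cr_alt[OF D] using ip_add by (intro h_carrierI) (auto simp: coroot_def ip_commute[of \<alpha>])

lemmas h_ops = h_simps[OF D]

lemma keys_add_ER: "Poly_Mapping.keys p \<subseteq> ER \<Longrightarrow> Poly_Mapping.keys q \<subseteq> ER \<Longrightarrow> Poly_Mapping.keys (p + q) \<subseteq> ER"
  using Poly_Mapping.keys_add[of p q] by auto

lemma keys_scale_ER:
  fixes p :: "'l \<times> 'h \<Rightarrow>\<^sub>0 'k"
  shows "Poly_Mapping.keys p \<subseteq> ER \<Longrightarrow> Poly_Mapping.keys (Poly_Mapping.map ((*) c) p) \<subseteq> ER"
  using keys_map_mult[of c p] by auto

lemma module_h: "module fld h"
proof (rule moduleI)
  show "cring (fld :: 'k ring)" by (rule cring_from_type_algebra)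
  show "abelian_group h"
  proof (rule abelian_groupI)
    fix x assume "x \<in> carrier h"
    then obtain f p where x: "x = (f, cls p)" "\<forall>y z. f (y + z) = f y + f z" "Poly_Mapping.keys p \<subseteq> ER"
      by (rule h_carrierE)
    then have "(\<lambda>y. - f y, cls (- p)) \<in> carrier h" by (intro h_carrierI) auto
    moreover have "(\<lambda>y. - f y, cls (- p)) \<oplus>\<^bsub>h\<^esub> x = \<zero>\<^bsub>h\<^esub>" by (simp add: x h_ops)
    ultimately show "\<exists>y\<in>carrier h. y \<oplus>\<^bsub>h\<^esub> x = \<zero>\<^bsub>h\<^esub>" by blast
  next
    show "\<zero>\<^bsub>h\<^esub> \<in> carrier h" unfolding h_ops by (rule h_carrierI) auto
  qed (auto elim!: h_carrierE simp: h_ops add_ac intro!: h_carrierI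
      dest!: subsetD[OF Poly_Mapping.keys_add])
qed (auto elim!: h_carrierE simp: h_ops algebra_simps map_mult_mult lookup_add
    intro!: h_carrierI keys_scale_ER poly_mapping_eqI arg_cong[of _ _ cls])

text \<open>The union over representatives follows the encoding of \<open>w_lift\<close>, so that
  \<open>w_lift_eq_twist\<close> is mere unfolding. By \<open>twist_cls\<close> all the classes
  being united coincide.\<close>

definition twist ::
    "('k \<Rightarrow> 'k) \<Rightarrow> ('l \<Rightarrow> 'l) \<Rightarrow> ('h \<Rightarrow> 'h) \<Rightarrow>
      ('l \<Rightarrow> 'k) \<times> ('l \<times> 'h \<Rightarrow>\<^sub>0 'k) set \<Rightarrow> ('l \<Rightarrow> 'k) \<times> ('l \<times> 'h \<Rightarrow>\<^sub>0 'k) set"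
  where "twist s u v = (\<lambda>(f, C). (s \<circ> f \<circ> inv_into UNIV u, \<Union>p\<in>C. cls (twist_free s u v p)))"

lemma w_lift_eq_twist: "w_lift ip w \<zeta> H \<iota> \<pi> = twist id w id"
  by (simp add: w_lift_def twist_def twist_free_def)

end

text \<open>\<open>v_class\<close> lets the pair \<open>(u, v)\<close> act on the fibre product,
  \<open>v_incl\<close> matches the \<open>s\<close>-linearity with the relations between symbols,
  and \<open>eps_equivariant\<close> takes care of the structure constants. Conditions on
  \<open>v\<close> concern the carrier of H only.\<close>

locale twisting = input_data ip w \<zeta> H \<iota> \<pi> \<epsilon> d
  for ip :: "'l::ab_group_add \<Rightarrow> 'l \<Rightarrow> int"
    and w :: "'l \<Rightarrow> 'l"
    and \<zeta> :: "'k::field_char_0"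
    and H :: "('h, 'm) monoid_scheme"
    and \<iota> :: "'k \<Rightarrow> 'h"
    and \<pi> :: "'h \<Rightarrow> 'l set"
    and \<epsilon> :: "'l \<Rightarrow> 'l \<Rightarrow> 'k"
    and d :: nat +
  fixes s :: "'k \<Rightarrow> 'k" and u :: "'l \<Rightarrow> 'l" and v :: "'h \<Rightarrow> 'h"
  assumes s_add: "s (x + y) = s x + s y"
    and s_mult: "s (x * y) = s x * s y"
    and s_one: "s 1 = 1"
    and u_bij: "bij u"
    and u_add: "u (\<alpha> + \<beta>) = u \<alpha> + u \<beta>"
    and u_ip: "ip (u \<alpha>) (u \<beta>) = ip \<alpha> \<beta>"
    and v_hom: "v \<in> hom H H"
    and v_class: "\<lbrakk>a \<in> carrier H; \<pi> a = coinv_class w \<alpha>\<rbrakk> \<Longrightarrow> \<pi> (v a) = coinv_class w (u \<alpha>)"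
    and s_root_of_unity: "z \<in> carrier Z \<Longrightarrow> s z \<in> carrier Z"
    and v_incl: "z \<in> carrier Z \<Longrightarrow> v (\<iota> z) = \<iota> (s z)"
    and eps_equivariant: "\<epsilon> (u \<alpha>) (u \<beta>) = s (\<epsilon> \<alpha> \<beta>)"
begin

section \<open>Twists on free representatives\<close>

abbreviation tw where "tw \<equiv> twist_free s u v"
abbreviation uv :: "'l \<times> 'h \<Rightarrow> 'l \<times> 'h" where "uv a \<equiv> (u (fst a), v (snd a))"

lemma s_zero [simp]: "s 0 = 0"
  using s_add[of 0 0] by (simp only: add_0_left add_cancel_right_right)

lemma u_zero: "u 0 = 0"
  using u_add[of 0 0] by simp

lemma s_uminus: "s (- x) = - s x"
  using s_add[of x "- x"] by (simp add: minus_unique)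

lemma s_of_int: "s (of_int n) = of_int n"
proof -
  have nat: "s (of_nat m) = of_nat m" for m
    by (induction m) (simp_all add: s_add s_one)
  show ?thesis by (cases n) (simp_all add: nat s_uminus del: of_nat_Suc)
qed

lemma u_eq_zero_iff: "u \<alpha> = 0 \<longleftrightarrow> \<alpha> = 0"
  using u_bij u_zero by (metis bij_is_inj injD)

lemma u_root_iff: "u \<alpha> \<in> roots ip \<longleftrightarrow> \<alpha> \<in> roots ip"
  by (simp add: roots_def u_ip)

lemma u_inv: "u (inv_into UNIV u \<alpha>) = \<alpha>"
  using u_bij by (simp add: bij_is_surj surj_f_inv_f)

lemma inv_u_add: "inv_into UNIV u (\<alpha> + \<beta>) = inv_into UNIV u \<alpha> + inv_into UNIV u \<beta>"
  using u_bij by (metis bij_is_inj inv_f_f u_add u_inv)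

lemma v_closed: "a \<in> carrier H \<Longrightarrow> v a \<in> carrier H"
  and v_mult: "a \<in> carrier H \<Longrightarrow> b \<in> carrier H \<Longrightarrow> v (a \<otimes>\<^bsub>H\<^esub> b) = v a \<otimes>\<^bsub>H\<^esub> v b"
  using v_hom by (auto simp: hom_def)

lemma uv_ER: "a \<in> ER \<Longrightarrow> uv a \<in> ER"
  by (simp add: ER_iff v_closed v_class u_root_iff)

lemma tw_add: "tw (p + q) = tw p + tw q"
  unfolding twist_free_def by (rule sum_keys_add) (auto simp: single_add s_add)

lemma tw_zero [simp]: "tw 0 = 0"
  by (simp add: twist_free_def)

lemma tw_scale: "tw (Poly_Mapping.map ((*) c) p) = Poly_Mapping.map ((*) (s c)) (tw p)"
  unfolding twist_free_def by (rule sum_keys_scale) (auto simp: s_mult)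

lemma tw_single: "tw (Poly_Mapping.single a x) = Poly_Mapping.single (uv a) (s x)"
  by (cases "x = 0") (auto simp: twist_free_def)

lemma tw_uminus: "tw (- p) = - tw p"
  using tw_add[of p "- p"] by (simp add: minus_unique)

lemma tw_diff: "tw (p - q) = tw p - tw q"
  using tw_add[of p "- q"] by (simp add: tw_uminus)

lemma tw_keys:
  assumes "Poly_Mapping.keys p \<subseteq> ER" shows "Poly_Mapping.keys (tw p) \<subseteq> ER"
  using assms
  by (induction p rule: free_induct') (simp_all add: tw_add tw_single uv_ER keys_add_ER)

text \<open>Multiplication of a symbol by the central \<zeta> turns into multiplication by
  \<open>s \<zeta>\<close>, and so does the scalar \<zeta>. The relation for \<zeta> at
  \<open>a\<close> thus becomes the relation for \<open>s \<zeta>\<close> at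
  \<open>uv a\<close>.\<close>

lemma tw_N: "p \<in> N \<Longrightarrow> tw p \<in> N"
proof (induction p rule: N_induct')
  case zero then show ?case by (simp add: N_facts[OF D])
next
  case (add p q) then show ?case by (simp add: tw_add N_facts[OF D])
next
  case (scale c p) then show ?case by (simp add: tw_scale N_facts[OF D])
next
  case (rel a)
  have "uv (inc \<zeta> \<otimes>\<^bsub>EL\<^esub> a) = inc (s \<zeta>) \<otimes>\<^bsub>EL\<^esub> uv a"
    using rel zeta_in[OF D] by (simp add: ext_incl_def ER_iff v_mult v_incl iota_in[OF D])
  then show ?case
    using N_rel_root_of_unity[OF uv_ER[OF rel] s_root_of_unity[OF zeta_in[OF D]]]
    by (simp add: tw_diff tw_single s_one del: EL_simps')
qed

lemma twist_cls: "twist s u v (f, cls p) = (s \<circ> f \<circ> inv_into UNIV u, cls (tw p))"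
proof -
  have "(\<Union>q\<in>cls p. cls (tw q)) = cls (tw p)"
    by (rule UN_cls[OF D], rule cls_eq[OF D], subst tw_diff[symmetric], rule tw_N)
      (simp add: mem_cls[OF D])
  then show ?thesis by (simp add: twist_def)
qed

lemma twist_closed:
  assumes "x \<in> carrier h" shows "twist s u v x \<in> carrier h"
proof -
  obtain f p where x: "x = (f, cls p)" "\<forall>y z. f (y + z) = f y + f z" "Poly_Mapping.keys p \<subseteq> ER"
    using assms by (rule h_carrierE)
  show ?thesis
    unfolding x(1) twist_cls
    by (rule h_carrierI[OF _ tw_keys[OF x(3)]]) (simp add: x(2) s_add inv_u_add)
qed

lemma twist_add:
  assumes "x \<in> carrier h" "y \<in> carrier h"
  shows "twist s u v (x \<oplus>\<^bsub>h\<^esub> y) = twist s u v x \<oplus>\<^bsub>h\<^esub> twist s u v y"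
  using assms by (auto elim!: h_carrierE simp: twist_cls h_ops tw_add s_add comp_def)

lemma twist_smult:
  assumes "x \<in> carrier h"
  shows "twist s u v (c \<odot>\<^bsub>h\<^esub> x) = s c \<odot>\<^bsub>h\<^esub> twist s u v x"
  using assms by (auto elim!: h_carrierE simp: twist_cls h_ops tw_scale s_mult comp_def)

text \<open>Coroots take integral values, which \<open>s\<close> fixes, and \<open>u\<close>
  preserves the form.\<close>

lemma s_coroot: "s (coroot ip \<alpha> (inv_into UNIV u x)) = coroot ip (u \<alpha>) x"
  using u_ip[of \<alpha> "inv_into UNIV u x"] by (simp add: coroot_def s_of_int u_inv)

lemma twist_coroot:
  "twist s u v (h_coroot ip w \<zeta> H \<iota> \<pi> \<alpha>) = h_coroot ip w \<zeta> H \<iota> \<pi> (u \<alpha>)"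
  by (simp add: cr_alt[OF D] twist_cls s_coroot comp_def)

lemma twist_X:
  "twist s u v (h_X ip w \<zeta> H \<iota> \<pi> a) = h_X ip w \<zeta> H \<iota> \<pi> (uv a)"
  by (simp add: X_alt[OF D] twist_cls tw_single s_one comp_def)

text \<open>The product of two elements over opposite roots lies in the central copy of the roots of
  unity, where \<open>uv\<close> restricts to \<open>s\<close>; and \<open>uv\<close> is
  multiplicative.\<close>

lemma ext_scalar_equivariant:
  assumes "a \<in> ER" "b \<in> ER" "fst a + fst b = 0"
  shows "ext_scalar \<zeta> \<iota> (uv a \<otimes>\<^bsub>EL\<^esub> uv b) = s (ext_scalar \<zeta> \<iota> (a \<otimes>\<^bsub>EL\<^esub> b))"
proof -
  have "a \<otimes>\<^bsub>EL\<^esub> b \<in> carrier EL" by (rule EL_closed[OF D]) (use assms ER_EL[OF D] in auto)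
  then have "a \<otimes>\<^bsub>EL\<^esub> b \<in> inc ` carrier Z"
    using inc_iff[OF D, of "a \<otimes>\<^bsub>EL\<^esub> b"] assms by auto
  then obtain z where z: "z \<in> carrier Z" "a \<otimes>\<^bsub>EL\<^esub> b = inc z" by blast
  have "uv a \<otimes>\<^bsub>EL\<^esub> uv b = uv (a \<otimes>\<^bsub>EL\<^esub> b)"
    using assms(1,2) by (simp add: u_add v_mult ER_iff)
  also have "\<dots> = inc (s z)"
    using z by (simp add: ext_incl_def u_zero v_incl)
  finally show ?thesis
    using z s_root_of_unity by (simp only: sc_inc[OF D])
qed

text \<open>Both sides are additive in \<open>p\<close> and in \<open>q\<close>, so two nested
  inductions reduce to single symbols. There \<epsilon>, the central scalar and the coroot are each
  equivariant.\<close>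

lemma free_bracket_t_equivariant:
  assumes "Poly_Mapping.keys p \<subseteq> ER" "Poly_Mapping.keys q \<subseteq> ER"
  shows "free_bracket_t ip w \<zeta> H \<iota> \<pi> \<epsilon> (tw p) (tw q) x =
    s (free_bracket_t ip w \<zeta> H \<iota> \<pi> \<epsilon> p q (inv_into UNIV u x))"
  using assms(1)
proof (induction p rule: free_induct')
  case (single a y)
  from assms(2) show ?case
  proof (induction q rule: free_induct')
    fix b z assume b: "b \<in> ER"
    have "gen_bracket_t ip w \<zeta> H \<iota> \<pi> \<epsilon> (uv a) (uv b) x =
        s (gen_bracket_t ip w \<zeta> H \<iota> \<pi> \<epsilon> a b (inv_into UNIV u x))"
      using ext_scalar_equivariant[OF single b]
      by (simp add: gen_bracket_t_def[OF D] s_mult s_coroot eps_equivariant u_eq_zero_iff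
          flip: u_add del: EL_simps')
    then show "free_bracket_t ip w \<zeta> H \<iota> \<pi> \<epsilon> (tw (Poly_Mapping.single a y)) (tw (Poly_Mapping.single b z)) x =
        s (free_bracket_t ip w \<zeta> H \<iota> \<pi> \<epsilon> (Poly_Mapping.single a y) (Poly_Mapping.single b z) (inv_into UNIV u x))"
      by (simp add: tw_single brt_single[OF D] s_mult)
  qed (simp_all add: zero_br[OF D] tw_add brt_add2[OF D] s_add)
qed (simp_all add: zero_br[OF D] tw_add brt_add1[OF D] s_add)

lemma free_bracket_l_equivariant:
  assumes "Poly_Mapping.keys p \<subseteq> ER" "Poly_Mapping.keys q \<subseteq> ER"
  shows "free_bracket_l ip w H \<pi> \<epsilon> (tw p) (tw q) = tw (free_bracket_l ip w H \<pi> \<epsilon> p q)"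
  using assms(1)
proof (induction p rule: free_induct')
  case (single a y)
  from assms(2) show ?case
  proof (induction q rule: free_induct')
    fix b z assume b: "b \<in> ER"
    have "gen_bracket_l ip w H \<pi> \<epsilon> (uv a) (uv b) = tw (gen_bracket_l ip w H \<pi> \<epsilon> a b)"
      using single b
      by (simp add: gen_bracket_l_def[OF D] tw_single eps_equivariant u_root_iff v_mult ER_iff flip: u_add)
    then show "free_bracket_l ip w H \<pi> \<epsilon> (tw (Poly_Mapping.single a y)) (tw (Poly_Mapping.single b z)) =
        tw (free_bracket_l ip w H \<pi> \<epsilon> (Poly_Mapping.single a y) (Poly_Mapping.single b z))"
      by (simp add: tw_single brl_single[OF D] s_mult tw_scale)
  qed (simp_all add: zero_br[OF D] tw_add brl_add2[OF D])
qed (simp_all add: zero_br[OF D] tw_add brl_add1[OF D])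

text \<open>At a symbol over \<open>u \<alpha>\<close> the transported functional takes the value
  \<open>s (f \<alpha>)\<close>, because \<open>u\<close> cancels against its inverse.\<close>

lemma free_t_action_equivariant:
  assumes "Poly_Mapping.keys p \<subseteq> ER"
  shows "free_t_action (s \<circ> f \<circ> inv_into UNIV u) (tw p) = tw (free_t_action f p)"
  using assms u_bij
  by (induction p rule: free_induct')
    (simp_all add: zero_br[OF D] tw_add tact_add[OF D] tact_single[OF D] tw_single s_mult bij_is_inj)

lemma twist_bracket:
  assumes "x \<in> carrier h" "y \<in> carrier h"
  shows "twist s u v (lie_bracket h x y) = lie_bracket h (twist s u v x) (twist s u v y)"
proof -
  obtain f p k q where x: "x = (f, cls p)" "Poly_Mapping.keys p \<subseteq> ER"
    and y: "y = (k, cls q)" "Poly_Mapping.keys q \<subseteq> ER"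
    using assms by (metis h_carrierE)
  show ?thesis
    using x(2) y(2)
    by (simp add: x(1) y(1) h_alg_def h_bracket_cls[OF D] twist_cls tw_keys tw_add tw_diff
        free_t_action_equivariant[unfolded comp_def] free_bracket_l_equivariant
        free_bracket_t_equivariant comp_def fun_eq_iff)
qed

end

section \<open>Composition of twists\<close>

context input_data
begin

abbreviation "compatible \<equiv> twisting ip w \<zeta> H \<iota> \<pi> \<epsilon> d"

lemma compatible_comp:
  assumes "compatible s u v" "compatible s' u' v'"
  shows "compatible (s \<circ> s') (u \<circ> u') (v \<circ> v')"
proof -
  interpret A: twisting ip w \<zeta> H \<iota> \<pi> \<epsilon> d s u v by fact
  interpret B: twisting ip w \<zeta> H \<iota> \<pi> \<epsilon> d s' u' v' by fact
  show ?thesis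
    by unfold_locales
      (auto simp: A.s_add B.s_add A.s_mult B.s_mult A.s_one B.s_one A.u_add B.u_add A.u_ip B.u_ip
        A.v_closed B.v_closed A.v_mult B.v_mult A.v_class B.v_class A.s_root_of_unity
        B.s_root_of_unity A.v_incl B.v_incl A.eps_equivariant B.eps_equivariant
        bij_comp A.u_bij B.u_bij hom_def)
qed

lemma twist_comp:
  assumes "compatible s u v" "compatible s' u' v'" "x \<in> carrier h"
  shows "twist s u v (twist s' u' v' x) = twist (s \<circ> s') (u \<circ> u') (v \<circ> v') x"
proof -
  interpret A: twisting ip w \<zeta> H \<iota> \<pi> \<epsilon> d s u v by fact
  interpret B: twisting ip w \<zeta> H \<iota> \<pi> \<epsilon> d s' u' v' by fact
  define s2 u2 v2 where comp: "s2 = s \<circ> s'" "u2 = u \<circ> u'" "v2 = v \<circ> v'"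
  have pt: "s2 c = s (s' c)" "u2 \<alpha> = u (u' \<alpha>)" "v2 a = v (v' a)" for c \<alpha> a
    by (simp_all add: comp)
  interpret C: twisting ip w \<zeta> H \<iota> \<pi> \<epsilon> d s2 u2 v2
    unfolding comp by (rule compatible_comp) fact+
  obtain f p where x: "x = (f, cls p)" "Poly_Mapping.keys p \<subseteq> ER"
    using assms(3) by (rule h_carrierE)
  have "A.tw (B.tw p) = C.tw p"
    using x(2)
  proof (induction p rule: free_induct')
    case (single a y)
    show ?case unfolding A.tw_single B.tw_single C.tw_single by (simp add: pt)
  qed (simp_all only: A.tw_zero B.tw_zero C.tw_zero A.tw_add B.tw_add C.tw_add)
  then have "twist s u v (twist s' u' v' x) = twist s2 u2 v2 x"
    by (simp add: x(1) A.twist_cls B.twist_cls C.twist_cls)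
      (simp add: comp o_inv_distrib[OF A.u_bij B.u_bij] comp_assoc)
  then show ?thesis by (simp only: comp)
qed

text \<open>Elements of \<open>AutoGroup H\<close> are extensional, so its unit and its products
  agree with \<open>id\<close> and \<open>\<circ>\<close> only on the carrier. Representatives of
  elements of h involve no other arguments of \<open>v\<close>.\<close>

lemma twist_cong:
  assumes "compatible s u v" "compatible s u v'" "x \<in> carrier h" "\<And>a. a \<in> carrier H \<Longrightarrow> v a = v' a"
  shows "twist s u v x = twist s u v' x"
proof -
  interpret A: twisting ip w \<zeta> H \<iota> \<pi> \<epsilon> d s u v by fact
  interpret B: twisting ip w \<zeta> H \<iota> \<pi> \<epsilon> d s u v' by fact
  obtain f p where x: "x = (f, cls p)" "Poly_Mapping.keys p \<subseteq> ER"
    using assms(3) by (rule h_carrierE)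
  have "A.tw p = B.tw p"
    unfolding twist_free_def using x(2) assms(4) by (intro sum.cong) (auto simp: ER_iff subset_iff)
  then show ?thesis by (simp add: x(1) A.twist_cls B.twist_cls)
qed

lemma compatible_id: "compatible id id id"
  by unfold_locales (auto simp: hom_def)

lemma twist_id: "x \<in> carrier h \<Longrightarrow> twist id id id x = x"
proof -
  interpret twisting ip w \<zeta> H \<iota> \<pi> \<epsilon> d id id id by (rule compatible_id)
  have "tw p = p" for p
    by (rule poly_mapping_eqI)
      (auto simp: twist_free_def lookup_sum lookup_single when_def in_keys_iff)
  then show "x \<in> carrier h \<Longrightarrow> twist id id id x = x"
    by (auto elim!: h_carrierE simp: twist_cls)
qed

text \<open>By construction w is trivial on its own coinvariants, which makes it compatible with the
  identity of H; equivariance of \<epsilon> is condition (ii) of an input datum.\<close>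

lemma compatible_w: "compatible id w id"
  using w_facts[OF D] coinv_w[OF D] D
  by unfold_locales (auto simp: hom_def input_datum_def)

lemma compatible_w_pow: "compatible id (w ^^ m) id"
proof (induction m)
  case 0 then show ?case using compatible_id by (simp add: id_def)
next
  case (Suc m) then show ?case
    using compatible_comp[OF compatible_w Suc.IH] by (simp only: id_comp funpow.simps)
qed

section \<open>The fixed subalgebra g\<close>

lemma g_carrier: "x \<in> carrier g \<longleftrightarrow> x \<in> carrier h \<and> twist id w id x = x"
  by (simp add: g_alg_def w_lift_eq_twist)

lemma twist_w_pow: "x \<in> carrier g \<Longrightarrow> twist id (w ^^ m) id x = x"
proof (induction m)
  case 0 then show ?case using twist_id by (simp add: g_carrier id_def)
next
  case (Suc m)
  then have IH: "twist id (w ^^ m) id x = x" by blast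
  have "twist id w id (twist id (w ^^ m) id x) = twist id (w ^^ Suc m) id x"
    using twist_comp[OF compatible_w compatible_w_pow, of x m] Suc.prems
    by (simp only: id_comp funpow.simps g_carrier)
  then show ?case using IH Suc.prems by (simp only: g_carrier)
qed

lemma submodule_g: "submodule (carrier g) fld h"
proof -
  interpret M: module fld h by (rule module_h)
  interpret W: twisting ip w \<zeta> H \<iota> \<pi> \<epsilon> d id w id by (rule compatible_w)
  have smult: "c \<odot>\<^bsub>h\<^esub> x \<in> carrier g" if "x \<in> carrier g" for c x
    using that M.smult_closed[of c x] by (simp add: g_carrier W.twist_smult)
  show ?thesis
  proof (rule M.submoduleI)
    have "twist id w id \<zero>\<^bsub>h\<^esub> = \<zero>\<^bsub>h\<^esub>"
      by (simp add: h_ops(3) W.twist_cls comp_def)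
    then show "\<zero>\<^bsub>h\<^esub> \<in> carrier g" by (simp add: g_carrier)
  next
    fix x assume x: "x \<in> carrier g"
    have "\<ominus>\<^bsub>h\<^esub> x = (\<ominus>\<^bsub>fld\<^esub> \<one>\<^bsub>fld\<^esub>) \<odot>\<^bsub>h\<^esub> x"
      using M.smult_l_minus[of "\<one>\<^bsub>fld\<^esub>" x] M.smult_one[of x] x by (simp add: g_carrier)
    then show "\<ominus>\<^bsub>h\<^esub> x \<in> carrier g" using smult[OF x] by simp
  next
    show "x \<oplus>\<^bsub>h\<^esub> y \<in> carrier g" if "x \<in> carrier g" "y \<in> carrier g" for x y
      using that by (simp add: g_carrier W.twist_add)
  qed (use smult in \<open>auto simp: g_alg_def\<close>)
qed

lemma module_g: "module fld g"
  using submodule.submodule_is_module[OF submodule_g module_h] by (simp add: g_alg_def)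

lemma g_ops: "x \<oplus>\<^bsub>g\<^esub> y = x \<oplus>\<^bsub>h\<^esub> y" "c \<odot>\<^bsub>g\<^esub> x = c \<odot>\<^bsub>h\<^esub> x" "lie_bracket g = lie_bracket h"
  by (simp_all add: g_alg_def)

section \<open>Closure of h and g under the bracket\<close>

lemma free_t_action_keys:
  fixes p :: "'l \<times> 'h \<Rightarrow>\<^sub>0 'k"
  shows "Poly_Mapping.keys p \<subseteq> ER \<Longrightarrow> Poly_Mapping.keys (free_t_action f p) \<subseteq> ER"
  by (induction p rule: free_induct')
    (simp_all add: zero_br[OF D] tact_add[OF D] tact_single[OF D] keys_add_ER)

lemma free_bracket_l_keys:
  assumes "Poly_Mapping.keys p \<subseteq> ER" "Poly_Mapping.keys q \<subseteq> ER"
  shows "Poly_Mapping.keys (free_bracket_l ip w H \<pi> \<epsilon> p q) \<subseteq> ER"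
  using assms(1)
proof (induction p rule: free_induct')
  case (single a y)
  from assms(2) show ?case
  proof (induction q rule: free_induct')
    fix b z assume b: "b \<in> ER"
    then have "a \<otimes>\<^bsub>EL\<^esub> b \<in> carrier EL"
      using single ER_EL[OF D] by (blast intro: EL_closed[OF D])
    then have "Poly_Mapping.keys (gen_bracket_l ip w H \<pi> \<epsilon> a b) \<subseteq> ER"
      by (auto simp: gen_bracket_l_def[OF D] ER_iff)
    then show "Poly_Mapping.keys (free_bracket_l ip w H \<pi> \<epsilon> (Poly_Mapping.single a y) (Poly_Mapping.single b z)) \<subseteq> ER"
      by (simp add: brl_single[OF D] keys_scale_ER)
  qed (simp_all add: zero_br[OF D] brl_add2[OF D] keys_add_ER)
qed (simp_all add: zero_br[OF D] brl_add1[OF D] keys_add_ER)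

text \<open>Places the t-component of a bracket in \<open>Hom(\<Lambda>, k)\<close>.\<close>

lemma free_bracket_t_additive:
  "free_bracket_t ip w \<zeta> H \<iota> \<pi> \<epsilon> p q (x + y) =
    free_bracket_t ip w \<zeta> H \<iota> \<pi> \<epsilon> p q x + free_bracket_t ip w \<zeta> H \<iota> \<pi> \<epsilon> p q y"
proof -
  have "coroot ip \<alpha> (x + y) = (coroot ip \<alpha> x + coroot ip \<alpha> y :: 'k)" for \<alpha>
    by (simp add: coroot_def ip_commute[of \<alpha>] ip_add)
  then show ?thesis
    unfolding free_bracket_t_def
    by (auto simp: sum.distrib[symmetric] algebra_simps intro!: sum.cong)
qed

lemma h_bracket_closed:
  assumes "x \<in> carrier h" "y \<in> carrier h" shows "lie_bracket h x y \<in> carrier h"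
proof -
  obtain f p k q where x: "x = (f, cls p)" "Poly_Mapping.keys p \<subseteq> ER"
    and y: "y = (k, cls q)" "Poly_Mapping.keys q \<subseteq> ER"
    using assms by (metis h_carrierE)
  have "Poly_Mapping.keys (free_t_action f q - free_t_action k p) \<subseteq> ER"
    using free_t_action_keys[OF x(2)] free_t_action_keys[OF y(2)] by (auto dest!: subsetD[OF keys_diff])
  then have "(free_bracket_t ip w \<zeta> H \<iota> \<pi> \<epsilon> p q,
      cls (free_t_action f q - free_t_action k p + free_bracket_l ip w H \<pi> \<epsilon> p q)) \<in> carrier h"
    using free_bracket_l_keys[OF x(2) y(2)]
    by (intro h_carrierI free_bracket_t_additive keys_add_ER)
  moreover have "lie_bracket h = h_bracket ip w \<zeta> H \<iota> \<pi> \<epsilon>"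
    by (simp add: h_alg_def)
  ultimately show ?thesis
    using h_bracket_cls[OF D x(2) y(2)] by (simp add: x(1) y(1))
qed

lemma g_bracket_closed:
  assumes "x \<in> carrier g" "y \<in> carrier g" shows "lie_bracket h x y \<in> carrier g"
  using assms twisting.twist_bracket[OF compatible_w, of x y] h_bracket_closed by (simp add: g_carrier)

end

section \<open>The semilinear action\<close>

lemma lattice_aut_iff:
  "f \<in> carrier (lattice_aut ip) \<longleftrightarrow>
    bij f \<and> (\<forall>x y. f (x + y) = f x + f y) \<and> (\<forall>x y. ip (f x) (f y) = ip x y)"
  by (auto simp: lattice_aut_def iso_def hom_def add_grp_def)

lemma lattice_aut_simps [simp]:
  "f \<otimes>\<^bsub>lattice_aut ip\<^esub> f' = f \<circ> f'" "\<one>\<^bsub>lattice_aut ip\<^esub> = id"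
  by (simp_all add: lattice_aut_def)

lemma group_lattice_aut: "group (lattice_aut ip)"
proof (rule groupI)
  fix f assume f: "f \<in> carrier (lattice_aut ip)"
  then have b: "bij f" by (simp add: lattice_aut_iff)
  have inv: "f (inv_into UNIV f x) = x" for x
    using b by (simp add: bij_is_surj surj_f_inv_f)
  have "inv_into UNIV f (x + y) = inv_into UNIV f x + inv_into UNIV f y" for x y
    using f by (intro inv_f_eq bij_is_inj b) (simp add: lattice_aut_iff inv)
  moreover have "ip (inv_into UNIV f x) (inv_into UNIV f y) = ip x y" for x y
  proof -
    have "ip (f (inv_into UNIV f x)) (f (inv_into UNIV f y)) = ip (inv_into UNIV f x) (inv_into UNIV f y)"
      using f unfolding lattice_aut_iff by blast
    then show ?thesis by (simp add: inv)
  qed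
  ultimately have "inv_into UNIV f \<in> carrier (lattice_aut ip)"
    using b by (simp add: lattice_aut_iff bij_imp_bij_inv)
  moreover have "inv_into UNIV f \<circ> f = id" using b by (simp add: bij_is_inj)
  ultimately show "\<exists>f'\<in>carrier (lattice_aut ip). f' \<otimes>\<^bsub>lattice_aut ip\<^esub> f = \<one>\<^bsub>lattice_aut ip\<^esub>"
    by auto
qed (auto simp: lattice_aut_iff bij_comp comp_assoc)

locale galois_input_data = input_data ip w \<zeta> H \<iota> \<pi> \<epsilon> d
  for ip :: "'l::ab_group_add \<Rightarrow> 'l \<Rightarrow> int"
    and w :: "'l \<Rightarrow> 'l"
    and \<zeta> :: "'k::field_char_0"
    and H :: "('h, 'm) monoid_scheme"
    and \<iota> :: "'k \<Rightarrow> 'h"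
    and \<pi> :: "'h \<Rightarrow> 'l set"
    and \<epsilon> :: "'l \<Rightarrow> 'l \<Rightarrow> 'k"
    and d :: nat +
  fixes k\<^sub>0 :: "'k set"
    and \<theta> :: "'k \<Rightarrow> 'l \<Rightarrow> 'l"
    and \<rho>\<^sub>\<Lambda> :: "('k \<Rightarrow> 'k) \<Rightarrow> 'l \<Rightarrow> 'l"
    and \<rho>\<^sub>H :: "('k \<Rightarrow> 'k) \<Rightarrow> 'h \<Rightarrow> 'h"
  assumes galois: "finite_galois_extension k\<^sub>0"
    and theta: "\<theta> \<in> hom (root_of_unity_grp \<zeta>) (lattice_aut ip)" "\<theta> \<zeta> = w"
    and act_lattice: "\<rho>\<^sub>\<Lambda> \<in> hom (galois_group k\<^sub>0) (lattice_aut ip)"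
    and act_H: "\<rho>\<^sub>H \<in> hom (galois_group k\<^sub>0) (AutoGroup H)"
    and A1: "\<forall>\<sigma>\<in>carrier (galois_group k\<^sub>0). \<forall>i::int.
      \<rho>\<^sub>\<Lambda> \<sigma> \<otimes>\<^bsub>lattice_aut ip\<^esub> \<theta> (\<zeta> powi i) \<otimes>\<^bsub>lattice_aut ip\<^esub> inv\<^bsub>lattice_aut ip\<^esub> (\<rho>\<^sub>\<Lambda> \<sigma>)
        = \<theta> (\<sigma> (\<zeta> powi i))"
    and A2: "\<forall>\<sigma>\<in>carrier (galois_group k\<^sub>0). \<forall>z\<in>carrier (root_of_unity_grp \<zeta>).
      \<rho>\<^sub>H \<sigma> (\<iota> z) = \<iota> (\<sigma> z)"
    and A3: "\<forall>\<sigma>\<in>carrier (galois_group k\<^sub>0). \<forall>c\<in>carrier (coinvariants w).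
      induced_map UNIV (coinv_class w) (\<rho>\<^sub>\<Lambda> \<sigma>) c = induced_map (carrier H) \<pi> (\<rho>\<^sub>H \<sigma>) c"
    and eps: "\<forall>\<sigma>\<in>carrier (galois_group k\<^sub>0). \<forall>\<alpha> \<beta>.
      \<sigma> (\<epsilon> \<alpha> \<beta>) = \<epsilon> (\<rho>\<^sub>\<Lambda> \<sigma> \<alpha>) (\<rho>\<^sub>\<Lambda> \<sigma> \<beta>)"
begin

abbreviation \<Gamma> where "\<Gamma> \<equiv> galois_group k\<^sub>0"

section \<open>The given actions on the lattice and on H\<close>

lemma w_additive: "w (x + y) = w x + w y" and w_zero: "w 0 = 0"
  using w_facts[OF D] w0[OF D] by auto

lemma rho_aut: "\<sigma> \<in> carrier \<Gamma> \<Longrightarrow> \<rho>\<^sub>\<Lambda> \<sigma> \<in> carrier (lattice_aut ip)"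
  using act_lattice by (auto simp: hom_def)

lemma rho_comp:
  "\<sigma> \<in> carrier \<Gamma> \<Longrightarrow> \<tau> \<in> carrier \<Gamma> \<Longrightarrow> \<rho>\<^sub>\<Lambda> (\<sigma> \<circ> \<tau>) = \<rho>\<^sub>\<Lambda> \<sigma> \<circ> \<rho>\<^sub>\<Lambda> \<tau>"
  using act_lattice by (auto simp: hom_def)

lemma rho_id: "\<rho>\<^sub>\<Lambda> id = id"
  using hom_one[OF act_lattice group_galois_group group_lattice_aut] by simp

lemma rhoH_auto: "\<sigma> \<in> carrier \<Gamma> \<Longrightarrow> \<rho>\<^sub>H \<sigma> \<in> auto H"
  using act_H by (auto simp: hom_def AutoGroup_def)

lemma rhoH_hom: "\<sigma> \<in> carrier \<Gamma> \<Longrightarrow> \<rho>\<^sub>H \<sigma> \<in> hom H H"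
  using rhoH_auto by (auto simp: auto_def)

lemma rhoH_comp:
  assumes "\<sigma> \<in> carrier \<Gamma>" "\<tau> \<in> carrier \<Gamma>" "a \<in> carrier H"
  shows "\<rho>\<^sub>H (\<sigma> \<circ> \<tau>) a = \<rho>\<^sub>H \<sigma> (\<rho>\<^sub>H \<tau> a)"
proof -
  have "\<rho>\<^sub>H (\<sigma> \<circ> \<tau>) = \<rho>\<^sub>H \<sigma> \<otimes>\<^bsub>AutoGroup H\<^esub> \<rho>\<^sub>H \<tau>"
    using act_H assms by (auto simp: hom_def)
  then show ?thesis
    using assms rhoH_auto by (auto simp: AutoGroup_def BijGroup_def auto_def compose_def)
qed

lemma rhoH_id: "a \<in> carrier H \<Longrightarrow> \<rho>\<^sub>H id a = a"
  using hom_one[OF act_H group_galois_group group.AutoGroup[OF groups(1)[OF D]]]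
  by (simp add: AutoGroup_def BijGroup_def)

lemma galois_root_of_unity:
  assumes "\<sigma> \<in> carrier \<Gamma>" "z \<in> carrier Z" shows "\<sigma> z \<in> carrier Z"
proof -
  have "\<sigma> (z ^ i) = \<sigma> z ^ i" for i
    using assms(1) by (induction i) (simp_all add: galois_group_iff)
  then show ?thesis
    using assms by (metis galois_group_iff root_of_unity_iff)
qed

lemma theta_pow: "\<theta> (\<zeta> ^ m) = w ^^ m"
proof (induction m)
  case 0
  show ?case using hom_one[OF theta(1) groups(2)[OF D] group_lattice_aut] by (simp add: root_simps[OF D])
next
  case (Suc m)
  then show ?case
    using hom_mult[OF theta(1) zeta_in[OF D] root_of_unity_pow[of m]] theta(2) by (simp add: root_simps[OF D])
qed

text \<open>(A1) with the inverse cleared. Exponents are kept on both sides for two uses: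
  \<open>m = 1\<close> gives the action on coinvariants, and \<open>n = 1\<close> moves a single w
  past \<sigma> in the proof that g is preserved.\<close>

lemma rho_conj:
  assumes \<sigma>: "\<sigma> \<in> carrier \<Gamma>" and m: "\<sigma> (\<zeta> ^ m) = \<zeta> ^ n"
  shows "\<rho>\<^sub>\<Lambda> \<sigma> \<circ> w ^^ m = w ^^ n \<circ> \<rho>\<^sub>\<Lambda> \<sigma>"
proof -
  interpret A: group "lattice_aut ip" by (rule group_lattice_aut)
  have \<rho>: "\<rho>\<^sub>\<Lambda> \<sigma> \<in> carrier (lattice_aut ip)" by (rule rho_aut[OF \<sigma>])
  have w: "\<theta> (\<zeta> ^ i) \<in> carrier (lattice_aut ip)" for i
    using theta(1) root_of_unity_pow[of i] by (auto simp: hom_def)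
  have "\<rho>\<^sub>\<Lambda> \<sigma> \<otimes>\<^bsub>lattice_aut ip\<^esub> \<theta> (\<zeta> ^ m) \<otimes>\<^bsub>lattice_aut ip\<^esub> inv\<^bsub>lattice_aut ip\<^esub> (\<rho>\<^sub>\<Lambda> \<sigma>) = \<theta> (\<zeta> ^ n)"
    using A1[rule_format, OF \<sigma>, of "int m"] m by simp
  then have "\<theta> (\<zeta> ^ n) \<otimes>\<^bsub>lattice_aut ip\<^esub> \<rho>\<^sub>\<Lambda> \<sigma> = \<rho>\<^sub>\<Lambda> \<sigma> \<otimes>\<^bsub>lattice_aut ip\<^esub> \<theta> (\<zeta> ^ m)"
    using A.inv_solve_right'[OF w A.m_closed[OF \<rho> w] \<rho>, of m n] by simp
  then show ?thesis by (simp add: theta_pow)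
qed

section \<open>Compatibility over the coinvariants\<close>

lemma coinv_class_eq_iff: "coinv_class w x = coinv_class w y \<longleftrightarrow> (\<exists>t. x - y = t - w t)"
proof
  assume "coinv_class w x = coinv_class w y"
  moreover have "x \<in> coinv_class w x"
    by (auto simp: coinv_class_def r_coset_def add_grp_def w_zero intro!: exI[of _ 0])
  ultimately show "\<exists>t. x - y = t - w t"
    by (auto simp: coinv_class_def r_coset_def add_grp_def)
next
  assume "\<exists>t. x - y = t - w t"
  then obtain t where t: "x = t - w t + y" by (metis diff_add_cancel)
  have w_diff: "w (a - b) = w a - w b" for a b
    using w_additive[of "a - b" b] by (simp add: algebra_simps)
  have "\<exists>b. a - w a + x = b - w b + y" for a
    by (rule exI[of _ "a + t"]) (simp add: t w_additive algebra_simps)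
  moreover have "\<exists>b. a - w a + y = b - w b + x" for a
    by (rule exI[of _ "a - t"]) (simp add: t w_diff algebra_simps)
  ultimately show "coinv_class w x = coinv_class w y"
    by (auto simp: coinv_class_def r_coset_def add_grp_def image_iff)
qed

text \<open>Conjugation by \<sigma> turns w into some power \<open>w ^^ n\<close>, and
  \<open>a - (w ^^ n) a\<close> telescopes into the image of \<open>1 - w\<close>. This makes the
  lattice side of (A3) well defined.\<close>

lemma rho_coinv_class:
  assumes \<sigma>: "\<sigma> \<in> carrier \<Gamma>" and xy: "coinv_class w x = coinv_class w y"
  shows "coinv_class w (\<rho>\<^sub>\<Lambda> \<sigma> x) = coinv_class w (\<rho>\<^sub>\<Lambda> \<sigma> y)"
proof -
  obtain t where t: "x - y = t - w t" using xy by (auto simp: coinv_class_eq_iff)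
  have add: "\<rho>\<^sub>\<Lambda> \<sigma> (a + b) = \<rho>\<^sub>\<Lambda> \<sigma> a + \<rho>\<^sub>\<Lambda> \<sigma> b" for a b
    using rho_aut[OF \<sigma>] by (simp add: lattice_aut_iff)
  have diff: "\<rho>\<^sub>\<Lambda> \<sigma> (a - b) = \<rho>\<^sub>\<Lambda> \<sigma> a - \<rho>\<^sub>\<Lambda> \<sigma> b" for a b
    using add[of "a - b" b] by (simp add: algebra_simps)
  obtain n where "\<sigma> (\<zeta> ^ 1) = \<zeta> ^ n"
    using root_of_unity_powE[OF galois_root_of_unity[OF \<sigma> zeta_in[OF D]]] by auto
  from fun_cong[OF rho_conj[OF \<sigma> this], of t]
  have n: "\<rho>\<^sub>\<Lambda> \<sigma> (w t) = (w ^^ n) (\<rho>\<^sub>\<Lambda> \<sigma> t)" by simp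
  have pow: "\<exists>b. a - (w ^^ n) a = b - w b" for a
  proof (induction n)
    case 0 show ?case by (rule exI[of _ 0]) (simp add: w_zero)
  next
    case (Suc n)
    then obtain b where "a - (w ^^ n) a = b - w b" ..
    \<comment> \<open>The new summand is \<open>1 - w\<close> applied to
      \<open>(w ^^ n) a\<close>.\<close>
    then have "a - (w ^^ Suc n) a = (b + (w ^^ n) a) - w (b + (w ^^ n) a)"
      by (simp add: w_additive algebra_simps)
    then show ?case ..
  qed
  show ?thesis
    unfolding coinv_class_eq_iff diff[symmetric] t unfolding diff n by (rule pow)
qed

text \<open>Extracts \<open>v_class\<close> from (A3). As \<open>induced_map\<close> is a
  \<open>the_elem\<close>, both sets of values must be singletons. In H, two elements over the same
  class differ by a central root of unity, which (A2) sends to another one, invisible under \<pi>;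
  in \<Lambda> this is \<open>rho_coinv_class\<close>.\<close>

lemma rho_compatible_class:
  assumes \<sigma>: "\<sigma> \<in> carrier \<Gamma>" and a: "a \<in> carrier H" "\<pi> a = coinv_class w x"
  shows "\<pi> (\<rho>\<^sub>H \<sigma> a) = coinv_class w (\<rho>\<^sub>\<Lambda> \<sigma> x)"
proof -
  interpret G: group H by (rule groups(1)[OF D])
  interpret C: group "coinvariants w" by (rule groups(3)[OF D])
  have \<pi>_hom: "\<pi> \<in> hom H (coinvariants w)"
    and ker: "kernel H (coinvariants w) \<pi> = \<iota> ` carrier Z"
    using CE[OF D] by (auto simp: central_extension_def epi_def)
  interpret P: group_hom H "coinvariants w" \<pi>
    by (intro group_hom.intro group_hom_axioms.intro G.is_group C.is_group \<pi>_hom)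
  have v_closed: "\<rho>\<^sub>H \<sigma> b \<in> carrier H" if "b \<in> carrier H" for b
    using that rhoH_hom[OF \<sigma>] by (auto simp: hom_def)
  have well_def: "\<pi> (\<rho>\<^sub>H \<sigma> b) = \<pi> (\<rho>\<^sub>H \<sigma> a)" if b: "b \<in> carrier H" "\<pi> b = \<pi> a" for b
  proof -
    have "b \<otimes>\<^bsub>H\<^esub> inv\<^bsub>H\<^esub> a \<in> kernel H (coinvariants w) \<pi>"
      using a b P.hom_closed[OF a(1)] by (simp add: kernel_def)
    then obtain z where z: "z \<in> carrier Z" "b \<otimes>\<^bsub>H\<^esub> inv\<^bsub>H\<^esub> a = \<iota> z" using ker by blast
    have "b = \<iota> z \<otimes>\<^bsub>H\<^esub> a"
      using a b z by (metis G.inv_closed G.inv_solve_right' iota_in[OF D])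
    then have "\<rho>\<^sub>H \<sigma> b = \<iota> (\<sigma> z) \<otimes>\<^bsub>H\<^esub> \<rho>\<^sub>H \<sigma> a"
      using rhoH_hom[OF \<sigma>] A2 \<sigma> z a iota_in[OF D] by (auto simp: hom_def)
    moreover have "\<pi> (\<iota> (\<sigma> z)) = \<one>\<^bsub>coinvariants w\<^esub>"
      using ker galois_root_of_unity[OF \<sigma> z(1)] by (auto simp: kernel_def)
    ultimately show ?thesis
      using a v_closed iota_in[OF D galois_root_of_unity[OF \<sigma> z(1)]] by simp
  qed
  have "\<pi> a \<in> carrier (coinvariants w)" by (rule P.hom_closed[OF a(1)])
  moreover have "induced_map (carrier H) \<pi> (\<rho>\<^sub>H \<sigma>) (\<pi> a) = \<pi> (\<rho>\<^sub>H \<sigma> a)"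
  proof -
    have "{\<pi> (\<rho>\<^sub>H \<sigma> b) |b. b \<in> carrier H \<and> \<pi> b = \<pi> a} = {\<pi> (\<rho>\<^sub>H \<sigma> a)}"
      using well_def a by blast
    then show ?thesis by (simp add: induced_map_def)
  qed
  moreover have "induced_map UNIV (coinv_class w) (\<rho>\<^sub>\<Lambda> \<sigma>) (\<pi> a) = coinv_class w (\<rho>\<^sub>\<Lambda> \<sigma> x)"
  proof -
    have "{coinv_class w (\<rho>\<^sub>\<Lambda> \<sigma> y) |y. y \<in> UNIV \<and> coinv_class w y = \<pi> a} = {coinv_class w (\<rho>\<^sub>\<Lambda> \<sigma> x)}"
      unfolding a(2) using rho_coinv_class[OF \<sigma>, of _ x] by blast
    then show ?thesis by (simp add: induced_map_def)
  qed
  ultimately show ?thesis using A3 \<sigma> by metis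
qed

lemma compatible_rho:
  assumes "\<sigma> \<in> carrier \<Gamma>" shows "compatible \<sigma> (\<rho>\<^sub>\<Lambda> \<sigma>) (\<rho>\<^sub>H \<sigma>)"
  using assms rho_aut[OF assms] rhoH_hom[OF assms] rho_compatible_class[OF assms]
    galois_root_of_unity[OF assms] A2 eps
  by unfold_locales (auto simp: galois_group_iff lattice_aut_iff)

section \<open>The Galois action on h and g\<close>

abbreviation gal_twist where "gal_twist \<sigma> \<equiv> twist \<sigma> (\<rho>\<^sub>\<Lambda> \<sigma>) (\<rho>\<^sub>H \<sigma>)"

lemma gal_twist_comp:
  assumes "\<sigma> \<in> carrier \<Gamma>" "\<tau> \<in> carrier \<Gamma>" "x \<in> carrier h"
  shows "gal_twist (\<sigma> \<circ> \<tau>) x = gal_twist \<sigma> (gal_twist \<tau> x)"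
proof -
  note comp = compatible_comp[OF compatible_rho[OF assms(1)] compatible_rho[OF assms(2)]]
  have "gal_twist \<sigma> (gal_twist \<tau> x) = twist (\<sigma> \<circ> \<tau>) (\<rho>\<^sub>\<Lambda> (\<sigma> \<circ> \<tau>)) (\<rho>\<^sub>H \<sigma> \<circ> \<rho>\<^sub>H \<tau>) x"
    using twist_comp[OF compatible_rho[OF assms(1)] compatible_rho[OF assms(2)] assms(3)]
    by (simp add: rho_comp assms)
  also have "\<dots> = gal_twist (\<sigma> \<circ> \<tau>) x"
    using compatible_rho[OF galois_group_comp[OF assms(1,2)]] comp assms
    by (intro twist_cong) (auto simp: rho_comp rhoH_comp)
  finally show ?thesis ..
qed

lemma gal_twist_id: "x \<in> carrier h \<Longrightarrow> gal_twist id x = x"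
  using twist_cong[OF _ compatible_id, of "\<rho>\<^sub>H id" x] compatible_rho[OF galois_group_id]
  by (simp add: rho_id rhoH_id twist_id)

lemma gal_twist_g:
  assumes \<sigma>: "\<sigma> \<in> carrier \<Gamma>" and x: "x \<in> carrier g"
  shows "gal_twist \<sigma> x \<in> carrier g"
proof -
  interpret S: twisting ip w \<zeta> H \<iota> \<pi> \<epsilon> d \<sigma> "\<rho>\<^sub>\<Lambda> \<sigma>" "\<rho>\<^sub>H \<sigma>" by (rule compatible_rho[OF \<sigma>])
  have xh: "x \<in> carrier h" using x by (simp add: g_carrier)
  \<comment> \<open>Choosing \<open>m\<close> through the inverse of \<sigma> places the power of w
    to the right of \<sigma>, where it acts on \<open>x\<close> directly and fixes it.\<close>
  obtain m where "inv_into UNIV \<sigma> \<zeta> = \<zeta> ^ m"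
    using root_of_unity_powE[OF galois_root_of_unity[OF galois_group_inv[OF \<sigma>] zeta_in[OF D]]] by auto
  then have "\<sigma> (\<zeta> ^ m) = \<zeta> ^ 1"
    using \<sigma> by (metis bij_is_surj galois_group_iff power_one_right surj_f_inv_f)
  from rho_conj[OF \<sigma> this] have conj: "w \<circ> \<rho>\<^sub>\<Lambda> \<sigma> = \<rho>\<^sub>\<Lambda> \<sigma> \<circ> w ^^ m" by simp
  have "twist id w id (gal_twist \<sigma> x) = twist \<sigma> (\<rho>\<^sub>\<Lambda> \<sigma> \<circ> w ^^ m) (\<rho>\<^sub>H \<sigma>) x"
    using twist_comp[OF compatible_w S.twisting_axioms xh] by (simp only: id_comp conj)
  also have "\<dots> = gal_twist \<sigma> (twist id (w ^^ m) id x)"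
    using twist_comp[OF S.twisting_axioms compatible_w_pow xh, of m] by (simp only: comp_id)
  also have "\<dots> = gal_twist \<sigma> x" by (simp only: twist_w_pow[OF x])
  finally show ?thesis using S.twist_closed[OF xh] by (simp add: g_carrier)
qed

text \<open>Restricted to the carrier because \<open>group_action\<close> takes values in
  extensional bijections.\<close>

definition act where "act \<sigma> = restrict (gal_twist \<sigma>) (carrier h)"

lemma act_eq: "x \<in> carrier h \<Longrightarrow> act \<sigma> x = gal_twist \<sigma> x"
  by (simp add: act_def)

lemma gal_twist_closed: "\<sigma> \<in> carrier \<Gamma> \<Longrightarrow> x \<in> carrier h \<Longrightarrow> gal_twist \<sigma> x \<in> carrier h"
  by (rule twisting.twist_closed[OF compatible_rho])

lemma galois_module_h: "galois_module h k\<^sub>0 act"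
  by (intro galois_module.intro galois_module_axioms.intro module_h galois)
    (simp_all add: act_eq gal_twist_closed twisting.twist_add[OF compatible_rho]
      twisting.twist_smult[OF compatible_rho] gal_twist_comp gal_twist_id
      abelian_monoid.a_closed[OF abelian_group.axioms(1)[OF module.axioms(2)[OF module_h]]]
      module.smult_closed[OF module_h])

lemma galois_module_g: "galois_module g k\<^sub>0 act"
proof -
  interpret M: galois_module h k\<^sub>0 act by (rule galois_module_h)
  have gh: "x \<in> carrier h" if "x \<in> carrier g" for x using that by (simp add: g_carrier)
  have closed: "act \<sigma> x \<in> carrier g" if "\<sigma> \<in> carrier \<Gamma>" "x \<in> carrier g" for \<sigma> x
    using that by (simp add: act_eq gh gal_twist_g)
  show ?thesis
    by (intro galois_module.intro galois_module_axioms.intro module_g galois)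
      (simp_all add: g_ops M.act_add M.act_smult M.act_comp M.act_id gh closed)
qed

lemma act_bracket:
  assumes "\<sigma> \<in> carrier \<Gamma>" "x \<in> carrier h" "y \<in> carrier h"
  shows "act \<sigma> (lie_bracket h x y) = lie_bracket h (act \<sigma> x) (act \<sigma> y)"
  using assms by (simp add: act_eq h_bracket_closed twisting.twist_bracket[OF compatible_rho])

lemma semilinear_act: "semilinear_action \<Gamma> h act"
proof -
  interpret M: galois_module h k\<^sub>0 act by (rule galois_module_h)
  have bij: "act \<sigma> \<in> Bij (carrier h)" if \<sigma>: "\<sigma> \<in> carrier \<Gamma>" for \<sigma>
  proof -
    have inv: "inv_into UNIV \<sigma> \<in> carrier \<Gamma>" by (rule galois_group_inv[OF \<sigma>])
    have b: "bij \<sigma>" using \<sigma> by (simp add: galois_group_iff)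
    have "\<sigma> \<circ> inv_into UNIV \<sigma> = id" "inv_into UNIV \<sigma> \<circ> \<sigma> = id"
      using b by (auto simp: fun_eq_iff bij_is_surj surj_f_inv_f bij_is_inj)
    then have "act \<sigma> (act (inv_into UNIV \<sigma>) x) = x" "act (inv_into UNIV \<sigma>) (act \<sigma> x) = x"
      if "x \<in> carrier h" for x
      using that M.act_comp[OF \<sigma> inv that] M.act_comp[OF inv \<sigma> that] M.act_id by simp_all
    then have "bij_betw (act \<sigma>) (carrier h) (carrier h)"
      using M.act_closed[OF \<sigma>] M.act_closed[OF inv]
      by (intro bij_betw_byWitness[where f' = "act (inv_into UNIV \<sigma>)"]) auto
    then show ?thesis by (simp add: Bij_def act_def)
  qed
  have "act (\<sigma> \<circ> \<tau>) = compose (carrier h) (act \<sigma>) (act \<tau>)"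
    if "\<sigma> \<in> carrier \<Gamma>" "\<tau> \<in> carrier \<Gamma>" for \<sigma> \<tau>
    using M.act_comp[OF that] by (auto simp: fun_eq_iff compose_def act_def)
  then have "act \<in> hom \<Gamma> (BijGroup (carrier h))"
    using bij by (auto simp: hom_def BijGroup_def)
  then have "group_action \<Gamma> (carrier h) act"
    by (intro group_action.intro group_hom.intro group_hom_axioms.intro group_galois_group group_BijGroup)
  then show ?thesis
    by (simp add: semilinear_action_def M.act_add M.act_smult)
qed

text \<open>Stability under the inverse of \<sigma> upgrades the inclusion to an equality.\<close>

lemma act_image_g: "\<sigma> \<in> carrier \<Gamma> \<Longrightarrow> act \<sigma> ` carrier g = carrier g"
proof -
  assume \<sigma>: "\<sigma> \<in> carrier \<Gamma>"
  interpret G: galois_module g k\<^sub>0 act by (rule galois_module_g)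
  have inv: "inv_into UNIV \<sigma> \<in> carrier \<Gamma>" by (rule galois_group_inv[OF \<sigma>])
  have "\<sigma> \<circ> inv_into UNIV \<sigma> = id"
    using \<sigma> by (auto simp: fun_eq_iff galois_group_iff bij_is_surj surj_f_inv_f)
  then have "act \<sigma> (act (inv_into UNIV \<sigma>) x) = x" if "x \<in> carrier g" for x
    using that G.act_comp[OF \<sigma> inv that] G.act_id by simp
  then show ?thesis
    using G.act_closed[OF \<sigma>] G.act_closed[OF inv] by force
qed

lemma is_form_h: "is_form k\<^sub>0 h (fixed_points \<Gamma> h act)"
  by (rule is_form_fixed_points[OF galois_module_h])
    (simp add: fixed_points_def act_bracket h_bracket_closed)

lemma is_form_g: "is_form k\<^sub>0 g (fixed_points \<Gamma> g act)"
proof (rule is_form_fixed_points[OF galois_module_g])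
  fix x y assume x: "x \<in> fixed_points \<Gamma> g act" and y: "y \<in> fixed_points \<Gamma> g act"
  then have "x \<in> carrier h" "y \<in> carrier h" by (simp_all add: fixed_points_def g_carrier)
  then show "lie_bracket g x y \<in> fixed_points \<Gamma> g act"
    using x y by (simp add: fixed_points_def g_ops act_bracket g_bracket_closed)
qed

end

text \<open>Naturality is expressed by the values on coroots and symbols: these span h, so with
  semilinearity they determine the action on the carrier.\<close>

theorem proposition2p7:
  fixes ip :: "'l::ab_group_add \<Rightarrow> 'l \<Rightarrow> int"
    and w :: "'l \<Rightarrow> 'l"
    and d :: nat
    and \<zeta> :: "'k::field_char_0"
    and H :: "('h, 'm) monoid_scheme"
    and \<iota> :: "'k \<Rightarrow> 'h"
    and \<pi> :: "'h \<Rightarrow> 'l set"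
    and \<epsilon> :: "'l \<Rightarrow> 'l \<Rightarrow> 'k"
    and k\<^sub>0 :: "'k set"
    and \<theta> :: "'k \<Rightarrow> 'l \<Rightarrow> 'l"
    and \<rho>\<^sub>\<Lambda> :: "('k \<Rightarrow> 'k) \<Rightarrow> 'l \<Rightarrow> 'l"
    and \<rho>\<^sub>H :: "('k \<Rightarrow> 'k) \<Rightarrow> 'h \<Rightarrow> 'h"
  assumes datum: "input_datum ip w \<zeta> H \<iota> \<pi> \<epsilon> d"
    and galois: "finite_galois_extension k\<^sub>0"
    and theta: "\<theta> \<in> hom (root_of_unity_grp \<zeta>) (lattice_aut ip)" "\<theta> \<zeta> = w"
    and act_lattice: "\<rho>\<^sub>\<Lambda> \<in> hom (galois_group k\<^sub>0) (lattice_aut ip)"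
    and act_H: "\<rho>\<^sub>H \<in> hom (galois_group k\<^sub>0) (AutoGroup H)"
    and A1: "\<forall>\<sigma>\<in>carrier (galois_group k\<^sub>0). \<forall>i::int.
      \<rho>\<^sub>\<Lambda> \<sigma> \<otimes>\<^bsub>lattice_aut ip\<^esub> \<theta> (\<zeta> powi i) \<otimes>\<^bsub>lattice_aut ip\<^esub> inv\<^bsub>lattice_aut ip\<^esub> (\<rho>\<^sub>\<Lambda> \<sigma>)
        = \<theta> (\<sigma> (\<zeta> powi i))"
    and A2: "\<forall>\<sigma>\<in>carrier (galois_group k\<^sub>0). \<forall>z\<in>carrier (root_of_unity_grp \<zeta>).
      \<rho>\<^sub>H \<sigma> (\<iota> z) = \<iota> (\<sigma> z)"
    and A3: "\<forall>\<sigma>\<in>carrier (galois_group k\<^sub>0). \<forall>c\<in>carrier (coinvariants w).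
      induced_map UNIV (coinv_class w) (\<rho>\<^sub>\<Lambda> \<sigma>) c = induced_map (carrier H) \<pi> (\<rho>\<^sub>H \<sigma>) c"
    and cond1: "\<forall>\<sigma>\<in>carrier (galois_group k\<^sub>0). \<forall>\<alpha> \<beta>.
      \<sigma> (lattice_pairing w \<zeta> H \<iota> \<pi> \<alpha> \<beta>)
        = lattice_pairing w \<zeta> H \<iota> \<pi> (\<rho>\<^sub>\<Lambda> \<sigma> \<alpha>) (\<rho>\<^sub>\<Lambda> \<sigma> \<beta>)"
    and cond2: "\<forall>\<sigma>\<in>carrier (galois_group k\<^sub>0). \<forall>\<alpha> \<beta>.
      \<sigma> (\<epsilon> \<alpha> \<beta>) = \<epsilon> (\<rho>\<^sub>\<Lambda> \<sigma> \<alpha>) (\<rho>\<^sub>\<Lambda> \<sigma> \<beta>)"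
  shows "\<exists>act.
    semilinear_action (galois_group k\<^sub>0) (h_alg ip w \<zeta> H \<iota> \<pi> \<epsilon>) act \<and>
    (\<forall>\<sigma>\<in>carrier (galois_group k\<^sub>0). \<forall>\<alpha>\<in>roots ip.
       act \<sigma> (h_coroot ip w \<zeta> H \<iota> \<pi> \<alpha>) = h_coroot ip w \<zeta> H \<iota> \<pi> (\<rho>\<^sub>\<Lambda> \<sigma> \<alpha>)) \<and>
    (\<forall>\<sigma>\<in>carrier (galois_group k\<^sub>0). \<forall>a\<in>ext_roots ip w H \<pi>.
       act \<sigma> (h_X ip w \<zeta> H \<iota> \<pi> a)
         = h_X ip w \<zeta> H \<iota> \<pi> (\<rho>\<^sub>\<Lambda> \<sigma> (fst a), \<rho>\<^sub>H \<sigma> (snd a))) \<and>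
    (\<forall>\<sigma>\<in>carrier (galois_group k\<^sub>0).
       act \<sigma> ` carrier (g_alg ip w \<zeta> H \<iota> \<pi> \<epsilon>) = carrier (g_alg ip w \<zeta> H \<iota> \<pi> \<epsilon>)) \<and>
    is_form k\<^sub>0 (h_alg ip w \<zeta> H \<iota> \<pi> \<epsilon>)
      (fixed_points (galois_group k\<^sub>0) (h_alg ip w \<zeta> H \<iota> \<pi> \<epsilon>) act) \<and>
    is_form k\<^sub>0 (g_alg ip w \<zeta> H \<iota> \<pi> \<epsilon>)
      (fixed_points (galois_group k\<^sub>0) (g_alg ip w \<zeta> H \<iota> \<pi> \<epsilon>) act)"
proof -
  interpret galois_input_data ip w \<zeta> H \<iota> \<pi> \<epsilon> d k\<^sub>0 \<theta> \<rho>\<^sub>\<Lambda> \<rho>\<^sub>H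
    by unfold_locales fact+
  have "act \<sigma> (h_coroot ip w \<zeta> H \<iota> \<pi> \<alpha>) = h_coroot ip w \<zeta> H \<iota> \<pi> (\<rho>\<^sub>\<Lambda> \<sigma> \<alpha>)"
    if "\<sigma> \<in> carrier \<Gamma>" for \<sigma> \<alpha>
    using twisting.twist_coroot[OF compatible_rho[OF that]] by (simp add: act_eq h_coroot_carrier)
  moreover have "act \<sigma> (h_X ip w \<zeta> H \<iota> \<pi> a) = h_X ip w \<zeta> H \<iota> \<pi> (\<rho>\<^sub>\<Lambda> \<sigma> (fst a), \<rho>\<^sub>H \<sigma> (snd a))"
    if "\<sigma> \<in> carrier \<Gamma>" "a \<in> ER" for \<sigma> a
    using twisting.twist_X[OF compatible_rho[OF that(1)]] that by (simp add: act_eq h_X_carrier)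
  ultimately show ?thesis
    using semilinear_act act_image_g is_form_h is_form_g by (intro exI[of _ act]) simp
qed

end
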